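(* Consider the problem \textsc{Proper-$\mathcal L$-Coloring} defined in the context. If $k=O(1)$ and $c=\operatorname{polylog}(m,n)$, then \textsc{Proper-$\mathcal L$-Coloring} can be solved in $\operatorname{quasi-poly}(m,n)$ time (i.e., time $2^{\operatorname{polylog}(m,n)}$), by a recursive algorithm whose recursion tree has depth $\operatorname{polylog}(m,n)$.
   Context: A hypergraph $\mathcal H\subseteq 2^V$ on a finite vertex set $V$ is $c$-intersecting (for an integer $c\ge 0$) if for every $H\in\mathcal H$ there are at most $c$ edges $H'\in\mathcal H$ with $H\cap H'=\emptyset$. Let $k\ge 2$, $[k]=\{1,\dots,k\}$, and let $\mathcal L:V\to 2^{[k]}$ assign to each vertex a list of admissible colors. An $\mathcal L$-coloring is a map $\chi:V\to[k]$ with $\chi(v)\in\mathcal L(v)$ for all $v$; it is proper if no edge is monochromatic, i.e. $|\chi(H)|\ge 2$ for all $H\in\mathcal H$, where $\chi(H)=\{\chi(v):v\in H\}$. The problem \textsc{Proper-$\mathcal L$-Coloring}: given a $c$-intersecting hypergraph $\mathcal H\subseteq 2^V$ and a mapping $\mathcal L:V\to 2^{[k]}$, either find a proper $\mathcal L$-coloring of $\mathcal H$ or declare that none exists. Here $n=|V|$, $m=|\mathcal H|$. Conventions: if some edge has size at most $1$, $\mathcal H$ is considered not properly $\mathcal L$-colorable; the empty hypergraph is properly $\mathcal L$-colorable; it is assumed that every list has size at least $2$. *)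

theory Defs
  imports Complex_Main "HOL-Library.FuncSet"
begin

subsection \<open>Hypergraphs and list colorings\<close>

definition c_intersecting :: "nat \<Rightarrow> 'a set set \<Rightarrow> bool" where
  "c_intersecting c E \<longleftrightarrow> (\<forall>H\<in>E. card {H'\<in>E. H \<inter> H' = {}} \<le> c)"

definition coloring_instance ::
    "nat \<Rightarrow> 'a set \<Rightarrow> 'a set set \<Rightarrow> ('a \<Rightarrow> nat set) \<Rightarrow> bool" where
  "coloring_instance k V E L \<longleftrightarrow>
     finite V \<and> E \<subseteq> Pow V \<and> (\<forall>v\<in>V. L v \<subseteq> {1..k} \<and> card (L v) \<ge> 2)"

definition list_coloring ::
    "nat \<Rightarrow> 'a set \<Rightarrow> ('a \<Rightarrow> nat set) \<Rightarrow> ('a \<Rightarrow> nat) \<Rightarrow> bool" where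
  "list_coloring k V L \<chi> \<longleftrightarrow> \<chi> \<in> V \<rightarrow> {1..k} \<and> (\<forall>v\<in>V. \<chi> v \<in> L v)"

text \<open>Edges of size at most one are never properly colored, since then \<open>card (\<chi> ` H) \<le> 1\<close>.\<close>

definition proper_list_coloring ::
    "nat \<Rightarrow> 'a set \<Rightarrow> 'a set set \<Rightarrow> ('a \<Rightarrow> nat set) \<Rightarrow> ('a \<Rightarrow> nat) \<Rightarrow> bool" where
  "proper_list_coloring k V E L \<chi> \<longleftrightarrow>
     list_coloring k V L \<chi> \<and> (\<forall>H\<in>E. card (\<chi> ` H) \<ge> 2)"

subsection \<open>Recursive programs with cost semantics\<close>

text \<open>
  The machine model is a first-order LISP: Jones's language F (one recursive function of one
  argument, working on binary trees) extended by \<open>Let\<close> and \<open>While\<close>. Loops are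
  included so that plain iteration does not count as recursion. Every construct costs one unit plus
  the cost of evaluating its parts. Values may be shared as pointers and the only test is for
  \<open>NIL\<close>, so each unit of time is a constant-time pointer operation, and this notion of time
  agrees with Turing machine time up to a polynomial.
\<close>

datatype sexp = NIL | Pair sexp sexp

text \<open>
  Variables are de Bruijn indices into the environment. \<open>While b e\<close> treats variable 0 as the loop
  state: as long as \<open>b\<close> is not \<open>NIL\<close>, the state is replaced by the value of
  \<open>e\<close>; the result is the final state. \<open>Rec e\<close> is a recursive call of the whole
  program on the value of \<open>e\<close>.
\<close>

datatype expr =
    Var nat
  | Nl
  | Cns expr expr
  | Hd expr
  | Tl expr
  | Cond expr expr expr
  | Let expr expr
  | While expr expr
  | Rec expr

text \<open>
  \<open>runs p \<rho> e v t d\<close>: for the program \<open>p\<close>, in the environment \<open>\<rho>\<close>, the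
  expression \<open>e\<close> evaluates to \<open>v\<close> in time \<open>t\<close>, and \<open>d\<close> is the maximal number of
  nested recursive calls, i.e. the depth of the tree of recursive calls.
\<close>

inductive runs :: "expr \<Rightarrow> sexp list \<Rightarrow> expr \<Rightarrow> sexp \<Rightarrow> nat \<Rightarrow> nat \<Rightarrow> bool" for p where
  Var: "i < length \<rho> \<Longrightarrow> runs p \<rho> (Var i) (\<rho> ! i) 1 0"
| Nl: "runs p \<rho> Nl NIL 1 0"
| Cns: "\<lbrakk>runs p \<rho> e1 v1 t1 d1; runs p \<rho> e2 v2 t2 d2\<rbrakk>
    \<Longrightarrow> runs p \<rho> (Cns e1 e2) (Pair v1 v2) (t1 + t2 + 1) (max d1 d2)"
| Hd: "runs p \<rho> e (Pair v1 v2) t d \<Longrightarrow> runs p \<rho> (Hd e) v1 (t + 1) d"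
| Hd_NIL: "runs p \<rho> e NIL t d \<Longrightarrow> runs p \<rho> (Hd e) NIL (t + 1) d"
| Tl: "runs p \<rho> e (Pair v1 v2) t d \<Longrightarrow> runs p \<rho> (Tl e) v2 (t + 1) d"
| Tl_NIL: "runs p \<rho> e NIL t d \<Longrightarrow> runs p \<rho> (Tl e) NIL (t + 1) d"
| Cond_True: "\<lbrakk>runs p \<rho> e v t d; v \<noteq> NIL; runs p \<rho> e1 v1 t1 d1\<rbrakk>
    \<Longrightarrow> runs p \<rho> (Cond e e1 e2) v1 (t + t1 + 1) (max d d1)"
| Cond_False: "\<lbrakk>runs p \<rho> e NIL t d; runs p \<rho> e2 v2 t2 d2\<rbrakk>
    \<Longrightarrow> runs p \<rho> (Cond e e1 e2) v2 (t + t2 + 1) (max d d2)"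
| Let: "\<lbrakk>runs p \<rho> e1 v1 t1 d1; runs p (v1 # \<rho>) e2 v2 t2 d2\<rbrakk>
    \<Longrightarrow> runs p \<rho> (Let e1 e2) v2 (t1 + t2 + 1) (max d1 d2)"
| While_False: "runs p (s # \<rho>) b NIL t d \<Longrightarrow> runs p (s # \<rho>) (While b e) s (t + 1) d"
| While_True: "\<lbrakk>runs p (s # \<rho>) b v t d; v \<noteq> NIL; runs p (s # \<rho>) e s' t1 d1;
      runs p (s' # \<rho>) (While b e) w t2 d2\<rbrakk>
    \<Longrightarrow> runs p (s # \<rho>) (While b e) w (t + t1 + t2 + 1) (max d (max d1 d2))"
| Rec: "\<lbrakk>runs p \<rho> e v t1 d1; runs p [v] p w t2 d2\<rbrakk>
    \<Longrightarrow> runs p \<rho> (Rec e) w (t1 + t2 + 1) (max d1 (Suc d2))"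

text \<open>Evaluation is deterministic, so result, time and recursion depth are well-defined.\<close>

lemma runs_deterministic:
  "runs p \<rho> e v t d \<Longrightarrow> runs p \<rho> e v' t' d' \<Longrightarrow> v' = v \<and> t' = t \<and> d' = d"
proof (induction arbitrary: v' t' d' rule: runs.induct)
  case (While_True s \<rho> b v t d e s' t1 d1 w t2 d2)
  from While_True.prems show ?case
    by cases (use While_True.IH While_True.hyps in blast)+
next
  case (Cond_True \<rho> e v t d e1 v1 t1 d1 e2)
  from Cond_True.prems show ?case
    by cases (use Cond_True.IH Cond_True.hyps in blast)+
qed (erule runs.cases; blast)+

subsection \<open>Encoding of instances and answers\<close>

definition enc_list :: "sexp list \<Rightarrow> sexp" where
  "enc_list xs = foldr Pair xs NIL"

definition enc_bool :: "bool \<Rightarrow> sexp" where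
  "enc_bool b = (if b then Pair NIL NIL else NIL)"

definition enc_nat :: "nat \<Rightarrow> sexp" where
  "enc_nat i = enc_list (replicate i NIL)"

text \<open>
  \<open>vs\<close> and \<open>es\<close> enumerate the vertices and edges. The input consists of the
  \<open>n \<times> k\<close> zero-one matrix of admissible colors and the \<open>m \<times> n\<close> incidence matrix.
\<close>

definition enc_instance ::
    "nat \<Rightarrow> 'a list \<Rightarrow> 'a set list \<Rightarrow> ('a \<Rightarrow> nat set) \<Rightarrow> sexp" where
  "enc_instance k vs es L =
     Pair (enc_list (map (\<lambda>v. enc_list (map (\<lambda>i. enc_bool (i \<in> L v)) [1..<k + 1])) vs))
          (enc_list (map (\<lambda>H. enc_list (map (\<lambda>v. enc_bool (v \<in> H)) vs)) es))"

definition enc_coloring :: "'a list \<Rightarrow> ('a \<Rightarrow> nat) \<Rightarrow> sexp" where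
  "enc_coloring vs \<chi> = Pair NIL (enc_list (map (\<lambda>v. enc_nat (\<chi> v)) vs))"

definition correct_answer ::
    "nat \<Rightarrow> 'a list \<Rightarrow> 'a set set \<Rightarrow> ('a \<Rightarrow> nat set) \<Rightarrow> sexp \<Rightarrow> bool" where
  "correct_answer k vs E L out \<longleftrightarrow>
     (\<exists>\<chi>. proper_list_coloring k (set vs) E L \<chi> \<and> out = enc_coloring vs \<chi>) \<or>
     (\<nexists>\<chi>. proper_list_coloring k (set vs) E L \<chi>) \<and> out = NIL"

text \<open>
  The argument order of the bounds \<open>c\<close>, \<open>T\<close>, \<open>D\<close> is number of edges, number of vertices.
  Vertices are natural numbers without loss of generality: the encoding does not depend on names.
\<close>

definition solves_proper_list_coloring ::
    "expr \<Rightarrow> nat \<Rightarrow> (nat \<Rightarrow> nat \<Rightarrow> nat) \<Rightarrow> (nat \<Rightarrow> nat \<Rightarrow> real) \<Rightarrow> (nat \<Rightarrow> nat \<Rightarrow> real) \<Rightarrow> bool" where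
  "solves_proper_list_coloring p k c T D \<longleftrightarrow>
     (\<forall>(V :: nat set) E L vs es.
        coloring_instance k V E L \<and> c_intersecting (c (card E) (card V)) E \<and>
        distinct vs \<and> set vs = V \<and> distinct es \<and> set es = E \<longrightarrow>
        (\<exists>out t d. runs p [enc_instance k vs es L] p out t d \<and>
           correct_answer k vs E L out \<and>
           real t \<le> T (card E) (card V) \<and> real d \<le> D (card E) (card V)))"

subsection \<open>Growth rates\<close>

text \<open>The summand 2 makes the logarithm at least 1, so constants are polylogarithmic everywhere.\<close>

definition polylog :: "(nat \<Rightarrow> nat \<Rightarrow> real) \<Rightarrow> bool" where
  "polylog f \<longleftrightarrow> (\<exists>A a. \<forall>m n. f m n \<le> A * log 2 (real (m + n + 2)) ^ a)"

definition quasi_poly :: "(nat \<Rightarrow> nat \<Rightarrow> real) \<Rightarrow> bool" where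
  "quasi_poly T \<longleftrightarrow> (\<exists>g. polylog g \<and> (\<forall>m n. T m n \<le> 2 powr g m n))"

end

theory Submission imports Defs begin

text \<open>
  Let \<open>S v\<close> be the set of colors still allowed at \<open>v\<close>, and call an edge live for color \<open>i\<close> if all
  its vertices allow \<open>i\<close>. If every edge that is live for some color has more than \<open>s \<approx> log (k m)\<close>
  undecided vertices, a random choice from the lists is proper with positive probability. Otherwise take
  an edge \<open>h\<close>, live for \<open>i\<close>, with at most \<open>s\<close> undecided vertices. All but \<open>c\<close> of the edges live
  for another color \<open>j\<close> meet \<open>h\<close> in an undecided vertex, so some vertex \<open>v\<close> of \<open>h\<close> lies on a
  fraction of about \<open>1/s\<close> of them. Branch on \<open>v\<close>: removing \<open>j\<close> from \<open>S v\<close> kills these edges, and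
  is done by a recursive call; setting \<open>S v = {j}\<close> decides a vertex, and is done by iterating a loop at
  most \<open>n\<close> times. The potential \<open>\<Sum>j<k. ln (|live j| + c)\<close> bounds the depth of recursion by
  \<open>O(k s c log (m + c))\<close>. A coloring is found by fixing the colors one by one while the instance stays
  colorable.
\<close>

subsection \<open>Evaluation within bounds\<close>

text \<open>The estimate \<open>|live j| \<le> c + s * d\<close>, with \<open>d\<close> the largest
  degree, promises nothing once \<open>|live j|\<close> is near \<open>c\<close>. Putting
  \<open>c\<close> inside the logarithm makes the loss of even one edge a relative decrease there,
  at the price of a factor \<open>c\<close> in the depth. The two branches are treated differently
  because setting \<open>S v = {j}\<close> may remove as little as the one edge \<open>h\<close>
  from those live for \<open>i\<close>. Such steps can be as many as the vertices, so they must not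
  nest. One call makes at most \<open>n + 1\<close> rounds with at most one recursive call each, so
  the time is a polynomial raised to the depth plus one. The random choice serves only to prove
  existence: the decision procedure just answers yes, and the search extracts colors by further
  decision calls. A program is a single recursive function, so decision and search share it and are
  told apart by the shape of the argument. The selection rules are formulas over index ranges,
  translated to programs once and for all with a polynomial cost bound for every fixed formula.
  Recomputing a choice wherever it occurs is then harmless.\<close>

definition evals :: "expr \<Rightarrow> sexp list \<Rightarrow> expr \<Rightarrow> sexp \<Rightarrow> nat \<Rightarrow> nat \<Rightarrow> bool" where
  "evals p \<rho> e v T D \<longleftrightarrow> (\<exists>t d. runs p \<rho> e v t d \<and> t \<le> T \<and> d \<le> D)"

lemma evals_mono: "evals p \<rho> e v T D \<Longrightarrow> T \<le> T' \<Longrightarrow> D \<le> D' \<Longrightarrow> evals p \<rho> e v T' D'"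
  unfolding evals_def by (meson order_trans)

lemma evals_eq: "evals p \<rho> e v T D \<Longrightarrow> v = w \<Longrightarrow> evals p \<rho> e w T D"
  by simp

fun hd_s :: "sexp \<Rightarrow> sexp" where
  "hd_s NIL = NIL" | "hd_s (Pair a b) = a"

fun tl_s :: "sexp \<Rightarrow> sexp" where
  "tl_s NIL = NIL" | "tl_s (Pair a b) = b"

lemma evals_Var: "i < length \<rho> \<Longrightarrow> \<rho> ! i = v \<Longrightarrow> evals p \<rho> (Var i) v 1 D"
  unfolding evals_def using runs.Var by blast

lemma evals_Nl: "evals p \<rho> Nl NIL 1 D"
  unfolding evals_def using runs.Nl by blast

lemma evals_Cns:
  assumes "evals p \<rho> e1 v1 T1 D" "evals p \<rho> e2 v2 T2 D"
  shows "evals p \<rho> (Cns e1 e2) (Pair v1 v2) (T1 + T2 + 1) D"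
proof -
  obtain t1 d1 t2 d2 where "runs p \<rho> e1 v1 t1 d1" "t1 \<le> T1" "d1 \<le> D"
    "runs p \<rho> e2 v2 t2 d2" "t2 \<le> T2" "d2 \<le> D" using assms unfolding evals_def by blast
  then show ?thesis unfolding evals_def
    by (intro exI[of _ "t1+t2+1"] exI[of _ "max d1 d2"]) (use runs.Cns in auto)
qed

lemma evals_Hd:
  assumes "evals p \<rho> e v T D" "w = hd_s v"
  shows "evals p \<rho> (Hd e) w (T + 1) D"
proof -
  obtain t d where r: "runs p \<rho> e v t d" and "t \<le> T" "d \<le> D"
    using assms unfolding evals_def by blast
  moreover have "runs p \<rho> (Hd e) w (t + 1) d"
    using r assms(2) runs.Hd runs.Hd_NIL by (cases v) (simp_all only: hd_s.simps)
  ultimately show ?thesis unfolding evals_def by (meson add_le_mono1)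
qed

lemma evals_Tl:
  assumes "evals p \<rho> e v T D" "w = tl_s v"
  shows "evals p \<rho> (Tl e) w (T + 1) D"
proof -
  obtain t d where r: "runs p \<rho> e v t d" and "t \<le> T" "d \<le> D"
    using assms unfolding evals_def by blast
  moreover have "runs p \<rho> (Tl e) w (t + 1) d"
    using r assms(2) runs.Tl runs.Tl_NIL by (cases v) (simp_all only: tl_s.simps)
  ultimately show ?thesis unfolding evals_def by (meson add_le_mono1)
qed

lemma evals_Cond:
  assumes "evals p \<rho> e v T D" "v \<noteq> NIL \<Longrightarrow> evals p \<rho> e1 w T1 D" "v = NIL \<Longrightarrow> evals p \<rho> e2 w T2 D"
  shows "evals p \<rho> (Cond e e1 e2) w (T + T1 + T2 + 1) D"
proof (cases "v = NIL")
  case True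
  then obtain t d t2 d2 where "runs p \<rho> e NIL t d" "t \<le> T" "d \<le> D"
    "runs p \<rho> e2 w t2 d2" "t2 \<le> T2" "d2 \<le> D" using assms unfolding evals_def by blast
  then show ?thesis unfolding evals_def
    by (intro exI[of _ "t+t2+1"] exI[of _ "max d d2"]) (use runs.Cond_False in auto)
next
  case False
  then obtain t d t2 d2 where "runs p \<rho> e v t d" "t \<le> T" "d \<le> D"
    "runs p \<rho> e1 w t2 d2" "t2 \<le> T1" "d2 \<le> D" using assms unfolding evals_def by blast
  then show ?thesis unfolding evals_def
    by (intro exI[of _ "t+t2+1"] exI[of _ "max d d2"]) (use runs.Cond_True False in auto)
qed

lemma evals_CondT:
  "evals p \<rho> e v T D \<Longrightarrow> v \<noteq> NIL \<Longrightarrow> evals p \<rho> e1 w T1 D \<Longrightarrow> evals p \<rho> (Cond e e1 e2) w (T + T1 + 1) D"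
  using evals_Cond[where ?T2.0 = 0] by fastforce

lemma evals_CondF:
  "evals p \<rho> e NIL T D \<Longrightarrow> evals p \<rho> e2 w T2 D \<Longrightarrow> evals p \<rho> (Cond e e1 e2) w (T + T2 + 1) D"
  using evals_Cond[where ?T1.0 = 0] by fastforce

lemma evals_Let:
  assumes "evals p \<rho> e1 v1 T1 D" "evals p (v1 # \<rho>) e2 v2 T2 D"
  shows "evals p \<rho> (Let e1 e2) v2 (T1 + T2 + 1) D"
proof -
  obtain t1 d1 t2 d2 where "runs p \<rho> e1 v1 t1 d1" "t1 \<le> T1" "d1 \<le> D"
    "runs p (v1 # \<rho>) e2 v2 t2 d2" "t2 \<le> T2" "d2 \<le> D" using assms unfolding evals_def by blast
  then show ?thesis unfolding evals_def
    by (intro exI[of _ "t1+t2+1"] exI[of _ "max d1 d2"]) (use runs.Let in auto)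
qed

lemma evals_Rec:
  assumes "evals p \<rho> e v T1 (Suc D)" "evals p [v] p w T2 D"
  shows "evals p \<rho> (Rec e) w (T1 + T2 + 1) (Suc D)"
proof -
  obtain t1 d1 t2 d2 where "runs p \<rho> e v t1 d1" "t1 \<le> T1" "d1 \<le> Suc D"
    "runs p [v] p w t2 d2" "t2 \<le> T2" "d2 \<le> D" using assms unfolding evals_def by blast
  then show ?thesis unfolding evals_def
    by (intro exI[of _ "t1+t2+1"] exI[of _ "max d1 (Suc d2)"]) (use runs.Rec in auto)
qed

subsection \<open>Folding over lists\<close>

text \<open>The loop state pairs the unread part of the list with the accumulator; inside \<open>body\<close> it is
  variable 0, so the current element is \<open>Hd (Hd (Var 0))\<close> and the accumulator \<open>Tl (Var 0)\<close>.\<close>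

definition Fold :: "expr \<Rightarrow> expr \<Rightarrow> expr \<Rightarrow> expr" where
  "Fold xs ini body =
     Let (Cns xs ini) (Tl (While (Hd (Var 0)) (Cns (Tl (Hd (Var 0))) body)))"

lemma enc_list_simps [simp]:
  "enc_list [] = NIL" "enc_list (x # xs) = Pair x (enc_list xs)"
  by (simp_all add: enc_list_def)

lemma enc_nat_simps [simp]: "enc_nat 0 = NIL" "enc_nat (Suc i) = Pair NIL (enc_nat i)"
  by (simp_all add: enc_nat_def)

lemma enc_nat_eq_NIL [simp]: "enc_nat i = NIL \<longleftrightarrow> i = 0"
  by (cases i) auto

text \<open>Each iteration adds 7 to the cost \<open>T\<close> of \<open>body\<close>: 2 for the
  test \<open>Hd (Var 0)\<close>, 3 for \<open>Tl (Hd (Var 0))\<close>, and 1 each for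
  \<open>Cns\<close> and \<open>While\<close>. The failing test at the end costs 3. An invariant
  takes the place of a step function because the result of a recursive call inside
  \<open>body\<close> is known only up to a property.\<close>

lemma evals_while:
  assumes step: "\<And>i acc. i < length l \<Longrightarrow> Inv i acc \<Longrightarrow>
    \<exists>acc'. evals p (Pair (enc_list (drop i l)) acc # \<rho>) body acc' T D \<and> Inv (Suc i) acc'"
  shows "i \<le> length l \<Longrightarrow> Inv i a \<Longrightarrow>
    \<exists>r. evals p (Pair (enc_list (drop i l)) a # \<rho>)
      (While (Hd (Var 0)) (Cns (Tl (Hd (Var 0))) body)) (Pair NIL r) ((length l - i) * (T + 7) + 3) D
      \<and> Inv (length l) r"
proof (induction "length l - i" arbitrary: i a)
  case 0
  then have i: "i = length l" by simp
  have "runs p (Pair NIL a # \<rho>) (Hd (Var 0)) NIL 2 0"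
    using runs.Hd[OF runs.Var[of 0 "Pair NIL a # \<rho>" p, simplified]] by (simp add: numeral_2_eq_2)
  from runs.While_False[OF this, of "Cns (Tl (Hd (Var 0))) body"] show ?case
    using 0 i unfolding evals_def by (intro exI[of _ a]) (auto intro!: exI)
next
  case (Suc x)
  then have i: "i < length l" by simp
  let ?s = "Pair (enc_list (drop i l)) a"
  from step[OF i] Suc.prems obtain a' where
    a': "evals p (?s # \<rho>) body a' T D" and inv: "Inv (Suc i) a'" by blast
  have "x = length l - Suc i" using Suc.hyps(2) by simp
  from Suc.hyps(1)[OF this] i inv obtain r where
    r: "evals p (Pair (enc_list (drop (Suc i) l)) a' # \<rho>)
      (While (Hd (Var 0)) (Cns (Tl (Hd (Var 0))) body)) (Pair NIL r) ((length l - Suc i) * (T + 7) + 3) D"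
    and invr: "Inv (length l) r" by (meson Suc_leI)
  have d: "drop i l = l ! i # drop (Suc i) l" using i by (simp add: Cons_nth_drop_Suc)
  have h: "runs p (?s # \<rho>) (Hd (Var 0)) (enc_list (drop i l)) 2 0"
    using runs.Hd[OF runs.Var[of 0 "?s # \<rho>" p, simplified]] by (simp add: numeral_2_eq_2)
  have ne: "enc_list (drop i l) \<noteq> NIL" by (simp add: d)
  have "evals p (?s # \<rho>) (Cns (Tl (Hd (Var 0))) body) (Pair (enc_list (drop (Suc i) l)) a') (3 + T + 1) D"
    using evals_Cns[OF evals_Tl[OF evals_Hd[OF evals_Var[of 0 "?s # \<rho>" ?s p D] refl] refl] a'] d
    by (simp add: eval_nat_numeral)
  then obtain t1 d1 where 1: "runs p (?s # \<rho>) (Cns (Tl (Hd (Var 0))) body)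
    (Pair (enc_list (drop (Suc i) l)) a') t1 d1" "t1 \<le> T + 4" "d1 \<le> D"
    unfolding evals_def by (auto simp: algebra_simps)
  from r obtain t2 d2 where 2: "runs p (Pair (enc_list (drop (Suc i) l)) a' # \<rho>)
      (While (Hd (Var 0)) (Cns (Tl (Hd (Var 0))) body)) (Pair NIL r) t2 d2"
      "t2 \<le> (length l - Suc i) * (T + 7) + 3" "d2 \<le> D" unfolding evals_def by auto
  have "length l - i = Suc (length l - Suc i)" using i by simp
  then have "2 + t1 + t2 + 1 \<le> (length l - i) * (T + 7) + 3"
    using 1 2 by simp
  moreover have "max 0 (max d1 d2) \<le> D" using 1(3) 2(3) by simp
  ultimately show ?case using runs.While_True[OF h ne 1(1) 2(1)] invr
    unfolding evals_def by blast
qed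

lemma evals_Fold_inv:
  assumes "evals p \<rho> xs (enc_list l) T1 D" "evals p \<rho> ini a T2 D" "Inv 0 a"
    and "\<And>i acc. i < length l \<Longrightarrow> Inv i acc \<Longrightarrow>
      \<exists>acc'. evals p (Pair (enc_list (drop i l)) acc # \<rho>) body acc' T D \<and> Inv (Suc i) acc'"
  shows "\<exists>r. evals p \<rho> (Fold xs ini body) r (T1 + T2 + length l * (T + 7) + 6) D \<and> Inv (length l) r"
proof -
  from evals_while[of l Inv p \<rho> body T D 0 a, OF assms(4)] assms(3) obtain r where
    r: "evals p (Pair (enc_list l) a # \<rho>)
      (While (Hd (Var 0)) (Cns (Tl (Hd (Var 0))) body)) (Pair NIL r) (length l * (T + 7) + 3) D"
    and inv: "Inv (length l) r" by auto
  have "evals p \<rho> (Fold xs ini body) r (T1 + T2 + length l * (T + 7) + 6) D"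
    unfolding Fold_def
    by (rule evals_mono[OF evals_Let[OF evals_Cns[OF assms(1,2)] evals_Tl[OF r]]]) auto
  with inv show ?thesis by blast
qed

lemma evals_Fold:
  assumes "evals p \<rho> xs (enc_list l) T1 D" "evals p \<rho> ini a T2 D"
    and body: "\<And>x acc rest. x \<in> set l \<Longrightarrow> evals p (Pair (Pair x rest) acc # \<rho>) body (g x acc) T D"
  shows "evals p \<rho> (Fold xs ini body) (fold g l a) (T1 + T2 + length l * (T + 7) + 6) D"
proof -
  have step: "\<exists>acc'. evals p (Pair (enc_list (drop i l)) acc # \<rho>) body acc' T D
      \<and> acc' = fold g (take (Suc i) l) a"
    if "i < length l" "acc = fold g (take i l) a" for i acc
  proof -
    have "drop i l = l ! i # drop (Suc i) l" using that by (simp add: Cons_nth_drop_Suc)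
    then show ?thesis using body[of "l ! i" "enc_list (drop (Suc i) l)" acc] that
      by (simp add: take_Suc_conv_app_nth)
  qed
  have "\<exists>r. evals p \<rho> (Fold xs ini body) r (T1 + T2 + length l * (T + 7) + 6) D
      \<and> r = fold g (take (length l) l) a"
    by (rule evals_Fold_inv[OF assms(1,2)]) (use step in auto)
  then show ?thesis by simp
qed

text \<open>The order is decreasing so that a loop which prepends builds its list in increasing
  order, and a loop which overwrites its accumulator ends with the least hit.\<close>

definition rng :: "nat \<Rightarrow> sexp" where
  "rng r = enc_list (map enc_nat (rev [0..<r]))"

lemma evals_Fold_rng:
  assumes "evals p \<rho> xs (rng r) T1 D" "evals p \<rho> ini a T2 D"
    and body: "\<And>x acc rest. x < r \<Longrightarrow>
      evals p (Pair (Pair (enc_nat x) rest) acc # \<rho>) body (g x acc) T D"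
  shows "evals p \<rho> (Fold xs ini body) (foldr g [0..<r] a) (T1 + T2 + r * (T + 7) + 6) D"
proof -
  \<comment> \<open>The loop sees encodings while \<open>g\<close> takes numbers; decoding mediates
    between the two.\<close>
  define dec where "dec = (inv enc_nat)"
  have inj: "inj enc_nat"
  proof (rule injI)
    fix x y show "enc_nat x = enc_nat y \<Longrightarrow> x = y"
    proof (induction x arbitrary: y)
      case (Suc x) then show ?case by (cases y) auto
    qed (metis enc_nat_eq_NIL enc_nat_simps(1))
  qed
  have dec: "dec (enc_nat x) = x" for x unfolding dec_def using inj by simp
  have "evals p \<rho> (Fold xs ini body) (fold (g \<circ> dec) (map enc_nat (rev [0..<r])) a)
    (T1 + T2 + length (map enc_nat (rev [0..<r])) * (T + 7) + 6) D"
    by (rule evals_Fold[OF assms(1)[unfolded rng_def] assms(2)]) (use body dec in auto)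
  moreover have "fold (g \<circ> dec) (map enc_nat xs) a = fold g xs a" for xs
    by (induction xs arbitrary: a) (auto simp: dec)
  ultimately show ?thesis by (simp add: foldr_conv_fold)
qed

text \<open>The unary number \<open>i\<close> is itself the list that drives the loop. The same
  program indexes into lists and subtracts unary numbers.\<close>

definition Drop :: "expr \<Rightarrow> expr \<Rightarrow> expr" where
  "Drop i xs = Fold i xs (Tl (Tl (Var 0)))"

lemma evals_Drop:
  assumes "evals p \<rho> i (enc_nat a) T1 D" "evals p \<rho> xs v T2 D" "a \<le> N"
  shows "evals p \<rho> (Drop i xs) ((tl_s ^^ a) v) (T1 + T2 + N * 10 + 6) D"
proof -
  have f: "fold (\<lambda>x. tl_s) (replicate b NIL) v = (tl_s ^^ b) v" for b v
    by (induction b arbitrary: v) (auto simp: funpow_swap1)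
  have "evals p \<rho> (Drop i xs) (fold (\<lambda>x. tl_s) (replicate a NIL) v)
      (T1 + T2 + length (replicate a NIL) * (3 + 7) + 6) D"
    unfolding Drop_def
    by (rule evals_Fold) (use assms in \<open>auto simp: enc_nat_def intro!: evals_mono[OF evals_Tl[OF evals_Tl[OF evals_Var]]]\<close>)
  then show ?thesis unfolding f by (rule evals_mono) (use assms in auto)
qed

lemma tl_s_enc_list: "(tl_s ^^ a) (enc_list xs) = enc_list (drop a xs)"
proof (induction a arbitrary: xs)
  case (Suc a)
  have "tl_s (enc_list xs) = enc_list (tl xs)" by (cases xs) auto
  then show ?case by (simp only: funpow_Suc_right o_apply Suc drop_Suc)
qed auto

lemma hd_s_enc_list: "hd_s (enc_list xs) = (if xs = [] then NIL else hd xs)"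
  by (cases xs) auto

definition Nth :: "expr \<Rightarrow> expr \<Rightarrow> expr" where
  "Nth xs i = Hd (Drop i xs)"

lemma evals_Nth:
  assumes "evals p \<rho> i (enc_nat a) T1 D" "evals p \<rho> xs (enc_list l) T2 D" "a \<le> N"
    and "v = (if a < length l then l ! a else NIL)"
  shows "evals p \<rho> (Nth xs i) v (T1 + T2 + N * 10 + 7) D"
  unfolding Nth_def
  by (rule evals_mono[OF evals_Hd[OF evals_Drop[OF assms(1-3)]]])
    (auto simp: tl_s_enc_list hd_s_enc_list assms(4) hd_drop_conv_nth)

definition mat :: "nat \<Rightarrow> nat \<Rightarrow> (nat \<Rightarrow> nat \<Rightarrow> bool) \<Rightarrow> sexp" where
  "mat r c P = enc_list (map (\<lambda>a. enc_list (map (\<lambda>b. enc_bool (P a b)) [0..<c])) [0..<r])"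

lemma enc_bool_nat: "enc_bool b = enc_nat (of_bool b)"
  by (auto simp: enc_bool_def)

text \<open>\<open>Hd\<close> and \<open>Tl\<close> of \<open>NIL\<close> are \<open>NIL\<close>, so
  an index out of range reads as false without any range check in the program. Hence the bounds
  inside the resulting truth value.\<close>

lemma evals_Nth_Nth:
  assumes "evals p \<rho> i (enc_nat a) T1 D" "evals p \<rho> j (enc_nat b) T2 D" "evals p \<rho> xs (mat r c P) T3 D"
    "a \<le> N" "b \<le> N"
  shows "evals p \<rho> (Nth (Nth xs i) j) (enc_nat (of_bool (a < r \<and> b < c \<and> P a b)))
    (T1 + T2 + T3 + N * 20 + 14) D"
proof -
  let ?l = "(if a < r then map (\<lambda>b. enc_bool (P a b)) [0..<c] else [])"
  have 1: "evals p \<rho> (Nth xs i) (enc_list ?l) (T1 + T3 + N * 10 + 7) D"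
    by (rule evals_Nth[OF assms(1) assms(3)[unfolded mat_def] assms(4)]) auto
  show ?thesis
    by (rule evals_mono[OF evals_Nth[OF assms(2) 1 assms(5)]]) (auto simp: enc_bool_nat)
qed

subsection \<open>Counting formulas over index ranges\<close>

datatype rangeid = RN | RK | RM

text \<open>Terms denote natural numbers; nonzero means true. \<open>Count x r e\<close> binds the name \<open>x\<close> and doubles
  as existential quantifier. \<open>Find\<close> yields the least witness, and 0 if there is none.\<close>

datatype nexp =
    NV nat
  | Thr
  | Al nexp nexp
  | Inc nexp nexp
  | Le nexp nexp
  | Conj nexp nexp
  | Neg nexp
  | Count nat rangeid nexp
  | Find nat rangeid nexp

primrec fv :: "nexp \<Rightarrow> nat set" where
  "fv (NV x) = {x}"
| "fv Thr = {}"
| "fv (Al e f) = fv e \<union> fv f"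
| "fv (Inc e f) = fv e \<union> fv f"
| "fv (Le e f) = fv e \<union> fv f"
| "fv (Conj e f) = fv e \<union> fv f"
| "fv (Neg e) = fv e"
| "fv (Count x r e) = fv e - {x}"
| "fv (Find x r e) = fv e - {x}"

primrec rngE :: "rangeid \<Rightarrow> nat \<Rightarrow> expr" where
  "rngE RN b = Hd (Tl (Tl (Tl (Tl (Var b)))))"
| "rngE RK b = Hd (Tl (Tl (Tl (Tl (Tl (Var b))))))"
| "rngE RM b = Tl (Tl (Tl (Tl (Tl (Tl (Var b))))))"

text \<open>\<open>b\<close> is the position of the instance data in the environment, \<open>q x\<close> that of the loop state which
  binds the name \<open>x\<close>.\<close>

definition bind :: "nat \<Rightarrow> (nat \<Rightarrow> nat) \<Rightarrow> nat \<Rightarrow> nat" where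
  "bind x q = (\<lambda>y. if y = x then 0 else Suc (q y))"

abbreviation Tr :: expr where "Tr \<equiv> Cns Nl Nl"

lemma evals_Nl1: "evals p \<rho> Nl NIL (Suc 0) D"
  using evals_Nl by simp

lemma evals_Tr: "evals p \<rho> Tr (Pair NIL NIL) 3 D"
  using evals_Cns[OF evals_Nl evals_Nl] by (simp add: numeral_3_eq_3)

text \<open>\<open>Le\<close> rests on \<open>Drop\<close> being truncated subtraction of unary
  numbers. \<open>Count\<close> adds one unit per hit. \<open>Find\<close> overwrites its
  accumulator at every hit, and since ranges run downwards the last one to survive is the least
  witness.\<close>

primrec cmp :: "nexp \<Rightarrow> nat \<Rightarrow> (nat \<Rightarrow> nat) \<Rightarrow> expr" where
  "cmp (NV x) b q = Hd (Hd (Var (q x)))"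
| "cmp Thr b q = Hd (Tl (Var b))"
| "cmp (Al e f) b q = Nth (Nth (Hd (Tl (Tl (Var b)))) (cmp e b q)) (cmp f b q)"
| "cmp (Inc e f) b q = Nth (Nth (Hd (Tl (Tl (Tl (Var b))))) (cmp e b q)) (cmp f b q)"
| "cmp (Le e f) b q = Cond (Drop (cmp f b q) (cmp e b q)) Nl Tr"
| "cmp (Conj e f) b q = Cond (cmp e b q) (Cond (cmp f b q) Tr Nl) Nl"
| "cmp (Neg e) b q = Cond (cmp e b q) Nl Tr"
| "cmp (Count x r e) b q = Fold (rngE r b) Nl
     (Cond (cmp e (Suc b) (bind x q)) (Cns Nl (Tl (Var 0))) (Tl (Var 0)))"
| "cmp (Find x r e) b q = Fold (rngE r b) Nl
     (Cond (cmp e (Suc b) (bind x q)) (Hd (Hd (Var 0))) (Tl (Var 0)))"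

text \<open>Here \<open>N\<close> bounds all ranges and all values of terms. Each quantifier
  contributes a factor \<open>N\<close>, so the bound is polynomial for every fixed formula.\<close>

primrec tb :: "nexp \<Rightarrow> nat \<Rightarrow> nat" where
  "tb (NV x) N = 3"
| "tb Thr N = 3"
| "tb (Al e f) N = tb e N + tb f N + N * 20 + 20"
| "tb (Inc e f) N = tb e N + tb f N + N * 20 + 20"
| "tb (Le e f) N = tb e N + tb f N + N * 10 + 20"
| "tb (Conj e f) N = tb e N + tb f N + 20"
| "tb (Neg e) N = tb e N + 20"
| "tb (Count x r e) N = N * (tb e N + 20) + 20"
| "tb (Find x r e) N = N * (tb e N + 20) + 20"

locale instance_data =
  fixes n k m s :: nat and I :: "nat \<Rightarrow> nat set"
begin

text \<open>The first component is the status of the main loop: \<open>NIL\<close> while undecided, afterwards a pair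
  whose head is the answer.\<close>

definition data :: "sexp \<Rightarrow> (nat \<Rightarrow> nat set) \<Rightarrow> sexp" where
  "data st S = Pair st (Pair (enc_nat s) (Pair (mat n k (\<lambda>v i. i \<in> S v))
     (Pair (mat m n (\<lambda>h v. v \<in> I h)) (Pair (rng n) (Pair (rng k) (rng m))))))"

primrec bd :: "rangeid \<Rightarrow> nat" where
  "bd RN = n" | "bd RK = k" | "bd RM = m"

primrec nv :: "(nat \<Rightarrow> nat set) \<Rightarrow> nexp \<Rightarrow> (nat \<Rightarrow> nat) \<Rightarrow> nat" where
  "nv S (NV x) \<sigma> = \<sigma> x"
| "nv S Thr \<sigma> = s"
| "nv S (Al e f) \<sigma> = of_bool (nv S e \<sigma> < n \<and> nv S f \<sigma> < k \<and> nv S f \<sigma> \<in> S (nv S e \<sigma>))"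
| "nv S (Inc e f) \<sigma> = of_bool (nv S e \<sigma> < m \<and> nv S f \<sigma> < n \<and> nv S f \<sigma> \<in> I (nv S e \<sigma>))"
| "nv S (Le e f) \<sigma> = of_bool (nv S e \<sigma> \<le> nv S f \<sigma>)"
| "nv S (Conj e f) \<sigma> = of_bool (nv S e \<sigma> \<noteq> 0 \<and> nv S f \<sigma> \<noteq> 0)"
| "nv S (Neg e) \<sigma> = of_bool (nv S e \<sigma> = 0)"
| "nv S (Count x r e) \<sigma> = card {a. a < bd r \<and> nv S e (\<sigma>(x := a)) \<noteq> 0}"
| "nv S (Find x r e) \<sigma> = (if \<exists>a<bd r. nv S e (\<sigma>(x := a)) \<noteq> 0
     then LEAST a. a < bd r \<and> nv S e (\<sigma>(x := a)) \<noteq> 0 else 0)"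

lemma nv_cong: "(\<And>x. x \<in> fv e \<Longrightarrow> \<sigma> x = \<tau> x) \<Longrightarrow> nv S e \<sigma> = nv S e \<tau>"
proof (induction e arbitrary: \<sigma> \<tau>)
  case (Count x r e)
  have "nv S e (\<sigma>(x := a)) = nv S e (\<tau>(x := a))" for a
    by (rule Count.IH) (use Count.prems in auto)
  then show ?case unfolding nv.simps by presburger
next
  case (Find x r e)
  have "nv S e (\<sigma>(x := a)) = nv S e (\<tau>(x := a))" for a
    by (rule Find.IH) (use Find.prems in auto)
  then show ?case unfolding nv.simps by presburger
next
  case (Al e1 e2)
  from Al.IH(1)[of \<sigma> \<tau>] Al.IH(2)[of \<sigma> \<tau>] Al.prems show ?case by simp
next
  case (Inc e1 e2)
  from Inc.IH(1)[of \<sigma> \<tau>] Inc.IH(2)[of \<sigma> \<tau>] Inc.prems show ?case by simp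
next
  case (Le e1 e2)
  from Le.IH(1)[of \<sigma> \<tau>] Le.IH(2)[of \<sigma> \<tau>] Le.prems show ?case by simp
next
  case (Conj e1 e2)
  from Conj.IH(1)[of \<sigma> \<tau>] Conj.IH(2)[of \<sigma> \<tau>] Conj.prems show ?case by simp
next
  case (Neg e)
  from Neg.IH[of \<sigma> \<tau>] Neg.prems show ?case by simp
qed auto

lemma nv_upd [simp]: "x \<notin> fv e \<Longrightarrow> nv S e (\<sigma>(x := a)) = nv S e \<sigma>"
  by (rule nv_cong) auto

lemma foldr_count:
  "foldr (\<lambda>x acc. if P x then Pair NIL acc else acc) [0..<r] NIL = enc_nat (card {a. a < r \<and> P a})"
proof -
  have "foldr (\<lambda>x acc. if P x then Pair NIL acc else acc) xs (enc_nat b)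
      = enc_nat (b + length (filter P xs))" for xs b
    by (induction xs) auto
  from this[of "[0..<r]" 0] have "foldr (\<lambda>x acc. if P x then Pair NIL acc else acc) [0..<r] NIL
    = enc_nat (length (filter P [0..<r]))" by simp
  also have "length (filter P [0..<r]) = card {a. a < r \<and> P a}"
    by (subst distinct_card[symmetric]) (auto intro!: arg_cong[of _ _ card])
  finally show ?thesis .
qed

lemma foldr_find:
  "foldr (\<lambda>x acc. if P x then enc_nat x else acc) [0..<r] NIL =
    enc_nat (if \<exists>a<r. P a then LEAST a. a < r \<and> P a else 0)"
proof -
  have "foldr (\<lambda>x acc. if P x then enc_nat x else acc) [a..<a + l] NIL =
    enc_nat (if \<exists>x. a \<le> x \<and> x < a + l \<and> P x then LEAST x. a \<le> x \<and> x < a + l \<and> P x else 0)" for a l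
  proof (induction l arbitrary: a)
    case (Suc l)
    have u: "[a..<a + Suc l] = a # [Suc a..<Suc a + l]"
      by (simp add: upt_rec)
    show ?case
    proof (cases "P a")
      case True
      then have "(LEAST x. a \<le> x \<and> x < a + Suc l \<and> P x) = a"
        by (intro Least_equality) auto
      with True show ?thesis unfolding u by auto
    next
      case False
      then have "(\<lambda>x. a \<le> x \<and> x < a + Suc l \<and> P x) = (\<lambda>x. Suc a \<le> x \<and> x < Suc a + l \<and> P x)"
        by (auto simp: fun_eq_iff Suc_le_eq le_less)
      then have eq: "a \<le> x \<and> x < a + Suc l \<and> P x \<longleftrightarrow> Suc a \<le> x \<and> x < Suc a + l \<and> P x" for x
        by metis
      show ?thesis unfolding u eq using Suc[of "Suc a"] False by (simp only: foldr.simps o_apply if_False)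
    qed
  qed auto
  from this[of 0 r] show ?thesis by (simp only: le0 simp_thms add_0)
qed

lemma evals_rngE:
  assumes "b < length \<rho>" "\<rho> ! b = data st S"
  shows "evals p \<rho> (rngE r b) (rng (bd r)) 7 D"
proof -
  let ?rest = "Pair (rng n) (Pair (rng k) (rng m))"
  have "evals p \<rho> (Tl (Tl (Tl (Tl (Var b))))) ?rest (1 + 1 + 1 + 1 + 1) D"
    using assms by (intro evals_Tl[OF evals_Tl[OF evals_Tl[OF evals_Tl[OF evals_Var]]]]) (auto simp: data_def)
  note rest = evals_mono[OF this, of 5 D]
  show ?thesis
  proof (cases r)
    case RN
    then show ?thesis using evals_mono[OF evals_Hd[OF rest refl], of 7 D] by simp
  next
    case RK
    then show ?thesis using evals_mono[OF evals_Hd[OF evals_Tl[OF rest refl] refl], of 7 D] by simp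
  next
    case RM
    then show ?thesis using evals_mono[OF evals_Tl[OF evals_Tl[OF rest refl] refl], of 7 D] by simp
  qed
qed

text \<open>The bound by \<open>N\<close> on values is carried through the same induction because a
  value may be used as an index, and the cost of \<open>Drop\<close> depends on it. Only the current
  element of the loop state that binds a name matters, hence the two applications of
  \<open>hd_s\<close>.\<close>

lemma evals_cmp_aux:
  assumes "n \<le> N" "k \<le> N" "m \<le> N" "s \<le> N" "1 \<le> N"
  shows "b < length \<rho> \<Longrightarrow> \<rho> ! b = data st S \<Longrightarrow>
    (\<And>x. x \<in> fv e \<Longrightarrow> q x < length \<rho> \<and> hd_s (hd_s (\<rho> ! q x)) = enc_nat (\<sigma> x) \<and> \<sigma> x \<le> N) \<Longrightarrow>
    evals p \<rho> (cmp e b q) (enc_nat (nv S e \<sigma>)) (tb e N) D \<and> nv S e \<sigma> \<le> N"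
proof (induction e arbitrary: \<rho> b q \<sigma>)
  case (NV x)
  then show ?case by (auto intro!: evals_mono[OF evals_Hd[OF evals_Hd[OF evals_Var]]])
next
  case Thr
  then show ?case using assms by (auto simp: data_def intro!: evals_mono[OF evals_Hd[OF evals_Tl[OF evals_Var]]])
next
  case (Al e1 e2)
  from Al.IH(1)[of b \<rho> q \<sigma>] Al.IH(2)[of b \<rho> q \<sigma>] Al.prems
  have 1: "evals p \<rho> (cmp e1 b q) (enc_nat (nv S e1 \<sigma>)) (tb e1 N) D" "nv S e1 \<sigma> \<le> N"
    and 2: "evals p \<rho> (cmp e2 b q) (enc_nat (nv S e2 \<sigma>)) (tb e2 N) D" "nv S e2 \<sigma> \<le> N" by auto
  have 3: "evals p \<rho> (Hd (Tl (Tl (Var b)))) (mat n k (\<lambda>v i. i \<in> S v)) 4 D"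
    using Al.prems by (auto simp: data_def intro!: evals_mono[OF evals_Hd[OF evals_Tl[OF evals_Tl[OF evals_Var]]]])
  show ?case using evals_Nth_Nth[OF 1(1) 2(1) 3 1(2) 2(2)] assms
    by (auto elim!: evals_mono simp del: of_bool_conj)
next
  case (Inc e1 e2)
  from Inc.IH(1)[of b \<rho> q \<sigma>] Inc.IH(2)[of b \<rho> q \<sigma>] Inc.prems
  have 1: "evals p \<rho> (cmp e1 b q) (enc_nat (nv S e1 \<sigma>)) (tb e1 N) D" "nv S e1 \<sigma> \<le> N"
    and 2: "evals p \<rho> (cmp e2 b q) (enc_nat (nv S e2 \<sigma>)) (tb e2 N) D" "nv S e2 \<sigma> \<le> N" by auto
  have 3: "evals p \<rho> (Hd (Tl (Tl (Tl (Var b))))) (mat m n (\<lambda>v i. i \<in> I v)) 5 D"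
    using Inc.prems by (auto simp: data_def intro!: evals_mono[OF evals_Hd[OF evals_Tl[OF evals_Tl[OF evals_Tl[OF evals_Var]]]]])
  show ?case using evals_Nth_Nth[OF 1(1) 2(1) 3 1(2) 2(2)] assms
    by (auto elim!: evals_mono simp del: of_bool_conj)
next
  case (Le e1 e2)
  from Le.IH(1)[of b \<rho> q \<sigma>] Le.IH(2)[of b \<rho> q \<sigma>] Le.prems
  have 1: "evals p \<rho> (cmp e1 b q) (enc_nat (nv S e1 \<sigma>)) (tb e1 N) D" "nv S e1 \<sigma> \<le> N"
    and 2: "evals p \<rho> (cmp e2 b q) (enc_nat (nv S e2 \<sigma>)) (tb e2 N) D" "nv S e2 \<sigma> \<le> N" by auto
  have d: "(tl_s ^^ b) (enc_nat a) = NIL \<longleftrightarrow> a \<le> b" for a b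
    by (simp add: enc_nat_def tl_s_enc_list) (metis enc_nat_def enc_nat_eq_NIL diff_is_0_eq)
  have "evals p \<rho> (cmp (Le e1 e2) b q) (enc_nat (nv S (Le e1 e2) \<sigma>))
    ((tb e2 N + tb e1 N + N * 10 + 6) + 1 + 3 + 1) D"
    unfolding cmp.simps
    by (rule evals_Cond[OF evals_Drop[OF 2(1) 1(1) 2(2)]])
      (auto simp: d intro: evals_Nl1 evals_Tr)
  then show ?case using assms by (auto elim!: evals_mono)
next
  case (Conj e1 e2)
  from Conj.IH(1)[of b \<rho> q \<sigma>] Conj.IH(2)[of b \<rho> q \<sigma>] Conj.prems
  have 1: "evals p \<rho> (cmp e1 b q) (enc_nat (nv S e1 \<sigma>)) (tb e1 N) D" "nv S e1 \<sigma> \<le> N"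
    and 2: "evals p \<rho> (cmp e2 b q) (enc_nat (nv S e2 \<sigma>)) (tb e2 N) D" "nv S e2 \<sigma> \<le> N" by auto
  have "evals p \<rho> (Cond (cmp e2 b q) Tr Nl) (enc_nat (of_bool (nv S e2 \<sigma> \<noteq> 0)))
    (tb e2 N + 3 + 1 + 1) D"
    by (rule evals_Cond[OF 2(1)])
      (auto intro: evals_Nl1 evals_Tr)
  then have "evals p \<rho> (cmp (Conj e1 e2) b q) (enc_nat (nv S (Conj e1 e2) \<sigma>))
    (tb e1 N + (tb e2 N + 3 + 1 + 1) + 1 + 1) D"
    unfolding cmp.simps
    by (intro evals_Cond[OF 1(1)]) (auto intro: evals_Nl1)
  then show ?case using assms by (auto elim!: evals_mono simp del: of_bool_conj)
next
  case (Neg e1)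
  from Neg.IH(1)[of b \<rho> q \<sigma>] Neg.prems
  have 1: "evals p \<rho> (cmp e1 b q) (enc_nat (nv S e1 \<sigma>)) (tb e1 N) D" "nv S e1 \<sigma> \<le> N"
    by auto
  have "evals p \<rho> (cmp (Neg e1) b q) (enc_nat (nv S (Neg e1) \<sigma>))
    (tb e1 N + 1 + 3 + 1) D"
    unfolding cmp.simps
    by (rule evals_Cond[OF 1(1)]) (auto intro: evals_Nl1 evals_Tr)
  then show ?case using assms by (auto elim!: evals_mono)
next
  case (Count x r e)
  let ?g = "\<lambda>a acc. if nv S e (\<sigma>(x := a)) \<noteq> 0 then Pair NIL acc else acc"
  have bd: "bd r \<le> N" using assms by (cases r) auto
  have "evals p \<rho> (cmp (Count x r e) b q) (foldr ?g [0..<bd r] NIL)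
    (7 + 1 + bd r * ((tb e N + 4 + 2 + 1) + 7) + 6) D"
    unfolding cmp.simps
  proof (rule evals_Fold_rng)
    show "evals p \<rho> (rngE r b) (rng (bd r)) 7 D" using evals_rngE Count.prems by auto
    show "evals p \<rho> Nl NIL 1 D" by (rule evals_Nl)
    fix a rest acc assume a: "a < bd r"
    let ?\<rho> = "Pair (Pair (enc_nat a) rest) acc # \<rho>"
    have "evals p ?\<rho> (cmp e (Suc b) (bind x q)) (enc_nat (nv S e (\<sigma>(x := a)))) (tb e N) D"
      by (rule Count.IH[THEN conjunct1]) (use Count.prems a bd in \<open>auto simp: bind_def\<close>)
    then show "evals p ?\<rho> (Cond (cmp e (Suc b) (bind x q)) (Cns Nl (Tl (Var 0))) (Tl (Var 0)))
        (?g a acc) (tb e N + 4 + 2 + 1) D"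
      by (rule evals_Cond) (auto intro!: evals_mono[OF evals_Tl[OF evals_Var]]
        evals_mono[OF evals_Cns[OF evals_Nl evals_Tl[OF evals_Var]]])
  qed
  then have "evals p \<rho> (cmp (Count x r e) b q) (enc_nat (nv S (Count x r e) \<sigma>))
    (7 + 1 + bd r * ((tb e N + 4 + 2 + 1) + 7) + 6) D"
    unfolding foldr_count by simp
  moreover have "bd r * ((tb e N + 4 + 2 + 1) + 7) \<le> N * (tb e N + 20)"
    using bd by (intro mult_mono) auto
  moreover have "card {a. a < bd r \<and> nv S e (\<sigma>(x := a)) \<noteq> 0} \<le> card {..<bd r}"
    by (rule card_mono) auto
  ultimately show ?case using bd by (auto elim!: evals_mono)
next
  case (Find x r e)
  let ?P = "\<lambda>a. nv S e (\<sigma>(x := a)) \<noteq> 0"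
  let ?g = "\<lambda>a acc. if nv S e (\<sigma>(x := a)) \<noteq> 0 then enc_nat a else acc"
  have bd: "bd r \<le> N" using assms by (cases r) auto
  have "evals p \<rho> (cmp (Find x r e) b q) (foldr ?g [0..<bd r] NIL)
    (7 + 1 + bd r * ((tb e N + 3 + 2 + 1) + 7) + 6) D"
    unfolding cmp.simps
  proof (rule evals_Fold_rng)
    show "evals p \<rho> (rngE r b) (rng (bd r)) 7 D" using evals_rngE Find.prems by auto
    show "evals p \<rho> Nl NIL 1 D" by (rule evals_Nl)
    fix a rest acc assume a: "a < bd r"
    let ?\<rho> = "Pair (Pair (enc_nat a) rest) acc # \<rho>"
    have "evals p ?\<rho> (cmp e (Suc b) (bind x q)) (enc_nat (nv S e (\<sigma>(x := a)))) (tb e N) D"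
      by (rule Find.IH[THEN conjunct1]) (use Find.prems a bd in \<open>auto simp: bind_def\<close>)
    then show "evals p ?\<rho> (Cond (cmp e (Suc b) (bind x q)) (Hd (Hd (Var 0))) (Tl (Var 0)))
        (?g a acc) (tb e N + 3 + 2 + 1) D"
      by (rule evals_Cond) (auto intro!: evals_mono[OF evals_Tl[OF evals_Var]]
        evals_mono[OF evals_Hd[OF evals_Hd[OF evals_Var]]])
  qed
  then have "evals p \<rho> (cmp (Find x r e) b q) (enc_nat (nv S (Find x r e) \<sigma>))
    (7 + 1 + bd r * ((tb e N + 3 + 2 + 1) + 7) + 6) D"
    unfolding foldr_find by simp
  moreover have "bd r * ((tb e N + 3 + 2 + 1) + 7) \<le> N * (tb e N + 20)"
    using bd by (intro mult_mono) auto
  moreover have "nv S (Find x r e) \<sigma> \<le> N"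
    using LeastI_ex[of "\<lambda>a. a < bd r \<and> ?P a"] bd by (simp only: nv.simps split: if_split) (meson le0 less_imp_le order_trans)
  moreover have "7 + 1 + bd r * ((tb e N + 3 + 2 + 1) + 7) + 6 \<le> tb (Find x r e) N"
    using calculation(2) by simp
  ultimately show ?case using evals_mono by blast
qed

end

subsection \<open>Branching on list colorings\<close>

locale hypergraph = instance_data +
  assumes I_sub: "h < m \<Longrightarrow> I h \<subseteq> {..<n}"
begin

definition live :: "(nat \<Rightarrow> nat set) \<Rightarrow> nat \<Rightarrow> nat set" where
  "live S i = {h. h < m \<and> (\<forall>v\<in>I h. i \<in> S v)}"

definition undecided :: "(nat \<Rightarrow> nat set) \<Rightarrow> nat \<Rightarrow> nat \<Rightarrow> nat set" where
  "undecided S h i = {v\<in>I h. \<exists>j<k. j \<noteq> i \<and> j \<in> S v}"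

text \<open>Colors are shifted to start at 0. Asking for a deviating vertex separately for each
  color rules out empty edges as soon as \<open>k > 0\<close>, in line with the convention on tiny
  edges.\<close>

definition proper :: "(nat \<Rightarrow> nat set) \<Rightarrow> (nat \<Rightarrow> nat) \<Rightarrow> bool" where
  "proper S \<chi> \<longleftrightarrow> (\<forall>v<n. \<chi> v < k \<and> \<chi> v \<in> S v) \<and> (\<forall>h<m. \<forall>i<k. \<exists>v\<in>I h. \<chi> v \<noteq> i)"

definition colorable :: "(nat \<Rightarrow> nat set) \<Rightarrow> bool" where
  "colorable S \<longleftrightarrow> (\<exists>\<chi>. proper S \<chi>)"

definition drop_color :: "(nat \<Rightarrow> nat set) \<Rightarrow> nat \<Rightarrow> nat \<Rightarrow> nat \<Rightarrow> nat set" where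
  "drop_color S v j = S(v := S v - {j})"

text \<open>Intersecting instead of assigning \<open>{j}\<close> makes this a shrinking operation
  for every \<open>j\<close>. A color that is not allowed leads to an empty list and so to an
  uncolorable instance, which spares a test of admissibility.\<close>

definition fix_color :: "(nat \<Rightarrow> nat set) \<Rightarrow> nat \<Rightarrow> nat \<Rightarrow> nat \<Rightarrow> nat set" where
  "fix_color S v j = S(v := S v \<inter> {j})"

lemma finite_live [simp]: "finite (live S i)"
  unfolding live_def by simp

lemma finite_I [simp]: "h < m \<Longrightarrow> finite (I h)"
  using I_sub finite_subset by blast

lemma finite_undecided [simp]: "h < m \<Longrightarrow> finite (undecided S h i)"
  unfolding undecided_def by simp

lemma live_mono: "(\<And>v. S' v \<subseteq> S v) \<Longrightarrow> live S' i \<subseteq> live S i"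
  unfolding live_def by blast

lemma drop_color_le: "drop_color S v j u \<subseteq> S u"
  unfolding drop_color_def by auto

lemma fix_color_le: "fix_color S v j u \<subseteq> S u"
  unfolding fix_color_def by auto

lemma live_fix_color: "live (fix_color S v j) i \<subseteq> live S i"
  by (rule live_mono) (rule fix_color_le)

lemma live_drop_color: "live (drop_color S v j) i \<subseteq> live S i"
  by (rule live_mono) (rule drop_color_le)

lemma proper_mono: "proper S' \<chi> \<Longrightarrow> (\<And>v. S' v \<subseteq> S v) \<Longrightarrow> proper S \<chi>"
  unfolding proper_def by (meson subsetD)

lemma colorable_mono: "colorable S' \<Longrightarrow> (\<And>v. S' v \<subseteq> S v) \<Longrightarrow> colorable S"
  unfolding colorable_def by (meson proper_mono)

lemma colorable_branch:
  "colorable S \<longleftrightarrow> colorable (drop_color S v j) \<or> colorable (fix_color S v j)"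
proof
  assume "colorable S"
  then obtain \<chi> where "proper S \<chi>" unfolding colorable_def by blast
  then have "proper (drop_color S v j) \<chi> \<or> proper (fix_color S v j) \<chi>"
    unfolding proper_def drop_color_def fix_color_def by auto
  then show "colorable (drop_color S v j) \<or> colorable (fix_color S v j)"
    unfolding colorable_def by blast
next
  assume "colorable (drop_color S v j) \<or> colorable (fix_color S v j)"
  then show "colorable S"
    using colorable_mono[of "drop_color S v j" S] colorable_mono[of "fix_color S v j" S]
      drop_color_le[of S v j] fix_color_le[of S v j] by auto
qed

text \<open>Recoloring \<open>v\<close> to \<open>j\<close> can create a monochromatic edge only
  through \<open>v\<close> and only in color \<open>j\<close>. The other vertices of such an edge
  already have color \<open>j\<close>, so the edge would be live for \<open>j\<close>.\<close>

lemma colorable_fix_free: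
  assumes "v < n" "j < k" "j \<in> S v" and free: "\<And>h. h \<in> live S j \<Longrightarrow> v \<notin> I h"
  shows "colorable S \<longleftrightarrow> colorable (fix_color S v j)"
proof
  assume "colorable S"
  then obtain \<chi> where \<chi>: "proper S \<chi>" unfolding colorable_def by blast
  have "\<exists>u\<in>I h. (\<chi>(v := j)) u \<noteq> i" if "h < m" "i < k" for h i
  proof (rule ccontr)
    assume mono: "\<not> (\<exists>u\<in>I h. (\<chi>(v := j)) u \<noteq> i)"
    have "v \<in> I h" using \<chi> that mono unfolding proper_def by (metis fun_upd_other)
    with mono have "i = j" by auto
    have "h \<in> live S j" unfolding live_def
      using \<chi> mono that I_sub[OF that(1)] \<open>i = j\<close> assms(3) unfolding proper_def
      by (auto split: if_splits)
    with free \<open>v \<in> I h\<close> show False by blast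
  qed
  then have "proper (fix_color S v j) (\<chi>(v := j))"
    using \<chi> assms unfolding proper_def fix_color_def by auto
  then show "colorable (fix_color S v j)" unfolding colorable_def by blast
next
  assume "colorable (fix_color S v j)"
  then show "colorable S"
    using colorable_mono[of "fix_color S v j" S] fix_color_le[of S v j] by auto
qed

text \<open>Every vertex of \<open>h\<close> is forced to color \<open>i\<close>. An empty edge is
  covered too, being live for all colors.\<close>

lemma not_colorable_if_decided:
  assumes "h \<in> live S i" "i < k" "undecided S h i = {}"
  shows "\<not> colorable S"
proof
  assume "colorable S"
  then obtain \<chi> where \<chi>: "proper S \<chi>" unfolding colorable_def by blast
  have "h < m" using assms by (simp add: live_def)
  then obtain v where v: "v \<in> I h" "\<chi> v \<noteq> i" using \<chi> assms unfolding proper_def by blast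
  then have "v < n" using I_sub \<open>h < m\<close> by blast
  then have "v \<in> undecided S h i" using v \<chi> unfolding undecided_def proper_def by blast
  with assms show False by blast
qed

text \<open>Bounds the expected number of monochromatic edges under a uniformly random choice from the lists.\<close>

definition weight :: "(nat \<Rightarrow> nat set) \<Rightarrow> real" where
  "weight S = (\<Sum>i<k. \<Sum>h\<in>live S i. (1/2) ^ card (undecided S h i))"

text \<open>Method of conditional expectations with two of the colors at \<open>v\<close>. Fixing
  \<open>v\<close> to \<open>a\<close> removes one undecided vertex from each edge through
  \<open>v\<close> that is live for \<open>a\<close>, which doubles its term, and ends liveness of
  edges through \<open>v\<close> for all other colors. Edges avoiding \<open>v\<close> keep their
  terms. So every term enters the sum of both branches at most twice.\<close>

lemma weight_fix:
  assumes "v < n" "a < k" "b < k" "a \<noteq> b" "a \<in> S v" "b \<in> S v"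
  shows "weight (fix_color S v a) + weight (fix_color S v b) \<le> 2 * weight S"
proof -
  define w where "w S i h = (if h \<in> live S i then (1/2::real) ^ card (undecided S h i) else 0)" for S i h
  have weight: "weight S = (\<Sum>i<k. \<Sum>h<m. w S i h)" for S
  proof -
    have "(\<Sum>h\<in>live S i. (1/2::real) ^ card (undecided S h i)) = (\<Sum>h<m. w S i h)" for i
      unfolding w_def by (subst sum.inter_restrict[symmetric]) (auto intro!: sum.cong simp: live_def)
    then show ?thesis unfolding weight_def by simp
  qed
  have half: "w (fix_color S v c) i h \<le> (if i = c then 2 * w S i h else 0)"
    if vh: "v \<in> I h" and h: "h < m" and c: "c \<in> {a, b}" for i h c
  proof (cases "h \<in> live (fix_color S v c) i")
    case True
    then have i: "i = c" using vh unfolding live_def fix_color_def by auto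
    have L: "h \<in> live S i" using True live_fix_color by blast
    have "v \<in> undecided S h i" using vh assms c i unfolding undecided_def by auto
    moreover have "undecided (fix_color S v c) h i = undecided S h i - {v}"
      using i unfolding undecided_def fix_color_def by auto
    ultimately have "card (undecided S h i) = Suc (card (undecided (fix_color S v c) h i))"
      using h by (metis card.remove finite_undecided)
    then show ?thesis using True L i unfolding w_def by simp
  qed (auto simp: w_def)
  have same: "w (fix_color S v c) i h = w S i h" if "v \<notin> I h" for c i h
  proof -
    have "\<forall>u\<in>I h. fix_color S v c u = S u" using that unfolding fix_color_def by auto
    then have "undecided (fix_color S v c) h i = undecided S h i"
      "h \<in> live (fix_color S v c) i \<longleftrightarrow> h \<in> live S i"
      unfolding undecided_def live_def by auto
    then show ?thesis unfolding w_def by simp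
  qed
  have nn: "0 \<le> w S i h" for i h unfolding w_def by simp
  have "w (fix_color S v a) i h + w (fix_color S v b) i h \<le> 2 * w S i h" if "h < m" for i h
  proof (cases "v \<in> I h")
    case True
    then show ?thesis using half[OF True that, of a i] half[OF True that, of b i] nn[of i h] assms(4)
      by (auto split: if_splits)
  qed (simp add: same)
  then show ?thesis unfolding weight sum.distrib[symmetric] sum_distrib_left
    by (intro sum_mono) auto
qed

text \<open>Induction on the total length of the lists: one of the two branches of
  \<open>weight_fix\<close> keeps the weight below 1. Once every list is a singleton the coloring is
  forced.\<close>

lemma colorable_if_weight_less_1:
  assumes "weight S < 1" "\<And>v. v < n \<Longrightarrow> \<exists>i<k. i \<in> S v"
  shows "colorable S"
  using assms
proof (induction "\<Sum>v<n. card (S v \<inter> {..<k})" arbitrary: S rule: less_induct)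
  case less
  show ?case
  proof (cases "\<exists>v<n. \<exists>a<k. \<exists>b<k. a \<noteq> b \<and> a \<in> S v \<and> b \<in> S v")
    case True
    then obtain v a b where v: "v < n" "a < k" "b < k" "a \<noteq> b" "a \<in> S v" "b \<in> S v" by blast
    from weight_fix[of v a b S, OF this] less.prems(1)
    have "weight (fix_color S v a) < 1 \<or> weight (fix_color S v b) < 1" by linarith
    then obtain c where c: "c \<in> {a, b}" "weight (fix_color S v c) < 1" by blast
    have "(\<Sum>u<n. card (fix_color S v c u \<inter> {..<k})) < (\<Sum>u<n. card (S u \<inter> {..<k}))"
    proof (rule sum_strict_mono_ex1)
      show "\<forall>u\<in>{..<n}. card (fix_color S v c u \<inter> {..<k}) \<le> card (S u \<inter> {..<k})"
        using fix_color_le[of S v c] by (intro ballI card_mono) auto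
      have "fix_color S v c v \<inter> {..<k} \<subset> S v \<inter> {..<k}"
      proof -
        have "fix_color S v c v = S v \<inter> {c}" by (simp add: fix_color_def)
        moreover have "a \<in> S v \<inter> {..<k} - {c} \<or> b \<in> S v \<inter> {..<k} - {c}" using v by auto
        ultimately show ?thesis by auto
      qed
      then have "card (fix_color S v c v \<inter> {..<k}) < card (S v \<inter> {..<k})"
        by (rule psubset_card_mono[rotated]) simp
      then show "\<exists>u\<in>{..<n}. card (fix_color S v c u \<inter> {..<k}) < card (S u \<inter> {..<k})"
        using v(1) by blast
    qed simp
    moreover have "\<exists>i<k. i \<in> fix_color S v c u" if "u < n" for u
    proof (cases "u = v")
      case True
      then show ?thesis using v c(1) by (auto simp: fix_color_def)
    next
      case False
      then show ?thesis using less.prems(2)[OF that] by (simp add: fix_color_def)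
    qed
    ultimately have "colorable (fix_color S v c)" using less.hyps c by blast
    then show ?thesis using colorable_mono[of "fix_color S v c" S] fix_color_le[of S v c] by auto
  next
    case False
    define \<chi> where "\<chi> v = (SOME i. i < k \<and> i \<in> S v)" for v
    have \<chi>: "\<chi> v < k \<and> \<chi> v \<in> S v" if "v < n" for v
      unfolding \<chi>_def using less.prems(2)[OF that] by (rule someI_ex)
    have "\<exists>v\<in>I h. \<chi> v \<noteq> i" if h: "h < m" and i: "i < k" for h i
    proof (rule ccontr)
      assume "\<not> (\<exists>v\<in>I h. \<chi> v \<noteq> i)"
      then have mono: "\<And>v. v \<in> I h \<Longrightarrow> v < n \<and> i \<in> S v" using \<chi> I_sub[OF h] by fastforce
      then have L: "h \<in> live S i" using h unfolding live_def by auto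
      have "undecided S h i = {}" using False mono i unfolding undecided_def by blast
      \<comment> \<open>A monochromatic edge has no undecided vertex left and alone contributes 1 to
        the weight.\<close>
      then have "1 = (1/2::real) ^ card (undecided S h i)" by simp
      also have "\<dots> \<le> (\<Sum>h\<in>live S i. (1/2) ^ card (undecided S h i))"
        by (rule member_le_sum[OF L]) auto
      also have "\<dots> \<le> weight S" unfolding weight_def
        by (rule member_le_sum[of i "{..<k}"]) (use i in \<open>auto intro: sum_nonneg\<close>)
      finally show False using less.prems(1) by simp
    qed
    then have "proper S \<chi>" using \<chi> unfolding proper_def by blast
    then show ?thesis unfolding colorable_def by blast
  qed
qed

text \<open>Union bound: at most \<open>k * m\<close> pairs of an edge and a color contribute at
  most \<open>2 ^ -(s + 1)\<close> each. A vertex with an empty list does not show up in the weight,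
  since edges through it are live for no color, so nonempty lists are demanded separately.\<close>

lemma colorable_if_no_small:
  assumes "k * m < 2 ^ Suc s"
    and "\<And>i h. i < k \<Longrightarrow> h \<in> live S i \<Longrightarrow> s < card (undecided S h i)"
    and "\<And>v. v < n \<Longrightarrow> \<exists>i<k. i \<in> S v"
  shows "colorable S"
proof (rule colorable_if_weight_less_1[OF _ assms(3)])
  have "(\<Sum>h\<in>live S i. (1/2::real) ^ card (undecided S h i)) \<le> m * (1/2) ^ Suc s" if "i < k" for i
  proof -
    have "(\<Sum>h\<in>live S i. (1/2::real) ^ card (undecided S h i)) \<le> (\<Sum>h\<in>live S i. (1/2) ^ Suc s)"
      using assms(2)[OF that] by (intro sum_mono power_decreasing Suc_leI) auto
    also have "\<dots> = card (live S i) * (1/2) ^ Suc s" by simp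
    also have "card (live S i) \<le> card {..<m}" by (rule card_mono) (auto simp: live_def)
    finally show ?thesis by (simp add: mult_right_mono)
  qed
  then have "weight S \<le> (\<Sum>i<k. m * (1/2) ^ Suc s)" unfolding weight_def by (intro sum_mono) auto
  also have "\<dots> = real (k * m) / 2 ^ Suc s" by (simp add: power_divide)
  also have "\<dots> < 1"
    using assms(1) by (simp add: divide_less_eq) (metis of_nat_less_iff of_nat_mult of_nat_numeral of_nat_power power_Suc)
  finally show "weight S < 1" .
qed

section \<open>Candidates for branching and the measure of the main loop\<close>

definition eligible :: "(nat \<Rightarrow> nat set) \<Rightarrow> nat \<Rightarrow> nat \<Rightarrow> nat \<Rightarrow> nat \<Rightarrow> bool" where
  "eligible S h i v j \<longleftrightarrow> v \<in> I h \<and> j < k \<and> j \<in> S v \<and> j \<noteq> i"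

definition deg :: "(nat \<Rightarrow> nat set) \<Rightarrow> nat \<Rightarrow> nat \<Rightarrow> nat" where
  "deg S v j = card {h \<in> live S j. v \<in> I h}"

definition multi :: "(nat \<Rightarrow> nat set) \<Rightarrow> nat" where
  "multi S = card {v. v < n \<and> (\<exists>a<k. \<exists>b<k. a \<noteq> b \<and> a \<in> S v \<and> b \<in> S v)}"

lemma multi_fix_color:
  assumes "v < n" "i < k" "j < k" "i \<noteq> j" "i \<in> S v" "j \<in> S v"
  shows "multi (fix_color S v j) < multi S"
  unfolding multi_def
proof (rule psubset_card_mono)
  let ?M = "\<lambda>S. {v. v < n \<and> (\<exists>a<k. \<exists>b<k. a \<noteq> b \<and> a \<in> S v \<and> b \<in> S v)}"
  have "v \<in> ?M S" "v \<notin> ?M (fix_color S v j)" using assms unfolding fix_color_def by auto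
  moreover have "?M (fix_color S v j) \<subseteq> ?M S" unfolding fix_color_def by auto
  ultimately show "?M (fix_color S v j) \<subset> ?M S" by blast
qed simp

lemma multi_le: "multi S \<le> n"
proof -
  have "multi S \<le> card {..<n}" unfolding multi_def by (rule card_mono) auto
  then show ?thesis by simp
qed

end

section \<open>Degrees and the decrease of the potential\<close>

locale intersecting_hypergraph = hypergraph +
  fixes c :: nat
  assumes intersecting: "h < m \<Longrightarrow> card {h'. h' < m \<and> I h \<inter> I h' = {}} \<le> c"
    and c_pos: "c > 0" and s_pos: "s > 0"
begin

text \<open>If an edge live for \<open>j\<close> meets \<open>h\<close> in \<open>v\<close>, then
  \<open>v\<close> allows \<open>j\<close>, and \<open>j \<noteq> i\<close> makes \<open>v\<close>
  undecided in \<open>h\<close>. So the edges live for \<open>j\<close> are covered by the at most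
  \<open>c\<close> edges disjoint from \<open>h\<close> and the stars of the undecided vertices of
  \<open>h\<close>.\<close>

lemma live_le_deg_sum:
  assumes "h \<in> live S i" "i < k" "j \<noteq> i" "j < k"
  shows "card (live S j) \<le> c + (\<Sum>v\<in>undecided S h i. deg S v j)"
proof -
  have h: "h < m" using assms by (simp add: live_def)
  have "live S j \<subseteq> {h'. h' < m \<and> I h \<inter> I h' = {}} \<union> (\<Union>v\<in>undecided S h i. {h'\<in>live S j. v \<in> I h'})"
  proof
    fix h' assume h': "h' \<in> live S j"
    show "h' \<in> {h'. h' < m \<and> I h \<inter> I h' = {}} \<union> (\<Union>v\<in>undecided S h i. {h'\<in>live S j. v \<in> I h'})"
    proof (cases "I h \<inter> I h' = {}")
      case True
      then show ?thesis using h' by (auto simp: live_def)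
    next
      case False
      then obtain v where v: "v \<in> I h" "v \<in> I h'" by blast
      then have "v \<in> undecided S h i" using h' assms unfolding live_def undecided_def by blast
      with v h' show ?thesis by blast
    qed
  qed
  then have "card (live S j) \<le> card ({h'. h' < m \<and> I h \<inter> I h' = {}} \<union> (\<Union>v\<in>undecided S h i. {h'\<in>live S j. v \<in> I h'}))"
    by (rule card_mono[rotated]) (use h in auto)
  also have "\<dots> \<le> card {h'. h' < m \<and> I h \<inter> I h' = {}} + card (\<Union>v\<in>undecided S h i. {h'\<in>live S j. v \<in> I h'})"
    by (rule card_Un_le)
  also have "\<dots> \<le> c + (\<Sum>v\<in>undecided S h i. deg S v j)"
    unfolding deg_def using intersecting[OF h] card_UN_le[of "undecided S h i"] h
    by (intro add_mono) auto
  finally show ?thesis .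
qed

definition potential :: "(nat \<Rightarrow> nat set) \<Rightarrow> real" where
  "potential S = (\<Sum>j<k. ln (real (card (live S j) + c)))"

lemma potential_nonneg: "0 \<le> potential S"
  unfolding potential_def using c_pos by (intro sum_nonneg) auto

lemma potential_mono:
  assumes "\<And>v. S' v \<subseteq> S v" shows "potential S' \<le> potential S"
  unfolding potential_def
proof (rule sum_mono)
  fix j
  have "card (live S' j) \<le> card (live S j)" by (rule card_mono) (use live_mono[OF assms] in auto)
  then show "ln (real (card (live S' j) + c)) \<le> ln (real (card (live S j) + c))"
    using c_pos by (intro ln_mono) auto
qed

lemma potential_le: "potential S \<le> k * ln (real (m + c))"
proof -
  have "card (live S j) \<le> card {..<m}" for j by (rule card_mono) (auto simp: live_def)
  then have "ln (real (card (live S j) + c)) \<le> ln (real (m + c))" for j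
    using c_pos by (intro ln_mono) auto
  then have "potential S \<le> (\<Sum>j<k. ln (real (m + c)))" unfolding potential_def by (intro sum_mono)
  then show ?thesis by simp
qed

text \<open>With \<open>d \<ge> 1\<close> the degree of the chosen pair,
  \<open>|live j| \<le> c + s * d\<close> gives
  \<open>|live j| + c \<le> 2 * c + s * d \<le> 3 * s * c * d\<close>, as \<open>s\<close> and
  \<open>c\<close> are at least 1.\<close>

definition rate :: real where "rate = 3 * real s * real c"

lemma rate_pos: "rate > 0"
  unfolding rate_def using c_pos s_pos by simp

text \<open>Removing a color of maximum degree among the eligible ones shrinks \<open>|live j| + c\<close> by the
  factor \<open>1 - 1 / rate\<close>: the degree is at least 1, and at least \<open>(|live j| - c) / s\<close>.\<close>

lemma potential_drop:
  assumes h: "h \<in> live S i" "i < k" and small: "card (undecided S h i) \<le> s"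
    and el: "eligible S h i v j" and pos: "deg S v j > 0"
    and best: "\<And>v' j'. eligible S h i v' j' \<Longrightarrow> deg S v' j' \<le> deg S v j"
  shows "rate * potential (drop_color S v j) + 1 \<le> rate * potential S"
proof -
  let ?S = "drop_color S v j" and ?x = "card (live S j)" and ?d = "deg S v j"
  have hm: "h < m" using h by (simp add: live_def)
  have j: "j < k" "j \<noteq> i" using el by (auto simp: eligible_def)
  \<comment> \<open>Only competitors with the same color \<open>j\<close> matter. A vertex that does
    not allow \<open>j\<close> lies on no edge live for \<open>j\<close> and has degree 0.\<close>
  have "deg S u j \<le> ?d" if "u \<in> undecided S h i" for u
  proof (cases "j \<in> S u")
    case True
    then show ?thesis using best[of u j] that j unfolding eligible_def undecided_def by auto
  next
    case False
    then have "{h \<in> live S j. u \<in> I h} = {}" unfolding live_def by blast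
    then show ?thesis unfolding deg_def by (metis card.empty le0)
  qed
  then have "(\<Sum>u\<in>undecided S h i. deg S u j) \<le> card (undecided S h i) * ?d"
    using sum_bounded_above[of "undecided S h i" "\<lambda>u. deg S u j" ?d] by simp
  also have "\<dots> \<le> s * ?d" using small by simp
  finally have "?x \<le> c + s * ?d" using live_le_deg_sum[OF h j(2) j(1)] by linarith
  moreover have "c + c \<le> s * ?d + s * ?d \<or> \<not> 2 * c \<le> ?x" using calculation by linarith
  moreover have "?d \<le> s * ?d" "c * 1 \<le> c * ?d" using s_pos pos by auto
  moreover have "s * ?d \<le> s * c * ?d" "c * ?d \<le> s * c * ?d" using s_pos c_pos by auto
  ultimately have "?x + c \<le> 3 * s * c * ?d" by linarith
  then have "real (?x + c) \<le> real (3 * s * c * ?d)" by (simp only: of_nat_le_iff)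
  then have d: "real (?x + c) \<le> rate * real ?d" unfolding rate_def by simp
  have dx: "?d \<le> ?x" unfolding deg_def by (rule card_mono) auto
  have "live ?S j = live S j - {h \<in> live S j. v \<in> I h}"
    unfolding live_def drop_color_def by auto
  then have x': "card (live ?S j) = ?x - ?d"
    unfolding deg_def by (simp add: card_Diff_subset)
  define y where "y = real (?x + c)"
  define y' where "y' = real (card (live ?S j) + c)"
  have y: "y > 0" "y' > 0" using c_pos by (auto simp: y_def y'_def)
  have y': "y' = y - real ?d" unfolding y_def y'_def x' using dx by (simp add: of_nat_diff)
  \<comment> \<open>This is \<open>ln (1 - x) \<le> - x\<close> for \<open>x = d / y\<close>, where
    \<open>x \<ge> 1 / rate\<close> by the degree bound.\<close>
  have "ln y' = ln y + ln (y' / y)" using y by (simp add: ln_div)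
  also have "ln (y' / y) \<le> y' / y - 1" using y by (intro ln_le_minus_one) simp
  also have "y' / y - 1 = - (real ?d / y)" unfolding y' using y by (simp add: field_simps)
  also have "\<dots> \<le> - (1 / rate)"
    using d y rate_pos unfolding y_def[symmetric] by (simp add: field_simps)
  finally have lnj: "ln y' \<le> ln y - 1 / rate" by simp
  have "potential ?S = ln y' + (\<Sum>j'\<in>{..<k} - {j}. ln (real (card (live ?S j') + c)))"
    unfolding potential_def y'_def using j by (subst sum.remove[of _ j]) auto
  also have "(\<Sum>j'\<in>{..<k} - {j}. ln (real (card (live ?S j') + c)))
      \<le> (\<Sum>j'\<in>{..<k} - {j}. ln (real (card (live S j') + c)))"
  proof (rule sum_mono)
    fix j'
    have "card (live ?S j') \<le> card (live S j')"
      by (rule card_mono) (use live_drop_color in auto)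
    then show "ln (real (card (live ?S j') + c)) \<le> ln (real (card (live S j') + c))"
      using c_pos by (intro ln_mono) auto
  qed
  also have "ln y' \<le> ln y - 1 / rate" by (rule lnj)
  also have "ln y - 1 / rate + (\<Sum>j'\<in>{..<k} - {j}. ln (real (card (live S j') + c))) = potential S - 1 / rate"
    unfolding potential_def y_def using j by (subst (2) sum.remove[of _ j]) auto
  finally have "potential ?S \<le> potential S - 1 / rate" by simp
  then have "rate * potential ?S \<le> rate * (potential S - 1 / rate)"
    using rate_pos by (intro mult_left_mono) auto
  then show ?thesis using rate_pos by (simp add: right_diff_distrib)
qed

end

subsection \<open>Formulas that select the branching vertex\<close>

abbreviation EqF :: "nexp \<Rightarrow> nexp \<Rightarrow> nexp" where "EqF e f \<equiv> Conj (Le e f) (Le f e)"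

text \<open>Bound names are kept apart to avoid capture: 10 and 11 inside edges and lists, 12 for
  edges in a degree, 4 and 5 for competitors in \<open>bestF\<close>, 0 to 3 for the choices being
  made, 20 and 21 for the entry of an updated matrix.\<close>

definition liveF :: "nexp \<Rightarrow> nexp \<Rightarrow> nexp" where
  "liveF h i = Neg (Count 10 RN (Conj (Inc h (NV 10)) (Neg (Al (NV 10) i))))"

definition sizeF :: "nexp \<Rightarrow> nexp \<Rightarrow> nexp" where
  "sizeF h i = Count 10 RN (Conj (Inc h (NV 10))
     (Count 11 RK (Conj (Neg (EqF (NV 11) i)) (Al (NV 10) (NV 11)))))"

definition smallF :: "nexp \<Rightarrow> nexp \<Rightarrow> nexp" where
  "smallF h i = Conj (liveF h i) (Le (sizeF h i) Thr)"

definition degF :: "nexp \<Rightarrow> nexp \<Rightarrow> nexp" where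
  "degF v j = Count 12 RM (Conj (Inc (NV 12) v) (liveF (NV 12) j))"

definition eligibleF :: "nexp \<Rightarrow> nexp \<Rightarrow> nexp \<Rightarrow> nexp \<Rightarrow> nexp" where
  "eligibleF h i v j = Conj (Inc h v) (Conj (Al v j) (Neg (EqF j i)))"

definition bestF :: "nexp \<Rightarrow> nexp \<Rightarrow> nexp \<Rightarrow> nexp \<Rightarrow> nexp" where
  "bestF h i v j = Conj (eligibleF h i v j) (Neg (Count 4 RN (Count 5 RK
     (Conj (eligibleF h i (NV 4) (NV 5)) (Neg (Le (degF (NV 4) (NV 5)) (degF v j)))))))"

definition foundF :: nexp where "foundF = Count 0 RM (Count 1 RK (smallF (NV 0) (NV 1)))"
text \<open>The language has no local definitions, so each choice is a closed formula that contains
  the earlier ones. Evaluation is deterministic, hence all occurrences denote the same edge, color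
  or vertex.\<close>

definition hF :: nexp where "hF = Find 0 RM (Count 1 RK (smallF (NV 0) (NV 1)))"
definition iF :: nexp where "iF = Find 1 RK (smallF hF (NV 1))"
definition branchF :: nexp where "branchF = Count 2 RN (Count 3 RK (bestF hF iF (NV 2) (NV 3)))"
definition vF :: nexp where "vF = Find 2 RN (Count 3 RK (bestF hF iF (NV 2) (NV 3)))"
definition jF :: nexp where "jF = Find 3 RK (bestF hF iF vF (NV 3))"
definition nonemptyF :: nexp where
  "nonemptyF = Neg (Count 0 RN (Neg (Count 1 RK (Al (NV 0) (NV 1)))))"

text \<open>Names 20 and 21 are the row (vertex) and the column (color) of the new matrix;
  \<open>BuildE\<close> binds them.\<close>

definition dropF :: "nexp \<Rightarrow> nexp \<Rightarrow> nexp" where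
  "dropF v j = Conj (Al (NV 20) (NV 21)) (Neg (Conj (EqF (NV 20) v) (EqF (NV 21) j)))"
definition fixF :: "nexp \<Rightarrow> nexp \<Rightarrow> nexp" where
  "fixF v j = Conj (Al (NV 20) (NV 21)) (Neg (Conj (EqF (NV 20) v) (Neg (EqF (NV 21) j))))"

lemmas closed_defs = foundF_def hF_def iF_def branchF_def vF_def jF_def nonemptyF_def
  liveF_def sizeF_def smallF_def degF_def eligibleF_def bestF_def dropF_def fixF_def

lemma fv_hF [simp]: "fv hF = {}" unfolding closed_defs by (simp; blast)
lemma fv_iF [simp]: "fv iF = {}" unfolding iF_def smallF_def liveF_def sizeF_def by (simp; blast)
lemma fv_vF [simp]: "fv vF = {}"
  unfolding vF_def bestF_def eligibleF_def degF_def liveF_def by (simp; blast)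
lemma fv_jF [simp]: "fv jF = {}"
  unfolding jF_def bestF_def eligibleF_def degF_def liveF_def by (simp; blast)
lemma fv_foundF [simp]: "fv foundF = {}" unfolding closed_defs by (simp; blast)
lemma fv_branchF [simp]: "fv branchF = {}"
  unfolding branchF_def bestF_def eligibleF_def degF_def liveF_def by (simp; blast)
lemma fv_nonemptyF [simp]: "fv nonemptyF = {}" unfolding closed_defs by simp
lemma fv_degF [simp]: "fv (degF vF jF) = {}" unfolding degF_def liveF_def by simp
lemma fv_dropF [simp]: "fv (dropF v j) = {20, 21} \<union> fv v \<union> fv j" unfolding dropF_def by auto
lemma fv_fixF [simp]: "fv (fixF v j) = {20, 21} \<union> fv v \<union> fv j" unfolding fixF_def by auto

context instance_data begin

lemma nv_Count_nonzero: "nv S (Count x r e) \<sigma> \<noteq> 0 \<longleftrightarrow> (\<exists>a<bd r. nv S e (\<sigma>(x := a)) \<noteq> 0)"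
  by (auto simp: card_eq_0_iff)

lemma nv_Find:
  assumes "\<exists>a<bd r. nv S e (\<sigma>(x := a)) \<noteq> 0"
  shows "nv S (Find x r e) \<sigma> < bd r \<and> nv S e (\<sigma>(x := nv S (Find x r e) \<sigma>)) \<noteq> 0"
  using LeastI_ex[OF assms] assms by (simp only: nv.simps simp_thms if_True)

end

context hypergraph begin

lemma nv_liveF:
  assumes "10 \<notin> fv h" "10 \<notin> fv i" "nv S h \<sigma> < m" "nv S i \<sigma> < k"
  shows "nv S (liveF h i) \<sigma> = of_bool (nv S h \<sigma> \<in> live S (nv S i \<sigma>))"
  using assms I_sub[of "nv S h \<sigma>"] unfolding liveF_def live_def by (auto simp: card_eq_0_iff)

lemma nv_sizeF:
  assumes "10 \<notin> fv h" "10 \<notin> fv i" "11 \<notin> fv h" "11 \<notin> fv i" "nv S h \<sigma> < m"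
  shows "nv S (sizeF h i) \<sigma> = card (undecided S (nv S h \<sigma>) (nv S i \<sigma>))"
proof -
  have "nv S (sizeF h i) \<sigma> = card {a. a < n \<and> a \<in> I (nv S h \<sigma>) \<and>
     nv S (Count 11 RK (Conj (Neg (EqF (NV 11) i)) (Al (NV 10) (NV 11)))) (\<sigma>(10 := a)) \<noteq> 0}"
    unfolding sizeF_def using assms by (simp del: nv.simps(8) add: nv.simps(8)[of _ 10] cong: conj_cong)
  also have "{a. a < n \<and> a \<in> I (nv S h \<sigma>) \<and>
     nv S (Count 11 RK (Conj (Neg (EqF (NV 11) i)) (Al (NV 10) (NV 11)))) (\<sigma>(10 := a)) \<noteq> 0}
     = undecided S (nv S h \<sigma>) (nv S i \<sigma>)"
    unfolding nv_Count_nonzero undecided_def using assms I_sub[of "nv S h \<sigma>"] by auto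
  finally show ?thesis .
qed

definition small :: "(nat \<Rightarrow> nat set) \<Rightarrow> nat \<Rightarrow> nat \<Rightarrow> bool" where
  "small S h i \<longleftrightarrow> h \<in> live S i \<and> card (undecided S h i) \<le> s"

lemma nv_smallF:
  assumes "10 \<notin> fv h" "10 \<notin> fv i" "11 \<notin> fv h" "11 \<notin> fv i" "nv S h \<sigma> < m" "nv S i \<sigma> < k"
  shows "nv S (smallF h i) \<sigma> = of_bool (small S (nv S h \<sigma>) (nv S i \<sigma>))"
  using assms unfolding smallF_def small_def by (simp add: nv_liveF nv_sizeF)

lemma nv_degF:
  assumes "{10, 12} \<inter> (fv v \<union> fv j) = {}" "nv S v \<sigma> < n" "nv S j \<sigma> < k"
  shows "nv S (degF v j) \<sigma> = deg S (nv S v \<sigma>) (nv S j \<sigma>)"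
proof -
  have "nv S (degF v j) \<sigma> = card {h. h < m \<and> nv S v \<sigma> \<in> I h \<and> h \<in> live S (nv S j \<sigma>)}"
    unfolding degF_def using assms by (simp add: nv_liveF cong: conj_cong)
  also have "{h. h < m \<and> nv S v \<sigma> \<in> I h \<and> h \<in> live S (nv S j \<sigma>)} = {h \<in> live S (nv S j \<sigma>). nv S v \<sigma> \<in> I h}"
    by (auto simp: live_def)
  finally show ?thesis by (simp add: deg_def)
qed

lemma nv_eligibleF:
  assumes "nv S h \<sigma> < m"
  shows "nv S (eligibleF h i v j) \<sigma> = of_bool (eligible S (nv S h \<sigma>) (nv S i \<sigma>) (nv S v \<sigma>) (nv S j \<sigma>))"
  using assms I_sub[of "nv S h \<sigma>"] unfolding eligibleF_def eligible_def by auto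

lemma eligible_bounds: "h < m \<Longrightarrow> eligible S h i v j \<Longrightarrow> v < n \<and> j < k"
  unfolding eligible_def using I_sub by blast

definition best :: "(nat \<Rightarrow> nat set) \<Rightarrow> nat \<Rightarrow> nat \<Rightarrow> nat \<Rightarrow> nat \<Rightarrow> bool" where
  "best S h i v j \<longleftrightarrow> eligible S h i v j \<and>
     (\<forall>v' j'. eligible S h i v' j' \<longrightarrow> deg S v' j' \<le> deg S v j)"

lemma nv_bestF:
  assumes fv: "{4, 5} \<inter> (fv h \<union> fv i \<union> fv v \<union> fv j) = {}" "{10, 12} \<inter> (fv v \<union> fv j) = {}"
    and m: "nv S h \<sigma> < m" and v: "nv S v \<sigma> < n" and j: "nv S j \<sigma> < k"
  shows "nv S (bestF h i v j) \<sigma> = of_bool (best S (nv S h \<sigma>) (nv S i \<sigma>) (nv S v \<sigma>) (nv S j \<sigma>))"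
proof -
  let ?e = "\<lambda>v j. eligible S (nv S h \<sigma>) (nv S i \<sigma>) v j"
  let ?c = "Count 4 RN (Count 5 RK (Conj (eligibleF h i (NV 4) (NV 5)) (Neg (Le (degF (NV 4) (NV 5)) (degF v j)))))"
  have upd: "nv S e (\<sigma>(4 := a, 5 := b)) = nv S e \<sigma>" if "4 \<notin> fv e" "5 \<notin> fv e" for e a b
    using that by simp
  have nv: "nv S h (\<sigma>(4 := a, 5 := b)) = nv S h \<sigma>" "nv S i (\<sigma>(4 := a, 5 := b)) = nv S i \<sigma>"
    "nv S v (\<sigma>(4 := a, 5 := b)) = nv S v \<sigma>" "nv S j (\<sigma>(4 := a, 5 := b)) = nv S j \<sigma>" for a b
    using fv by (auto intro!: upd)
  have "nv S (Conj (eligibleF h i (NV 4) (NV 5)) (Neg (Le (degF (NV 4) (NV 5)) (degF v j)))) (\<sigma>(4 := a, 5 := b)) \<noteq> 0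
     \<longleftrightarrow> ?e a b \<and> \<not> deg S a b \<le> deg S (nv S v \<sigma>) (nv S j \<sigma>)" if "a < n" "b < k" for a b
    using that m v j fv(2) by (simp add: nv_eligibleF nv_degF nv)
  then have "nv S ?c \<sigma> \<noteq> 0 \<longleftrightarrow> (\<exists>a<n. \<exists>b<k. ?e a b \<and> \<not> deg S a b \<le> deg S (nv S v \<sigma>) (nv S j \<sigma>))"
    unfolding nv_Count_nonzero by (simp del: nv.simps cong: conj_cong)
  also have "\<dots> \<longleftrightarrow> (\<exists>a b. ?e a b \<and> \<not> deg S a b \<le> deg S (nv S v \<sigma>) (nv S j \<sigma>))"
    using eligible_bounds[OF m] by blast
  finally show ?thesis
    unfolding bestF_def best_def nv.simps(6,7) nv_eligibleF[OF m] by auto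
qed

abbreviation zero :: "nat \<Rightarrow> nat" where "zero \<equiv> \<lambda>_. 0"

lemma foundF: "nv S foundF zero \<noteq> 0 \<longleftrightarrow> (\<exists>h<m. \<exists>i<k. small S h i)"
proof -
  have "nv S (smallF (NV 0) (NV 1)) ((zero(0 := h))(1 := i)) = of_bool (small S h i)"
    if "h < m" "i < k" for h i
    using that by (subst nv_smallF) auto
  then show ?thesis unfolding foundF_def nv_Count_nonzero by (simp del: nv.simps cong: conj_cong)
qed

lemma chosen_edge:
  assumes "nv S foundF zero \<noteq> 0"
  shows "nv S hF zero < m" "nv S iF zero < k" "small S (nv S hF zero) (nv S iF zero)"
proof -
  have sm: "nv S (smallF (NV 0) (NV 1)) ((zero(0 := h))(1 := i)) = of_bool (small S h i)"
    if "h < m" "i < k" for h i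
    using that by (subst nv_smallF) auto
  have "\<exists>a<bd RM. nv S (Count 1 RK (smallF (NV 0) (NV 1))) (zero(0 := a)) \<noteq> 0"
    using assms unfolding foundF_def nv_Count_nonzero .
  from nv_Find[OF this] have h: "nv S hF zero < m" and
    "nv S (Count 1 RK (smallF (NV 0) (NV 1))) (zero(0 := nv S hF zero)) \<noteq> 0"
    by (auto simp: hF_def simp del: nv.simps)
  then obtain i where i: "i < k" "small S (nv S hF zero) i"
    unfolding nv_Count_nonzero using sm[OF h] by (auto simp del: nv.simps)
  have sm': "nv S (smallF hF (NV 1)) (zero(1 := i)) = of_bool (small S (nv S hF zero) i)" if "i < k" for i
    using that h by (subst nv_smallF) auto
  have "\<exists>a<bd RK. nv S (smallF hF (NV 1)) (zero(1 := a)) \<noteq> 0"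
    using sm' i by (auto simp del: nv.simps)
  from nv_Find[OF this] show "nv S iF zero < k" "small S (nv S hF zero) (nv S iF zero)"
    using sm' by (auto simp: iF_def simp del: nv.simps)
  show "nv S hF zero < m" by (rule h)
qed

lemma best_exists:
  assumes "h < m" "eligible S h i v j"
  shows "\<exists>v<n. \<exists>j<k. best S h i v j"
proof -
  let ?A = "{(v, j). eligible S h i v j}"
  have "?A \<subseteq> {..<n} \<times> {..<k}" using eligible_bounds[OF assms(1)] by auto
  then have fin: "finite ?A" by (rule finite_subset) auto
  then have fin': "finite ((\<lambda>(v, j). deg S v j) ` ?A)" by simp
  have "Max ((\<lambda>(v, j). deg S v j) ` ?A) \<in> (\<lambda>(v, j). deg S v j) ` ?A"
    by (rule Max_in[OF fin']) (use assms in auto)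
  then obtain v j where "eligible S h i v j" "deg S v j = Max ((\<lambda>(v, j). deg S v j) ` ?A)" by auto
  moreover have "deg S v' j' \<le> Max ((\<lambda>(v, j). deg S v j) ` ?A)" if "eligible S h i v' j'" for v' j'
    by (rule Max_ge[OF fin']) (use that in auto)
  ultimately have "best S h i v j" unfolding best_def by auto
  then show ?thesis using eligible_bounds[OF assms(1)] unfolding best_def by blast
qed

lemma branchF:
  assumes "nv S foundF zero \<noteq> 0"
  shows "nv S branchF zero \<noteq> 0 \<longleftrightarrow> undecided S (nv S hF zero) (nv S iF zero) \<noteq> {}"
proof -
  note h = chosen_edge[OF assms]
  let ?h = "nv S hF zero" and ?i = "nv S iF zero"
  have "nv S (bestF hF iF (NV 2) (NV 3)) ((zero(2 := v))(3 := j)) = of_bool (best S ?h ?i v j)"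
    if "v < n" "j < k" for v j
    using that h by (subst nv_bestF) auto
  then have "nv S branchF zero \<noteq> 0 \<longleftrightarrow> (\<exists>v<n. \<exists>j<k. best S ?h ?i v j)"
    unfolding branchF_def nv_Count_nonzero by (simp del: nv.simps cong: conj_cong)
  also have "\<dots> \<longleftrightarrow> (\<exists>v j. eligible S ?h ?i v j)"
    using best_exists[OF h(1)] unfolding best_def by meson
  also have "\<dots> \<longleftrightarrow> undecided S ?h ?i \<noteq> {}"
    unfolding eligible_def undecided_def by blast
  finally show ?thesis .
qed

lemma chosen_branch:
  assumes "nv S foundF zero \<noteq> 0" "nv S branchF zero \<noteq> 0"
  shows "nv S vF zero < n" "nv S jF zero < k"
    "best S (nv S hF zero) (nv S iF zero) (nv S vF zero) (nv S jF zero)"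
    "nv S (degF vF jF) zero = deg S (nv S vF zero) (nv S jF zero)"
proof -
  note h = chosen_edge[OF assms(1)]
  let ?h = "nv S hF zero" and ?i = "nv S iF zero"
  have b: "nv S (bestF hF iF (NV 2) (NV 3)) ((zero(2 := v))(3 := j)) = of_bool (best S ?h ?i v j)"
    if "v < n" "j < k" for v j
    using that h by (subst nv_bestF) auto
  have "\<exists>a<bd RN. nv S (Count 3 RK (bestF hF iF (NV 2) (NV 3))) (zero(2 := a)) \<noteq> 0"
    using assms(2) unfolding branchF_def nv_Count_nonzero .
  from nv_Find[OF this] have v: "nv S vF zero < n" and
    "nv S (Count 3 RK (bestF hF iF (NV 2) (NV 3))) (zero(2 := nv S vF zero)) \<noteq> 0"
    by (auto simp: vF_def simp del: nv.simps)
  then obtain j where j: "j < k" "best S ?h ?i (nv S vF zero) j"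
    unfolding nv_Count_nonzero using b[OF v] by (auto simp del: nv.simps)
  have b': "nv S (bestF hF iF vF (NV 3)) (zero(3 := j)) = of_bool (best S ?h ?i (nv S vF zero) j)"
    if "j < k" for j
    using that h v by (subst nv_bestF) auto
  have "\<exists>a<bd RK. nv S (bestF hF iF vF (NV 3)) (zero(3 := a)) \<noteq> 0"
    using b' j by (auto simp del: nv.simps)
  from nv_Find[OF this] show j: "nv S jF zero < k" and "best S ?h ?i (nv S vF zero) (nv S jF zero)"
    using b' by (auto simp: jF_def simp del: nv.simps)
  show "nv S (degF vF jF) zero = deg S (nv S vF zero) (nv S jF zero)"
    using v j by (subst nv_degF) auto
  show "nv S vF zero < n" by (rule v)
qed

lemma nonemptyF: "nv S nonemptyF zero \<noteq> 0 \<longleftrightarrow> (\<forall>v<n. \<exists>i<k. i \<in> S v)"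
  unfolding nonemptyF_def nv.simps(7) of_bool_eq_0_iff
  using nv_Count_nonzero[of S 0 RN "Neg (Count 1 RK (Al (NV 0) (NV 1)))" zero]
  unfolding nv.simps(7) of_bool_eq_0_iff nv_Count_nonzero by (auto simp: card_eq_0_iff)

lemma nv_dropF:
  assumes "{20, 21} \<inter> (fv v \<union> fv j) = {}" "a < n" "b < k"
  shows "nv S (dropF v j) (\<sigma>(20 := a, 21 := b)) = of_bool (b \<in> drop_color S (nv S v \<sigma>) (nv S j \<sigma>) a)"
  using assms unfolding dropF_def drop_color_def by auto

lemma nv_fixF:
  assumes "{20, 21} \<inter> (fv v \<union> fv j) = {}" "a < n" "b < k"
  shows "nv S (fixF v j) (\<sigma>(20 := a, 21 := b)) = of_bool (b \<in> fix_color S (nv S v \<sigma>) (nv S j \<sigma>) a)"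
  using assms unfolding fixF_def fix_color_def by auto

end

subsection \<open>The recursive program\<close>

definition BuildE :: "nexp \<Rightarrow> nat \<Rightarrow> (nat \<Rightarrow> nat) \<Rightarrow> expr" where
  "BuildE e b q = Fold (rngE RN b) Nl (Cns (Fold (rngE RK (Suc b)) Nl
     (Cns (cmp e (Suc (Suc b)) (bind 21 (bind 20 q))) (Tl (Var 0)))) (Tl (Var 0)))"

text \<open>The status is reset to \<open>NIL\<close>, so the result can serve both as the next loop
  state and as the argument of a recursive call.\<close>

definition UpdE :: "nexp \<Rightarrow> nat \<Rightarrow> (nat \<Rightarrow> nat) \<Rightarrow> expr" where
  "UpdE e b q = Cns Nl (Cns (Hd (Tl (Var b))) (Cns (BuildE e b q) (Tl (Tl (Tl (Var b))))))"

definition upd_time :: "nexp \<Rightarrow> nat \<Rightarrow> nat" where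
  "upd_time e N = N * (N * (tb e N + 20) + 30) + 40"

definition statusE :: "expr \<Rightarrow> expr" where
  "statusE v = Cns v (Tl (Var 0))"

text \<open>If the degree is 0, setting \<open>S v = {j}\<close> loses no coloring and there is no recursive call; this
  keeps the potential argument valid, which needs a positive degree.\<close>

definition stepE :: expr where
  "stepE = Cond (Hd (Var 0)) (Var 0)
    (Cond (cmp foundF 0 (\<lambda>_. 0))
      (Cond (cmp branchF 0 (\<lambda>_. 0))
        (Cond (Cond (cmp (degF vF jF) 0 (\<lambda>_. 0)) (Rec (UpdE (dropF vF jF) 0 (\<lambda>_. 0))) Nl)
          (statusE (Cns Tr Nl)) (UpdE (fixF vF jF) 0 (\<lambda>_. 0)))
        (statusE (Cns Nl Nl)))
      (Cond (cmp nonemptyF 0 (\<lambda>_. 0)) (statusE (Cns Tr Nl)) (statusE (Cns Nl Nl))))"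

text \<open>The list driving the loop only counts rounds. The extra \<open>Nl\<close> provides round
  \<open>n + 1\<close>: up to \<open>n\<close> rounds decide a vertex, and one more reaches a
  verdict. Rounds after the verdict copy the state. The \<open>Let\<close> moves the accumulator to
  index 0, where \<open>stepE\<close> expects the data.\<close>

definition decideE :: expr where
  "decideE = Hd (Hd (Fold (Cns Nl (rngE RN 0)) (Var 0) (Let (Tl (Var 0)) stepE)))"

definition step_time :: "nat \<Rightarrow> nat" where
  "step_time N = tb foundF N + tb branchF N + tb (degF vF jF) N + upd_time (dropF vF jF) N +
     upd_time (fixF vF jF) N + tb nonemptyF N + 50"

text \<open>Chosen so that the cost of one call whose recursive calls take time
  \<open>T \<ge> 1\<close> is at most \<open>node_time N * T\<close>; the total is then a
  power.\<close>

definition node_time :: "nat \<Rightarrow> nat" where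
  "node_time N = (N + 1) * (step_time N + 50)"

context instance_data begin

lemma foldr_Pair: "foldr (\<lambda>x. Pair (f x)) xs NIL = enc_list (map f xs)"
  by (induction xs) auto

lemma evals_Build:
  assumes N: "n \<le> N" "k \<le> N" "m \<le> N" "s \<le> N" "1 \<le> N"
    and b: "b < length \<rho>" "\<rho> ! b = data st S"
    and fv: "\<And>x. x \<in> fv e - {20, 21} \<Longrightarrow> q x < length \<rho> \<and> hd_s (hd_s (\<rho> ! q x)) = enc_nat (\<sigma> x) \<and> \<sigma> x \<le> N"
    and S': "\<And>v i. v < n \<Longrightarrow> i < k \<Longrightarrow> nv S e (\<sigma>(20 := v, 21 := i)) = of_bool (i \<in> S' v)"
  shows "evals p \<rho> (BuildE e b q) (mat n k (\<lambda>v i. i \<in> S' v)) (N * (N * (tb e N + 20) + 30) + 20) D"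
proof -
  let ?row = "\<lambda>v. enc_list (map (\<lambda>i. enc_bool (i \<in> S' v)) [0..<k])"
  have "evals p \<rho> (BuildE e b q) (foldr (\<lambda>v. Pair (?row v)) [0..<n] NIL)
    (7 + 1 + n * ((7 + 1 + k * ((tb e N + 2 + 1) + 7) + 6 + 2 + 1) + 7) + 6) D"
    unfolding BuildE_def
  proof (rule evals_Fold_rng[OF _ evals_Nl])
    show "evals p \<rho> (rngE RN b) (rng n) 7 D" using evals_rngE[OF b, where r = RN] by simp
    fix v acc rest assume v: "v < n"
    let ?\<rho> = "Pair (Pair (enc_nat v) rest) acc # \<rho>"
    have "evals p ?\<rho> (Fold (rngE RK (Suc b)) Nl (Cns (cmp e (Suc (Suc b)) (bind 21 (bind 20 q))) (Tl (Var 0))))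
      (foldr (\<lambda>i. Pair (enc_bool (i \<in> S' v))) [0..<k] NIL) (7 + 1 + k * ((tb e N + 2 + 1) + 7) + 6) D"
    proof (rule evals_Fold_rng[OF _ evals_Nl])
      show "evals p ?\<rho> (rngE RK (Suc b)) (rng k) 7 D"
        using evals_rngE[of "Suc b" ?\<rho> st S p RK D] b by simp
      fix i acc' rest' assume i: "i < k"
      let ?\<rho>' = "Pair (Pair (enc_nat i) rest') acc' # ?\<rho>"
      have "evals p ?\<rho>' (cmp e (Suc (Suc b)) (bind 21 (bind 20 q)))
        (enc_nat (nv S e (\<sigma>(20 := v, 21 := i)))) (tb e N) D"
      proof (rule evals_cmp_aux[OF N, THEN conjunct1])
        fix x assume "x \<in> fv e"
        then show "bind 21 (bind 20 q) x < length ?\<rho>' \<and>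
          hd_s (hd_s (?\<rho>' ! bind 21 (bind 20 q) x)) = enc_nat ((\<sigma>(20 := v, 21 := i)) x) \<and> (\<sigma>(20 := v, 21 := i)) x \<le> N"
          using fv[of x] v i N unfolding bind_def by auto
      qed (use b in auto)
      then have 1: "evals p ?\<rho>' (cmp e (Suc (Suc b)) (bind 21 (bind 20 q)))
        (enc_bool (i \<in> S' v)) (tb e N) D" using S'[OF v i] by (simp add: enc_bool_nat)
      have 2: "evals p ?\<rho>' (Tl (Var 0)) acc' 2 D"
        using evals_Tl[OF evals_Var[of 0 ?\<rho>' "?\<rho>' ! 0" p D] refl] by (simp add: numeral_2_eq_2)
      show "evals p ?\<rho>' (Cns (cmp e (Suc (Suc b)) (bind 21 (bind 20 q))) (Tl (Var 0)))
        (Pair (enc_bool (i \<in> S' v)) acc') (tb e N + 2 + 1) D"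
        by (rule evals_Cns[OF 1 2])
    qed
    then have 1: "evals p ?\<rho> (Fold (rngE RK (Suc b)) Nl (Cns (cmp e (Suc (Suc b)) (bind 21 (bind 20 q))) (Tl (Var 0))))
      (?row v) (7 + 1 + k * ((tb e N + 2 + 1) + 7) + 6) D" by (simp only: foldr_Pair)
    have 2: "evals p ?\<rho> (Tl (Var 0)) acc 2 D"
      using evals_Tl[OF evals_Var[of 0 ?\<rho> "?\<rho> ! 0" p D] refl] by (simp add: numeral_2_eq_2)
    show "evals p ?\<rho> (Cns (Fold (rngE RK (Suc b)) Nl (Cns (cmp e (Suc (Suc b)) (bind 21 (bind 20 q))) (Tl (Var 0)))) (Tl (Var 0)))
      (Pair (?row v) acc) (7 + 1 + k * ((tb e N + 2 + 1) + 7) + 6 + 2 + 1) D"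
      by (rule evals_Cns[OF 1 2])
  qed
  moreover have "foldr (\<lambda>v. Pair (?row v)) [0..<n] NIL = mat n k (\<lambda>v i. i \<in> S' v)"
    unfolding mat_def by (rule foldr_Pair)
  moreover have "n * ((7 + 1 + k * ((tb e N + 2 + 1) + 7) + 6 + 2 + 1) + 7) \<le> N * (N * (tb e N + 20) + 30)"
  proof (rule mult_mono)
    have "k * ((tb e N + 2 + 1) + 7) \<le> N * (tb e N + 20)" using N by (intro mult_mono) auto
    then show "7 + 1 + k * ((tb e N + 2 + 1) + 7) + 6 + 2 + 1 + 7 \<le> N * (tb e N + 20) + 30" by linarith
  qed (use N in auto)
  ultimately show ?thesis by (auto elim!: evals_mono)
qed

lemma evals_Upd:
  assumes N: "n \<le> N" "k \<le> N" "m \<le> N" "s \<le> N" "1 \<le> N"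
    and b: "b < length \<rho>" "\<rho> ! b = data st S"
    and fv: "\<And>x. x \<in> fv e - {20, 21} \<Longrightarrow> q x < length \<rho> \<and> hd_s (hd_s (\<rho> ! q x)) = enc_nat (\<sigma> x) \<and> \<sigma> x \<le> N"
    and S': "\<And>v i. v < n \<Longrightarrow> i < k \<Longrightarrow> nv S e (\<sigma>(20 := v, 21 := i)) = of_bool (i \<in> S' v)"
  shows "evals p \<rho> (UpdE e b q) (data NIL S') (upd_time e N) D"
proof -
  have 1: "evals p \<rho> (Hd (Tl (Var b))) (enc_nat s) 3 D"
    using evals_Hd[OF evals_Tl[OF evals_Var[OF b] refl] refl] unfolding data_def by (simp add: eval_nat_numeral)
  have 2: "evals p \<rho> (Tl (Tl (Tl (Var b)))) (Pair (mat m n (\<lambda>h v. v \<in> I h)) (Pair (rng n) (Pair (rng k) (rng m)))) 4 D"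
    using evals_Tl[OF evals_Tl[OF evals_Tl[OF evals_Var[OF b] refl] refl] refl] unfolding data_def by (simp add: eval_nat_numeral)
  show ?thesis unfolding UpdE_def data_def
    by (rule evals_mono[OF evals_Cns[OF evals_Nl evals_Cns[OF 1 evals_Cns[OF evals_Build[OF N b fv S'] 2]]]])
      (auto simp: upd_time_def)
qed

lemma evals_cmp:
  assumes "n \<le> N" "k \<le> N" "m \<le> N" "s \<le> N" "1 \<le> N" "b < length \<rho>" "\<rho> ! b = data st S" "fv e = {}"
  shows "evals p \<rho> (cmp e b q) (enc_nat (nv S e \<sigma>)) (tb e N) D"
  by (rule evals_cmp_aux[OF assms(1-7), THEN conjunct1]) (use assms in auto)

lemma evals_status:
  assumes "evals p (data st S # \<rho>) e v T D"
  shows "evals p (data st S # \<rho>) (statusE e) (data v S) (T + 3) D"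
  unfolding statusE_def
  using evals_Cns[OF assms evals_Tl[OF evals_Var[of 0 "data st S # \<rho>" "data st S"] refl]]
  by (simp add: data_def eval_nat_numeral)

end

section \<open>Correctness, time and depth of the decision procedure\<close>

context intersecting_hypergraph begin

definition answer_ok :: "(nat \<Rightarrow> nat set) \<Rightarrow> sexp \<Rightarrow> bool" where
  "answer_ok S r \<longleftrightarrow> (r \<noteq> NIL \<longleftrightarrow> colorable S)"

lemma branch_facts:
  assumes f: "nv S foundF (\<lambda>_. 0) \<noteq> 0" and br: "nv S branchF (\<lambda>_. 0) \<noteq> 0"
  defines "v \<equiv> nv S vF (\<lambda>_. 0)" and "j \<equiv> nv S jF (\<lambda>_. 0)"
  shows "v < n" "j < k" "multi (fix_color S v j) < multi S"
    "nv S (degF vF jF) (\<lambda>_. 0) = 0 \<Longrightarrow> colorable S \<longleftrightarrow> colorable (fix_color S v j)"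
    "nv S (degF vF jF) (\<lambda>_. 0) \<noteq> 0 \<Longrightarrow> rate * potential (drop_color S v j) + 1 \<le> rate * potential S"
proof -
  define h where "h = nv S hF (\<lambda>_. 0)"
  define i where "i = nv S iF (\<lambda>_. 0)"
  note e = chosen_edge[OF f, folded h_def i_def]
  note b = chosen_branch[OF f br, folded h_def i_def v_def j_def]
  show vj: "v < n" "j < k" by (rule b)+
  have el: "eligible S h i v j" using b(3) unfolding best_def by blast
  have h: "h \<in> live S i" "card (undecided S h i) \<le> s" using e(3) unfolding small_def by auto
  have "v \<in> I h" "j \<in> S v" "j \<noteq> i" using el unfolding eligible_def by auto
  \<comment> \<open>Since \<open>h\<close> is live for \<open>i\<close>, the vertex allows a second
    color besides \<open>j\<close>, so fixing it lowers \<open>multi\<close>.\<close>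
  moreover from this h have "i \<in> S v" unfolding live_def by blast
  ultimately show "multi (fix_color S v j) < multi S"
    using multi_fix_color[of v i j S] vj e(2) by auto
  show "colorable S \<longleftrightarrow> colorable (fix_color S v j)" if "nv S (degF vF jF) (\<lambda>_. 0) = 0"
  proof -
    have "{h \<in> live S j. v \<in> I h} = {}" using that b(4) unfolding deg_def by simp
    then show ?thesis using colorable_fix_free[of v j S] vj \<open>j \<in> S v\<close> by blast
  qed
  show "rate * potential (drop_color S v j) + 1 \<le> rate * potential S" if "nv S (degF vF jF) (\<lambda>_. 0) \<noteq> 0"
    by (rule potential_drop[OF h(1) e(2) h(2) el]) (use that b best_def in auto)
qed

text \<open>\<open>D\<close> is the depth still available, and the scaled potential stays below
  \<open>D + 1\<close>. A recursive call lowers it by at least 1, which matches the step from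
  \<open>D\<close> to \<open>D - 1\<close>. The claim for smaller depth enters as a hypothesis, so
  that one round can be analyzed before the induction on \<open>D\<close>.\<close>

lemma evals_step:
  assumes N: "n \<le> N" "k \<le> N" "m \<le> N" "s \<le> N" "1 \<le> N" and km: "k * m < 2 ^ Suc s"
    and pot: "rate * potential S < real D + 1"
    and IH: "\<And>D' S'. D = Suc D' \<Longrightarrow> rate * potential S' < real D' + 1 \<Longrightarrow>
      \<exists>r. evals p [data NIL S'] p r T D' \<and> answer_ok S' r"
  shows "\<exists>st S'. evals p (data NIL S # \<rho>) stepE (data st S') (step_time N + T) D \<and>
    (st = NIL \<and> (\<forall>v. S' v \<subseteq> S v) \<and> (colorable S' \<longleftrightarrow> colorable S) \<and> multi S' < multi S \<or>
     st \<noteq> NIL \<and> answer_ok S (hd_s st))"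
proof -
  let ?\<rho> = "data NIL S # \<rho>"
  let ?nv = "\<lambda>e. nv S e (\<lambda>_. 0)"
  have c: "evals p ?\<rho> (cmp e 0 (\<lambda>_. 0)) (enc_nat (?nv e)) (tb e N) D" if "fv e = {}" for e
    by (rule evals_cmp[OF N, where st = NIL]) (use that in auto)
  have cF: "evals p ?\<rho> (cmp e 0 (\<lambda>_. 0)) NIL (tb e N) D" if "fv e = {}" "?nv e = 0" for e
    using c[OF that(1)] that(2) by simp
  have d: "evals p ?\<rho> (Hd (Var 0)) NIL 2 D"
    using evals_Hd[OF evals_Var[of 0 ?\<rho> "?\<rho> ! 0"] refl] by (simp add: data_def eval_nat_numeral)
  have yes: "evals p ?\<rho> (statusE (Cns Tr Nl)) (data (Pair (Pair NIL NIL) NIL) S) 8 D"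
    using evals_status[OF evals_Cns[OF evals_Tr evals_Nl]] by simp
  have no: "evals p ?\<rho> (statusE (Cns Nl Nl)) (data (Pair NIL NIL) S) 6 D"
    using evals_status[OF evals_Tr] by simp
  have step: "evals p ?\<rho> stepE out (step_time N + T) D"
    if "evals p ?\<rho> (Cond (cmp foundF 0 (\<lambda>_. 0))
      (Cond (cmp branchF 0 (\<lambda>_. 0))
        (Cond (Cond (cmp (degF vF jF) 0 (\<lambda>_. 0)) (Rec (UpdE (dropF vF jF) 0 (\<lambda>_. 0))) Nl)
          (statusE (Cns Tr Nl)) (UpdE (fixF vF jF) 0 (\<lambda>_. 0)))
        (statusE (Cns Nl Nl)))
      (Cond (cmp nonemptyF 0 (\<lambda>_. 0)) (statusE (Cns Tr Nl)) (statusE (Cns Nl Nl)))) out (step_time N + T - 3) D" for out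
    unfolding stepE_def
    by (rule evals_mono[OF evals_CondF[OF d that]]) (auto simp: step_time_def)
  show ?thesis
  proof (cases "?nv foundF = 0")
    case True
    then have ns: "\<And>h i. h < m \<Longrightarrow> i < k \<Longrightarrow> \<not> small S h i" using foundF[of S] by auto
    show ?thesis
    proof (cases "?nv nonemptyF = 0")
      case False
      have "evals p ?\<rho> stepE (data (Pair (Pair NIL NIL) NIL) S) (step_time N + T) D"
        by (rule step, rule evals_mono[OF evals_CondF[OF cF[OF fv_foundF True] evals_CondT[OF c[OF fv_nonemptyF] _ yes]]])
          (use False in \<open>auto simp: step_time_def\<close>)
      moreover have "colorable S"
      proof (rule colorable_if_no_small[OF km])
        show "s < card (undecided S h i)" if "i < k" "h \<in> live S i" for i h
          using ns[of h i] that unfolding small_def live_def by auto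
        show "\<exists>i<k. i \<in> S v" if "v < n" for v using nonemptyF[of S] False that by blast
      qed
      ultimately show ?thesis unfolding answer_ok_def by (intro exI conjI disjI2) auto
    next
      case t: True
      have "evals p ?\<rho> stepE (data (Pair NIL NIL) S) (step_time N + T) D"
        by (rule step, rule evals_mono[OF evals_CondF[OF cF[OF fv_foundF True] evals_CondF[OF cF[OF fv_nonemptyF t] no]]])
          (use True t in \<open>auto simp: step_time_def\<close>)
      moreover have "\<not> colorable S"
        using nonemptyF[of S] t unfolding colorable_def proper_def by metis
      ultimately show ?thesis unfolding answer_ok_def by (intro exI conjI disjI2) auto
    qed
  next
    case f: False
    show ?thesis
    proof (cases "?nv branchF = 0")
      case True
      have "evals p ?\<rho> stepE (data (Pair NIL NIL) S) (step_time N + T) D"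
        by (rule step, rule evals_mono[OF evals_CondT[OF c[OF fv_foundF] _ evals_CondF[OF cF[OF fv_branchF True] no]]])
          (use f in \<open>auto simp: step_time_def\<close>)
      moreover have "\<not> colorable S"
        using branchF[OF f] True chosen_edge[OF f] not_colorable_if_decided unfolding small_def by blast
      ultimately show ?thesis unfolding answer_ok_def by (intro exI conjI disjI2) auto
    next
      case br: False
      let ?v = "?nv vF" and ?j = "?nv jF"
      note bf = branch_facts[OF f br]
      have fixu: "evals p ?\<rho> (UpdE (fixF vF jF) 0 (\<lambda>_. 0)) (data NIL (fix_color S ?v ?j)) (upd_time (fixF vF jF) N) D"
        by (rule evals_Upd[OF N, where \<sigma> = "\<lambda>_. 0" and st = NIL and S = S]) (auto simp: nv_fixF simp del: fun_upd_apply)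
      have dropu: "evals p ?\<rho> (UpdE (dropF vF jF) 0 (\<lambda>_. 0)) (data NIL (drop_color S ?v ?j)) (upd_time (dropF vF jF) N) D" for D
        by (rule evals_Upd[OF N, where \<sigma> = "\<lambda>_. 0" and st = NIL and S = S]) (auto simp: nv_dropF simp del: fun_upd_apply)
      let ?test = "Cond (cmp (degF vF jF) 0 (\<lambda>_. 0)) (Rec (UpdE (dropF vF jF) 0 (\<lambda>_. 0))) Nl"
      \<comment> \<open>The test yields \<open>NIL\<close> either for degree 0 or for an uncolorable
        instance without \<open>j\<close> at \<open>v\<close>. In both cases fixing \<open>j\<close>
        preserves colorability.\<close>
      have "\<exists>r. evals p ?\<rho> ?test r (tb (degF vF jF) N + (upd_time (dropF vF jF) N + T + 1) + 1 + 1) D \<and>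
        (r \<noteq> NIL \<longrightarrow> colorable S) \<and> (r = NIL \<longrightarrow> (colorable (fix_color S ?v ?j) \<longleftrightarrow> colorable S))"
      proof (cases "?nv (degF vF jF) = 0")
        case True
        have "evals p ?\<rho> ?test NIL (tb (degF vF jF) N + (upd_time (dropF vF jF) N + T + 1) + 1 + 1) D"
          by (rule evals_Cond[OF c]) (use True evals_Nl in auto)
        then show ?thesis using bf(4)[OF True] by blast
      next
        case False
        note p = bf(5)[OF False]
        have "0 \<le> rate * potential (drop_color S ?v ?j)" using rate_pos potential_nonneg by simp
        \<comment> \<open>The scaled potential is nonnegative after the drop, so it was at least 1
          before.\<close>
        then have "D \<noteq> 0" using p pot by (cases D) auto
        then obtain D' where D': "D = Suc D'" by (cases D) auto
        then obtain r where r: "evals p [data NIL (drop_color S ?v ?j)] p r T D'" "answer_ok (drop_color S ?v ?j) r"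
          using IH[OF D', of "drop_color S ?v ?j"] p pot by auto
        have "evals p ?\<rho> (Rec (UpdE (dropF vF jF) 0 (\<lambda>_. 0))) r (upd_time (dropF vF jF) N + T + 1) D"
          unfolding D' by (rule evals_Rec[OF dropu r(1)])
        then have "evals p ?\<rho> ?test r (tb (degF vF jF) N + (upd_time (dropF vF jF) N + T + 1) + 1 + 1) D"
          by (intro evals_Cond[OF c]) (use False in auto)
        moreover have "colorable S \<longleftrightarrow> r \<noteq> NIL \<or> colorable (fix_color S ?v ?j)"
          using r(2) colorable_branch[of S ?v ?j] unfolding answer_ok_def by blast
        ultimately show ?thesis by blast
      qed
      then obtain r where r: "evals p ?\<rho> ?test r (tb (degF vF jF) N + (upd_time (dropF vF jF) N + T + 1) + 1 + 1) D"
        "r \<noteq> NIL \<Longrightarrow> colorable S" "r = NIL \<Longrightarrow> colorable (fix_color S ?v ?j) \<longleftrightarrow> colorable S" by blast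
      define out where "out = (if r \<noteq> NIL then data (Pair (Pair NIL NIL) NIL) S else data NIL (fix_color S ?v ?j))"
      have "evals p ?\<rho> (Cond ?test (statusE (Cns Tr Nl)) (UpdE (fixF vF jF) 0 (\<lambda>_. 0))) out
        (tb (degF vF jF) N + (upd_time (dropF vF jF) N + T + 1) + 1 + 1 + 8 + upd_time (fixF vF jF) N + 1) D"
        by (rule evals_Cond[OF r(1)]) (use yes fixu out_def in auto)
      note inner = this
      have ev: "evals p ?\<rho> stepE out (step_time N + T) D"
        by (rule step, rule evals_mono[OF evals_CondT[OF c[OF fv_foundF] _ evals_CondT[OF c[OF fv_branchF] _ inner]]])
          (use br f in \<open>auto simp: step_time_def\<close>)
      show ?thesis
      proof (cases "r = NIL")
        case True
        then show ?thesis using ev r(3)[OF True] bf(3) fix_color_le[of S ?v ?j] unfolding out_def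
          by (intro exI[of _ NIL] exI[of _ "fix_color S ?v ?j"]) auto
      next
        case False
        then show ?thesis using ev r(2)[OF False] unfolding out_def answer_ok_def
          by (intro exI[of _ "Pair (Pair NIL NIL) NIL"] exI[of _ S]) auto
      qed
    qed
  qed
qed

lemma evals_decideE:
  assumes N: "n \<le> N" "k \<le> N" "m \<le> N" "s \<le> N" "1 \<le> N" and km: "k * m < 2 ^ Suc s"
    and pot: "rate * potential S < real D + 1"
    and IH: "\<And>D' S'. D = Suc D' \<Longrightarrow> rate * potential S' < real D' + 1 \<Longrightarrow>
      \<exists>r. evals p [data NIL S'] p r T D' \<and> answer_ok S' r"
  shows "\<exists>r. evals p [data NIL S] decideE r ((N + 1) * (step_time N + T + 10) + 20) D \<and> answer_ok S r"
proof -
  \<comment> \<open>As long as there is no verdict, every round lowers \<open>multi\<close>. At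
    \<open>t = n + 1\<close> the inequality \<open>multi S' + t \<le> n\<close> is impossible, so a
    verdict has been reached.\<close>
  define Inv where "Inv t acc \<longleftrightarrow> (\<exists>st S'. acc = data st S' \<and>
    (st = NIL \<and> (\<forall>v. S' v \<subseteq> S v) \<and> (colorable S' \<longleftrightarrow> colorable S) \<and> multi S' + t \<le> n \<or>
     st \<noteq> NIL \<and> answer_ok S (hd_s st)))" for t acc
  let ?\<rho> = "[data NIL S]"
  let ?l = "NIL # map enc_nat (rev [0..<n])"
  have l: "evals p ?\<rho> (Cns Nl (rngE RN 0)) (enc_list ?l) (1 + 7 + 1) D"
    using evals_Cns[OF evals_Nl evals_rngE[of 0 ?\<rho> NIL S p RN D]] by (simp add: rng_def)
  have i: "evals p ?\<rho> (Var 0) (data NIL S) 1 D" by (rule evals_Var) auto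
  have "\<exists>r. evals p ?\<rho> (Fold (Cns Nl (rngE RN 0)) (Var 0) (Let (Tl (Var 0)) stepE)) r
    (1 + 7 + 1 + 1 + length ?l * ((2 + (step_time N + T) + 1) + 7) + 6) D \<and> Inv (length ?l) r"
  proof (rule evals_Fold_inv[OF l i])
    show "Inv 0 (data NIL S)" unfolding Inv_def using multi_le[of S] by (intro exI[of _ NIL] exI[of _ S]) auto
    fix t acc assume t: "t < length ?l" and "Inv t acc"
    then obtain st S' where acc: "acc = data st S'" and
      inv: "st = NIL \<and> (\<forall>v. S' v \<subseteq> S v) \<and> (colorable S' \<longleftrightarrow> colorable S) \<and> multi S' + t \<le> n \<or>
       st \<noteq> NIL \<and> answer_ok S (hd_s st)" unfolding Inv_def by blast
    let ?s = "Pair (enc_list (drop t ?l)) acc"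
    have tl: "evals p (?s # ?\<rho>) (Tl (Var 0)) acc 2 D"
      using evals_Tl[OF evals_Var[of 0 "?s # ?\<rho>" ?s p D] refl] by (simp add: numeral_2_eq_2)
    show "\<exists>acc'. evals p (?s # ?\<rho>) (Let (Tl (Var 0)) stepE) acc' (2 + (step_time N + T) + 1) D \<and> Inv (Suc t) acc'"
    proof (cases "st = NIL")
      case True
      with inv have S': "\<forall>v. S' v \<subseteq> S v" "colorable S' \<longleftrightarrow> colorable S" "multi S' + t \<le> n" by auto
      have "rate * potential S' < real D + 1"
      proof -
        have "rate * potential S' \<le> rate * potential S"
          using potential_mono[of S' S] S'(1) rate_pos by (intro mult_left_mono) auto
        with pot show ?thesis by linarith
      qed
      from evals_step[OF N km this IH, of "?s # ?\<rho>"] obtain st' S'' where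
        e: "evals p (data NIL S' # ?s # ?\<rho>) stepE (data st' S'') (step_time N + T) D" and
        o: "st' = NIL \<and> (\<forall>v. S'' v \<subseteq> S' v) \<and> (colorable S'' \<longleftrightarrow> colorable S') \<and> multi S'' < multi S' \<or>
          st' \<noteq> NIL \<and> answer_ok S' (hd_s st')" by blast
      have "evals p (?s # ?\<rho>) (Let (Tl (Var 0)) stepE) (data st' S'') (2 + (step_time N + T) + 1) D"
        by (rule evals_Let[OF tl]) (use e acc True in auto)
      moreover have "Inv (Suc t) (data st' S'')"
        unfolding Inv_def
        by (intro exI[of _ st'] exI[of _ S'']) (use o S' in \<open>auto simp: answer_ok_def\<close>)
      ultimately show ?thesis by blast
    next
      case False
      have d: "evals p (acc # ?s # ?\<rho>) (Hd (Var 0)) st 2 D"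
        using evals_Hd[OF evals_Var[of 0 "acc # ?s # ?\<rho>" acc p D] refl] acc by (simp add: numeral_2_eq_2 data_def)
      have "evals p (acc # ?s # ?\<rho>) stepE acc (2 + 1 + 0 + 1) D"
        unfolding stepE_def by (rule evals_Cond[OF d]) (use False in \<open>auto intro!: evals_Var[simplified]\<close>)
      from evals_Let[OF tl this] have "evals p (?s # ?\<rho>) (Let (Tl (Var 0)) stepE) acc (2 + (step_time N + T) + 1) D"
        by (rule evals_mono) (auto simp: step_time_def)
      moreover have "Inv (Suc t) acc" unfolding Inv_def using acc inv False by blast
      ultimately show ?thesis by blast
    qed
  qed
  then obtain r where r: "evals p ?\<rho> (Fold (Cns Nl (rngE RN 0)) (Var 0) (Let (Tl (Var 0)) stepE)) r
    (1 + 7 + 1 + 1 + length ?l * ((2 + (step_time N + T) + 1) + 7) + 6) D" "Inv (length ?l) r" by blast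
  then obtain st S' where st: "r = data st S'" "answer_ok S (hd_s st)" unfolding Inv_def by auto
  have len: "length ?l = Suc n" by simp
  have "evals p ?\<rho> decideE (hd_s st) (1 + 7 + 1 + 1 + length ?l * ((2 + (step_time N + T) + 1) + 7) + 6 + 1 + 1) D"
    unfolding decideE_def by (rule evals_Hd[OF evals_Hd[OF r(1)]]) (auto simp: st data_def)
  then have "evals p ?\<rho> decideE (hd_s st) ((N + 1) * (step_time N + T + 10) + 20) D"
  proof (rule evals_mono)
    have "length ?l * (2 + (step_time N + T) + 1 + 7) \<le> (N + 1) * (step_time N + T + 10)"
      using N by (intro mult_mono) auto
    then show "1 + 7 + 1 + 1 + length ?l * (2 + (step_time N + T) + 1 + 7) + 6 + 1 + 1 \<le> (N + 1) * (step_time N + T + 10) + 20"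
      unfolding len by linarith
  qed simp
  then show ?thesis using st by blast
qed

text \<open>Induction on the depth, each level costing one more factor \<open>node_time N\<close>.
  The encoded \<open>s\<close> is positive, hence not \<open>NIL\<close>, and sends the program to
  \<open>decideE\<close>; the other branch \<open>e\<close> is never entered from such an
  argument.\<close>

lemma evals_decide:
  assumes N: "n \<le> N" "k \<le> N" "m \<le> N" "s \<le> N" "1 \<le> N" and km: "k * m < 2 ^ Suc s"
    and p: "p = Cond (Cond (Hd (Var 0)) Nl (Hd (Tl (Var 0)))) decideE e"
  shows "rate * potential S < real D + 1 \<Longrightarrow>
    \<exists>r. evals p [data NIL S] p r (node_time N ^ Suc D) D \<and> answer_ok S r"
proof (induction D arbitrary: S)
  have top: "\<exists>r. evals p [data NIL S] p r ((N + 1) * (step_time N + T + 10) + 30) D \<and> answer_ok S r"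
    if "\<exists>r. evals p [data NIL S] decideE r ((N + 1) * (step_time N + T + 10) + 20) D \<and> answer_ok S r" for S T D
  proof -
    let ?\<rho> = "[data NIL S]"
    from that obtain r where r: "evals p [data NIL S] decideE r ((N + 1) * (step_time N + T + 10) + 20) D" "answer_ok S r"
      by blast
    have a: "evals p ?\<rho> (Hd (Var 0)) NIL 2 D"
      using evals_Hd[OF evals_Var[of 0 ?\<rho> "?\<rho> ! 0"] refl] by (simp add: data_def eval_nat_numeral)
    have b: "evals p ?\<rho> (Hd (Tl (Var 0))) (enc_nat s) 3 D"
      using evals_Hd[OF evals_Tl[OF evals_Var[of 0 ?\<rho> "?\<rho> ! 0"] refl] refl] by (simp add: data_def eval_nat_numeral)
    have "evals p ?\<rho> (Cond (Hd (Var 0)) Nl (Hd (Tl (Var 0)))) (enc_nat s) (2 + 0 + 3 + 1) D"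
      by (rule evals_Cond[OF a]) (use b in auto)
    then have "evals p ?\<rho> (Cond (Cond (Hd (Var 0)) Nl (Hd (Tl (Var 0)))) decideE e) r
      ((2 + 0 + 3 + 1) + ((N + 1) * (step_time N + T + 10) + 20) + 0 + 1) D"
      by (rule evals_Cond) (use r s_pos in auto)
    then have "evals p ?\<rho> p r ((N + 1) * (step_time N + T + 10) + 30) D"
      unfolding p[symmetric] by (rule evals_mono) linarith+
    then show ?thesis using r(2) by blast
  qed
  have bound: "(N + 1) * (step_time N + T + 10) + 30 \<le> node_time N * T" if "T > 0" for T
  proof -
    have "(N + 1) * (step_time N + T + 10) + 30 \<le> (N + 1) * (step_time N * T + T + 10 * T) + 30 * T"
      using that by (intro add_mono mult_mono) auto
    also have "\<dots> \<le> (N + 1) * (step_time N * T + T + 10 * T) + (N + 1) * (39 * T)" by simp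
    also have "\<dots> = node_time N * T" unfolding node_time_def by (simp add: algebra_simps)
    finally show ?thesis .
  qed
  have bpos: "node_time N > 0" unfolding node_time_def by simp
  {
    case 0
    \<comment> \<open>At depth 0 the hypothesis on recursive calls is vacuous, so any positive value
      can stand for their time; 1 is taken.\<close>
    have "\<exists>r. evals p [data NIL S] decideE r ((N + 1) * (step_time N + 1 + 10) + 20) 0 \<and> answer_ok S r"
      by (rule evals_decideE[OF N km]) (use 0 in auto)
    from top[OF this] obtain r where r: "evals p [data NIL S] p r ((N + 1) * (step_time N + 1 + 10) + 30) 0"
      "answer_ok S r" by blast
    have "evals p [data NIL S] p r (node_time N ^ Suc 0) 0"
      by (rule evals_mono[OF r(1)]) (use bound[of 1] in auto)
    with r(2) show ?case by blast
  next
    case (Suc D)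
    have "\<exists>r. evals p [data NIL S] decideE r ((N + 1) * (step_time N + node_time N ^ Suc D + 10) + 20) (Suc D) \<and> answer_ok S r"
      by (rule evals_decideE[OF N km]) (use Suc in auto)
    from top[OF this] obtain r where
      r: "evals p [data NIL S] p r ((N + 1) * (step_time N + node_time N ^ Suc D + 10) + 30) (Suc D)"
      "answer_ok S r" by blast
    have "evals p [data NIL S] p r (node_time N ^ Suc (Suc D)) (Suc D)"
      by (rule evals_mono[OF r(1)]) (use bound[of "node_time N ^ Suc D"] bpos in auto)
    with r(2) show ?case by blast
  }
qed

end

section \<open>Preparing the data and searching for a coloring\<close>

lemma evals_Fold_rng_inv:
  assumes "evals p \<rho> xs (rng r) T1 D" "evals p \<rho> ini a T2 D" "Inv r a"
    and step: "\<And>x acc rest. x < r \<Longrightarrow> Inv (Suc x) acc \<Longrightarrow>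
      \<exists>acc'. evals p (Pair (Pair (enc_nat x) rest) acc # \<rho>) body acc' T D \<and> Inv x acc'"
  shows "\<exists>w. evals p \<rho> (Fold xs ini body) w (T1 + T2 + r * (T + 7) + 6) D \<and> Inv 0 w"
proof -
  let ?l = "map enc_nat (rev [0..<r])"
  have "\<exists>w. evals p \<rho> (Fold xs ini body) w (T1 + T2 + length ?l * (T + 7) + 6) D \<and> Inv (r - length ?l) w"
  proof (rule evals_Fold_inv[OF assms(1)[unfolded rng_def] assms(2)])
    show "Inv (r - 0) a" using assms(3) by simp
    fix t acc assume t: "t < length ?l" and inv: "Inv (r - t) acc"
    have "drop t ?l = ?l ! t # drop (Suc t) ?l" using t by (rule Cons_nth_drop_Suc[symmetric])
    moreover have "?l ! t = enc_nat (r - Suc t)" using t by (simp add: rev_nth)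
    ultimately have "enc_list (drop t ?l) = Pair (enc_nat (r - Suc t)) (enc_list (drop (Suc t) ?l))" by simp
    with step[of "r - Suc t" acc "enc_list (drop (Suc t) ?l)"] t inv
    show "\<exists>acc'. evals p (Pair (enc_list (drop t ?l)) acc # \<rho>) body acc' T D \<and> Inv (r - Suc t) acc'"
      by (simp add: Suc_diff_Suc)
  qed
  then show ?thesis by simp
qed

text \<open>The accumulator starts as the list containing only 0, encoded by \<open>Tr\<close>.
  Every element of \<open>xs\<close> prepends the successor of the head, and the final
  \<open>Tl\<close> removes the length itself, which lies outside the range.\<close>

definition rangeE :: "expr \<Rightarrow> expr" where
  "rangeE xs = Tl (Fold xs Tr (Cns (Cns Nl (Hd (Tl (Var 0)))) (Tl (Var 0))))"

lemma evals_rangeE: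
  assumes "evals p \<rho> xs (enc_list l) T D" "length l \<le> N"
  shows "evals p \<rho> (rangeE xs) (rng (length l)) (T + N * 15 + 10) D"
proof -
  let ?g = "\<lambda>x acc. Pair (Pair NIL (hd_s acc)) acc"
  have f: "fold ?g l (enc_list (map enc_nat (rev [0..<Suc a]))) = enc_list (map enc_nat (rev [0..<Suc (a + length l)]))" for a
  proof (induction l arbitrary: a)
    case (Cons x l)
    from Cons[of "Suc a"] show ?case by simp
  qed simp
  have "evals p \<rho> (Fold xs Tr (Cns (Cns Nl (Hd (Tl (Var 0)))) (Tl (Var 0)))) (fold ?g l (Pair NIL NIL))
    (T + 3 + length l * (8 + 7) + 6) D"
  proof (rule evals_Fold[OF assms(1) evals_Tr])
    fix x acc rest
    let ?\<rho> = "Pair (Pair x rest) acc # \<rho>"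
    have 1: "evals p ?\<rho> (Tl (Var 0)) acc 2 D"
      using evals_Tl[OF evals_Var[of 0 ?\<rho> "?\<rho> ! 0"] refl] by (simp add: numeral_2_eq_2)
    show "evals p ?\<rho> (Cns (Cns Nl (Hd (Tl (Var 0)))) (Tl (Var 0))) (?g x acc) 8 D"
      using evals_Cns[OF evals_Cns[OF evals_Nl evals_Hd[OF 1 refl]] 1] by (simp add: eval_nat_numeral)
  qed
  moreover have "Pair NIL NIL = enc_list (map enc_nat (rev [0..<Suc 0]))" by simp
  ultimately have "evals p \<rho> (Fold xs Tr (Cns (Cns Nl (Hd (Tl (Var 0)))) (Tl (Var 0))))
     (enc_list (map enc_nat (rev [0..<Suc (0 + length l)]))) (T + 3 + length l * (8 + 7) + 6) D"
    by (simp only: f)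
  from evals_Tl[OF this] show ?thesis unfolding rangeE_def
    by (rule evals_mono) (use assms(2) in \<open>auto simp: rng_def\<close>)
qed

text \<open>One step of an integer logarithm in unary: in a phase that starts with \<open>a = b = 2 ^ s\<close>, \<open>a\<close> grows
  while \<open>b\<close> counts down, so \<open>a\<close> has doubled when \<open>b\<close> is used up.\<close>

fun log_step :: "nat \<times> nat \<times> nat \<Rightarrow> nat \<times> nat \<times> nat" where
  "log_step (s, a, b) = (if b = 0 then (Suc s, a, a) else (s, Suc a, b - 1))"

definition lg :: "nat \<Rightarrow> nat" where
  "lg t = fst ((log_step ^^ t) (0, 1, 1))"

text \<open>Invariant: \<open>a + b\<close> is the power of two at which the phase ends, and
  \<open>a + s\<close> grows by one in every step because exactly one of \<open>a\<close> and
  \<open>s\<close> does. The upper bound on \<open>t\<close> then follows from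
  \<open>a \<le> 2 ^ (s + 1)\<close> and \<open>s < 2 ^ s\<close>.\<close>

lemma lg_bounds: "2 ^ lg t \<le> t + 1 \<and> t \<le> 2 ^ (lg t + 2)"
proof -
  have "let (s, a, b) = (log_step ^^ t) (0, 1, 1) in a + b = 2 ^ Suc s \<and> 2 ^ s \<le> a \<and> a + s = Suc t" for t
    by (induction t) (auto simp: Let_def split: prod.splits if_splits)
  from this[of t] obtain a b where *: "a + b = 2 ^ Suc (lg t)" "2 ^ lg t \<le> a" "a + lg t = Suc t"
    unfolding lg_def by (auto simp: Let_def split: prod.splits)
  have "lg t < 2 ^ lg t" by simp
  moreover have "2 ^ (lg t + 2) = (2::nat) ^ Suc (lg t) + 2 * 2 ^ lg t" by simp
  ultimately have "t \<le> 2 ^ (lg t + 2)" "2 ^ lg t \<le> t + 1" using * by linarith+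
  then show ?thesis by blast
qed

definition logE :: "expr \<Rightarrow> expr" where
  "logE xs = Hd (Fold xs (Cns Nl (Cns Tr Tr))
     (Cond (Tl (Tl (Tl (Var 0))))
       (Cns (Hd (Tl (Var 0))) (Cns (Cns Nl (Hd (Tl (Tl (Var 0))))) (Tl (Tl (Tl (Tl (Var 0)))))))
       (Cns (Cns Nl (Hd (Tl (Var 0)))) (Cns (Hd (Tl (Tl (Var 0)))) (Hd (Tl (Tl (Var 0))))))))"

lemma evals_logE:
  assumes "evals p \<rho> xs (enc_list l) T D" "length l \<le> N"
  shows "evals p \<rho> (logE xs) (enc_nat (lg (length l))) (T + N * 60 + 20) D"
proof -
  define enc where "enc = (\<lambda>(s, a, b). Pair (enc_nat s) (Pair (enc_nat a) (enc_nat b)))"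
  let ?body = "Cond (Tl (Tl (Tl (Var 0))))
       (Cns (Hd (Tl (Var 0))) (Cns (Cns Nl (Hd (Tl (Tl (Var 0))))) (Tl (Tl (Tl (Tl (Var 0)))))))
       (Cns (Cns Nl (Hd (Tl (Var 0)))) (Cns (Hd (Tl (Tl (Var 0)))) (Hd (Tl (Tl (Var 0))))))"
  have ini: "evals p \<rho> (Cns Nl (Cns Tr Tr)) (enc (0, 1, 1)) 9 D"
    using evals_Cns[OF evals_Nl evals_Cns[OF evals_Tr evals_Tr]] by (simp add: enc_def)
  have "\<exists>r. evals p \<rho> (Fold xs (Cns Nl (Cns Tr Tr)) ?body) r (T + 9 + length l * (40 + 7) + 6) D
    \<and> r = enc ((log_step ^^ length l) (0, 1, 1))"
  proof (rule evals_Fold_inv[OF assms(1) ini])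
    fix t acc assume t: "t < length l" and acc: "acc = enc ((log_step ^^ t) (0, 1, 1))"
    obtain s a b where st: "(log_step ^^ t) (0, 1, 1) = (s, a, b)" by (metis prod_cases3)
    have accv: "acc = Pair (enc_nat s) (Pair (enc_nat a) (enc_nat b))"
      unfolding acc st by (simp add: enc_def)
    let ?\<rho> = "Pair (enc_list (drop t l)) acc # \<rho>"
    have 1: "evals p ?\<rho> (Tl (Var 0)) acc 2 D"
      using evals_Tl[OF evals_Var[of 0 ?\<rho> "?\<rho> ! 0"] refl] by (simp add: numeral_2_eq_2)
    have s: "evals p ?\<rho> (Hd (Tl (Var 0))) (enc_nat s) 3 D"
      using evals_Hd[OF 1 refl] by (simp add: accv)
    have a: "evals p ?\<rho> (Hd (Tl (Tl (Var 0)))) (enc_nat a) 4 D"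
      using evals_Hd[OF evals_Tl[OF 1 refl] refl] by (simp add: accv)
    have b: "evals p ?\<rho> (Tl (Tl (Tl (Var 0)))) (enc_nat b) 4 D"
      using evals_Tl[OF evals_Tl[OF 1 refl] refl] by (simp add: accv)
    have "evals p ?\<rho> ?body (enc (log_step (s, a, b))) 40 D"
    proof (cases b)
      case 0
      then show ?thesis
        by (intro evals_mono[OF evals_CondF[OF _ evals_Cns[OF evals_Cns[OF evals_Nl s] evals_Cns[OF a a]], THEN evals_eq]])
          (use b 0 in \<open>auto simp: enc_def\<close>)
    next
      case (Suc b')
      then show ?thesis
        by (intro evals_mono[OF evals_CondT[OF b _ evals_Cns[OF s evals_Cns[OF evals_Cns[OF evals_Nl a] evals_Tl[OF b refl]]], THEN evals_eq]])
          (auto simp: enc_def)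
    qed
    then show "\<exists>acc'. evals p ?\<rho> ?body acc' 40 D \<and> acc' = enc ((log_step ^^ Suc t) (0, 1, 1))"
      by (simp only: funpow.simps o_apply st) blast
  qed simp
  then have "evals p \<rho> (Fold xs (Cns Nl (Cns Tr Tr)) ?body) (enc ((log_step ^^ length l) (0, 1, 1)))
    (T + 9 + length l * (40 + 7) + 6) D" by blast
  moreover have "hd_s (enc ((log_step ^^ length l) (0, 1, 1))) = enc_nat (lg (length l))"
    unfolding lg_def enc_def by (simp split: prod.splits)
  ultimately have "evals p \<rho> (logE xs) (enc_nat (lg (length l))) (T + 9 + length l * (40 + 7) + 6 + 1) D"
    unfolding logE_def using evals_Hd by metis
  then show ?thesis by (rule evals_mono) (use assms(2) in auto)
qed

text \<open>The number of colors is fixed, so its range is written into the program as a literal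
  whose cost does not depend on the input.\<close>

primrec litE :: "sexp \<Rightarrow> expr" where
  "litE NIL = Nl"
| "litE (Pair a b) = Cns (litE a) (litE b)"

primrec lit_time :: "sexp \<Rightarrow> nat" where
  "lit_time NIL = 1"
| "lit_time (Pair a b) = lit_time a + lit_time b + 1"

lemma evals_litE: "evals p \<rho> (litE v) v (lit_time v) D"
proof (induction v)
  case (Pair a b)
  then show ?case using evals_Cns by simp
qed (simp add: evals_Nl1)

lemma evals_Cns_pow:
  "evals p \<rho> e (enc_nat a) T D \<Longrightarrow> evals p \<rho> ((Cns Nl ^^ b) e) (enc_nat (a + b)) (T + 2 * b) D"
proof (induction b)
  case (Suc b)
  from evals_Cns[OF evals_Nl Suc.IH[OF Suc.prems]] show ?case by simp
qed simp

definition dataE :: "nat \<Rightarrow> expr" where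
  "dataE k = Cns Nl (Cns ((Cns Nl ^^ Suc k) (logE (Tl (Var 0)))) (Cns (Hd (Var 0)) (Cns (Tl (Var 0))
     (Cns (rangeE (Hd (Var 0))) (Cns (litE (rng k)) (rangeE (Tl (Var 0))))))))"

text \<open>After the first \<open>Let\<close>, position 0 holds the data, 1 the loop over colors
  and 2 the loop over vertices, hence the positions of the names 1 and 0. After the second,
  \<open>Var 0\<close> is the restricted instance and \<open>Var 1\<close> the old one to fall back
  on.\<close>

definition tryE :: expr where
  "tryE = Let (Tl (Var 0)) (Let (UpdE (fixF (NV 0) (NV 1)) 0 (\<lambda>x. if x = 0 then 2 else 1))
     (Cond (Rec (Var 0)) (Var 0) (Var 1)))"

text \<open>The outer \<open>Nl\<close> marks success. The \<open>Cns Nl\<close> in front of each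
  color turns the internal colors from 0 back into colors from 1.\<close>

definition outE :: expr where
  "outE = Cns Nl (Fold (rngE RN 0) Nl
     (Cns (Cns Nl (cmp (Find 1 RK (Al (NV 0) (NV 1))) 1 (\<lambda>_. 0))) (Tl (Var 0))))"

text \<open>Self-reduction: the nested loop never changes colorability, so the instance with its
  lists narrowed can be tested once at the end instead of testing the original at the start.\<close>

definition searchE :: "nat \<Rightarrow> expr" where
  "searchE k = Let (dataE k) (Let (Fold (rngE RN 0) (Var 0) (Fold (rngE RK 1) (Tl (Var 0)) tryE))
     (Cond (Rec (Var 0)) outE Nl))"

text \<open>Recursive calls are on \<open>data NIL S\<close>, where \<open>Hd\<close> is \<open>NIL\<close> and \<open>Hd (Tl _)\<close> encodes
  \<open>s > 0\<close>. In an encoded instance, \<open>Hd\<close> is \<open>NIL\<close> only without vertices, and then the rows of the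
  incidence matrix are empty and \<open>Hd (Tl _)\<close> is \<open>NIL\<close> as well.\<close>

definition program :: "nat \<Rightarrow> expr" where
  "program k = Cond (Cond (Hd (Var 0)) Nl (Hd (Tl (Var 0)))) decideE (searchE k)"

definition search_time :: "nat \<Rightarrow> nat \<Rightarrow> nat" where
  "search_time k N = N * N * (upd_time (fixF (NV 0) (NV 1)) N + 50) + lit_time (rng k) + N * 200 + 200
     + N * (tb (Find 1 RK (Al (NV 0) (NV 1))) N + 20) + 2 * k"

context instance_data begin

lemma evals_dataE:
  assumes N: "n \<le> N" "m \<le> N" and s: "s = lg m + Suc k"
  shows "evals p [Pair (mat n k (\<lambda>v i. i \<in> S v)) (mat m n (\<lambda>h v. v \<in> I h))] (dataE k) (data NIL S)
    (lit_time (rng k) + N * 90 + 2 * k + 70) D"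
proof -
  let ?\<rho> = "[Pair (mat n k (\<lambda>v i. i \<in> S v)) (mat m n (\<lambda>h v. v \<in> I h))]"
  have A: "evals p ?\<rho> (Hd (Var 0)) (mat n k (\<lambda>v i. i \<in> S v)) 2 D"
    using evals_Hd[OF evals_Var[of 0 ?\<rho> "?\<rho> ! 0"] refl] by (simp add: numeral_2_eq_2)
  have B: "evals p ?\<rho> (Tl (Var 0)) (mat m n (\<lambda>h v. v \<in> I h)) 2 D"
    using evals_Tl[OF evals_Var[of 0 ?\<rho> "?\<rho> ! 0"] refl] by (simp add: numeral_2_eq_2)
  have RN: "evals p ?\<rho> (rangeE (Hd (Var 0))) (rng n) (2 + N * 15 + 10) D"
    using evals_rangeE[OF evals_eq[OF A mat_def], of N] N by simp
  have RM: "evals p ?\<rho> (rangeE (Tl (Var 0))) (rng m) (2 + N * 15 + 10) D"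
    using evals_rangeE[OF evals_eq[OF B mat_def], of N] N by simp
  have "evals p ?\<rho> (logE (Tl (Var 0))) (enc_nat (lg m)) (2 + N * 60 + 20) D"
    using evals_logE[OF evals_eq[OF B mat_def], of N] N by simp
  from evals_Cns_pow[OF this, of "Suc k"]
  have S: "evals p ?\<rho> ((Cns Nl ^^ Suc k) (logE (Tl (Var 0)))) (enc_nat s) (2 + N * 60 + 20 + 2 * Suc k) D"
    unfolding s .
  show ?thesis unfolding dataE_def data_def
    by (rule evals_mono[OF evals_Cns[OF evals_Nl evals_Cns[OF S evals_Cns[OF A evals_Cns[OF B
      evals_Cns[OF RN evals_Cns[OF evals_litE RM]]]]]]]) auto
qed

definition decoded :: "(nat \<Rightarrow> nat set) \<Rightarrow> nat \<Rightarrow> nat" where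
  "decoded S v = nv S (Find 1 RK (Al (NV 0) (NV 1))) ((\<lambda>_. 0)(0 := v))"

lemma evals_outE:
  assumes N: "n \<le> N" "k \<le> N" "m \<le> N" "s \<le> N" "1 \<le> N"
  shows "evals p (data st S # \<rho>) outE (Pair NIL (enc_list (map (\<lambda>v. enc_nat (Suc (decoded S v))) [0..<n])))
    (N * (tb (Find 1 RK (Al (NV 0) (NV 1))) N + 20) + 20) D"
proof -
  let ?e = "Find 1 RK (Al (NV 0) (NV 1))"
  let ?\<rho> = "data st S # \<rho>"
  have "evals p ?\<rho> (Fold (rngE RN 0) Nl (Cns (Cns Nl (cmp ?e 1 (\<lambda>_. 0))) (Tl (Var 0))))
    (foldr (\<lambda>v. Pair (enc_nat (Suc (decoded S v)))) [0..<n] NIL) (7 + 1 + n * ((tb ?e N + 5) + 7) + 6) D"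
  proof (rule evals_Fold_rng[OF _ evals_Nl])
    show "evals p ?\<rho> (rngE RN 0) (rng n) 7 D" using evals_rngE[of 0 ?\<rho> st S p RN D] by simp
    fix v acc rest assume v: "v < n"
    let ?\<rho>' = "Pair (Pair (enc_nat v) rest) acc # ?\<rho>"
    have 1: "evals p ?\<rho>' (cmp ?e 1 (\<lambda>_. 0)) (enc_nat (decoded S v)) (tb ?e N) D"
      unfolding decoded_def by (rule evals_cmp_aux[OF N, THEN conjunct1]) (use v N in auto)
    have 2: "evals p ?\<rho>' (Tl (Var 0)) acc 2 D"
      using evals_Tl[OF evals_Var[of 0 ?\<rho>' "?\<rho>' ! 0" p D] refl] by (simp add: numeral_2_eq_2)
    show "evals p ?\<rho>' (Cns (Cns Nl (cmp ?e 1 (\<lambda>_. 0))) (Tl (Var 0))) (Pair (enc_nat (Suc (decoded S v))) acc)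
      (tb ?e N + 5) D"
      using evals_Cns[OF evals_Cns[OF evals_Nl 1] 2] by (simp add: eval_nat_numeral)
  qed
  then have "evals p ?\<rho> (Fold (rngE RN 0) Nl (Cns (Cns Nl (cmp ?e 1 (\<lambda>_. 0))) (Tl (Var 0))))
    (enc_list (map (\<lambda>v. enc_nat (Suc (decoded S v))) [0..<n])) (7 + 1 + n * ((tb ?e N + 5) + 7) + 6) D"
    by (simp only: foldr_Pair)
  moreover have "n * ((tb ?e N + 5) + 7) \<le> N * (tb ?e N + 20)" using N by (intro mult_mono) auto
  ultimately show ?thesis unfolding outE_def
    by (intro evals_mono[OF evals_Cns[OF evals_Nl]]) auto
qed

end

context intersecting_hypergraph begin

lemma proper_decoded:
  assumes "colorable S" "\<And>v. v < n \<Longrightarrow> \<exists>i. S v \<subseteq> {i}"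
  shows "proper S (decoded S)"
proof -
  obtain \<chi> where \<chi>: "proper S \<chi>" using assms(1) unfolding colorable_def by blast
  have eq: "decoded S v = \<chi> v" if v: "v < n" for v
  proof -
    let ?\<sigma> = "(\<lambda>_. 0)(0 := v) :: nat \<Rightarrow> nat"
    have c: "\<chi> v < k" "\<chi> v \<in> S v" using \<chi> v unfolding proper_def by auto
    then have "\<exists>a<bd RK. nv S (Al (NV 0) (NV 1)) (?\<sigma>(1 := a)) \<noteq> 0" using v by (intro exI[of _ "\<chi> v"]) auto
    from nv_Find[OF this] have "decoded S v \<in> S v" unfolding decoded_def by (auto simp del: nv.simps(9))
    with assms(2)[OF v] c show ?thesis by blast
  qed
  have "\<exists>v\<in>I h. decoded S v \<noteq> i" if "h < m" "i < k" for h i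
    using \<chi> that I_sub[of h] eq unfolding proper_def by (metis lessThan_iff subsetD)
  then show ?thesis using \<chi> eq unfolding proper_def by auto
qed

lemma evals_tryE:
  assumes N: "n \<le> N" "k \<le> N" "m \<le> N" "s \<le> N" "1 \<le> N"
    and dec: "\<And>S. \<exists>r. evals p [data NIL S] p r T D \<and> answer_ok S r"
    and vi: "v < n" "i < k"
  shows "evals p (Pair (Pair (enc_nat i) rest) (data NIL S) # Pair (Pair (enc_nat v) rest') acc' # \<rho>) tryE
    (data NIL (if colorable (fix_color S v i) then fix_color S v i else S))
    (upd_time (fixF (NV 0) (NV 1)) N + T + 20) (Suc D)"
proof -
  let ?s = "Pair (Pair (enc_nat i) rest) (data NIL S)"
  let ?\<rho> = "?s # Pair (Pair (enc_nat v) rest') acc' # \<rho>"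
  let ?\<rho>1 = "data NIL S # ?\<rho>"
  let ?q = "\<lambda>x::nat. if x = 0 then 2 else (1::nat)"
  let ?\<sigma> = "(\<lambda>x. if x = 0 then v else i)"
  have 1: "evals p ?\<rho> (Tl (Var 0)) (data NIL S) 2 (Suc D)"
    using evals_Tl[OF evals_Var[of 0 ?\<rho> "?\<rho> ! 0" p] refl] by (simp add: numeral_2_eq_2)
  have 2: "evals p ?\<rho>1 (UpdE (fixF (NV 0) (NV 1)) 0 ?q) (data NIL (fix_color S v i)) (upd_time (fixF (NV 0) (NV 1)) N) (Suc D)"
  proof (rule evals_Upd[OF N, where \<sigma> = ?\<sigma> and st = NIL and S = S])
    show "nv S (fixF (NV 0) (NV 1)) (?\<sigma>(20 := a, 21 := b)) = of_bool (b \<in> fix_color S v i a)"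
      if "a < n" "b < k" for a b using nv_fixF[of "NV 0" "NV 1" a b S ?\<sigma>] that by simp
  qed (use vi N in auto)
  let ?\<rho>2 = "data NIL (fix_color S v i) # ?\<rho>1"
  from dec obtain r where r: "evals p [data NIL (fix_color S v i)] p r T D" "answer_ok (fix_color S v i) r" by blast
  have 3: "evals p ?\<rho>2 (Rec (Var 0)) r (1 + T + 1) (Suc D)"
    by (rule evals_Rec[OF evals_Var r(1)]) auto
  have 4: "evals p ?\<rho>2 (Cond (Rec (Var 0)) (Var 0) (Var 1))
    (data NIL (if colorable (fix_color S v i) then fix_color S v i else S)) ((1 + T + 1) + 1 + 1 + 1) (Suc D)"
    by (rule evals_Cond[OF 3]) (use r(2) in \<open>auto intro!: evals_Var[simplified] simp: answer_ok_def\<close>)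
  show ?thesis unfolding tryE_def
    by (rule evals_mono[OF evals_Let[OF 1 evals_Let[OF 2 4]]]) auto
qed

lemma evals_searchE:
  fixes S :: "nat \<Rightarrow> nat set"
  assumes N: "n \<le> N" "k \<le> N" "m \<le> N" "s \<le> N" "1 \<le> N" and s: "s = lg m + Suc k"
    and dec: "\<And>S. \<exists>r. evals p [data NIL S] p r T D \<and> answer_ok S r"
  shows "\<exists>out. evals p [Pair (mat n k (\<lambda>v i. i \<in> S v)) (mat m n (\<lambda>h v. v \<in> I h))] (searchE k) out
      ((N * N + 1) * T + search_time k N) (Suc D) \<and>
    (colorable S \<longrightarrow> (\<exists>\<chi>. proper S \<chi> \<and> out = Pair NIL (enc_list (map (\<lambda>v. enc_nat (Suc (\<chi> v))) [0..<n])))) \<and>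
    (\<not> colorable S \<longrightarrow> out = NIL)"
proof -
  let ?\<rho> = "[Pair (mat n k (\<lambda>v i. i \<in> S v)) (mat m n (\<lambda>h v. v \<in> I h))]"
  let ?\<rho>1 = "data NIL S # ?\<rho>"
  define U where "U = upd_time (fixF (NV 0) (NV 1)) N"
  \<comment> \<open>Vertices are treated from the last to the first, so those from \<open>x\<close>
    on are done. They are decided only if the instance is colorable, since otherwise every attempt
    to fix a color is rejected.\<close>
  define Inv where "Inv x acc \<longleftrightarrow> (\<exists>S'. acc = data NIL S' \<and> (\<forall>v. S' v \<subseteq> S v) \<and>
    (colorable S' \<longleftrightarrow> colorable S) \<and> (colorable S \<longrightarrow> (\<forall>v. x \<le> v \<and> v < n \<longrightarrow> (\<exists>i. S' v \<subseteq> {i}))))" for x acc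
  have "\<exists>w. evals p ?\<rho>1 (Fold (rngE RN 0) (Var 0) (Fold (rngE RK 1) (Tl (Var 0)) tryE)) w
    (7 + 1 + n * ((7 + 2 + k * ((U + T + 20) + 7) + 6) + 7) + 6) (Suc D) \<and> Inv 0 w"
  proof (rule evals_Fold_rng_inv)
    show "evals p ?\<rho>1 (rngE RN 0) (rng n) 7 (Suc D)" using evals_rngE[of 0 ?\<rho>1 NIL S p RN] by simp
    show "evals p ?\<rho>1 (Var 0) (data NIL S) 1 (Suc D)" by (rule evals_Var) auto
    show "Inv n (data NIL S)" unfolding Inv_def by auto
    fix v acc rest assume v: "v < n" and "Inv (Suc v) acc"
    then obtain S' where acc: "acc = data NIL S'" and S': "\<forall>v. S' v \<subseteq> S v"
      "colorable S' \<longleftrightarrow> colorable S" "colorable S \<Longrightarrow> (\<forall>u. Suc v \<le> u \<and> u < n \<longrightarrow> (\<exists>i. S' u \<subseteq> {i}))"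
      unfolding Inv_def by blast
    let ?s = "Pair (Pair (enc_nat v) rest) acc"
    \<comment> \<open>Colors from \<open>x\<close> on have been tried at \<open>v\<close>. If none
      was accepted, every proper coloring uses a smaller one. At \<open>x = 0\<close> this
      alternative contradicts colorability, so \<open>v\<close> is decided.\<close>
    define Inv' where "Inv' x acc \<longleftrightarrow> (\<exists>S''. acc = data NIL S'' \<and> (\<forall>v. S'' v \<subseteq> S' v) \<and>
      (colorable S'' \<longleftrightarrow> colorable S') \<and> ((\<exists>i. S'' v \<subseteq> {i}) \<or> (\<forall>\<chi>. proper S'' \<chi> \<longrightarrow> \<chi> v < x)))" for x acc
    have "\<exists>w. evals p (?s # ?\<rho>1) (Fold (rngE RK 1) (Tl (Var 0)) tryE) w
      (7 + 2 + k * ((U + T + 20) + 7) + 6) (Suc D) \<and> Inv' 0 w"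
    proof (rule evals_Fold_rng_inv)
      show "evals p (?s # ?\<rho>1) (rngE RK 1) (rng k) 7 (Suc D)" using evals_rngE[of 1 "?s # ?\<rho>1" NIL S p RK] by simp
      show "evals p (?s # ?\<rho>1) (Tl (Var 0)) acc 2 (Suc D)"
        using evals_Tl[OF evals_Var[of 0 "?s # ?\<rho>1" ?s p] refl] by (simp add: numeral_2_eq_2)
      show "Inv' k acc" unfolding Inv'_def acc using v by (intro exI[of _ S']) (auto simp: proper_def)
      fix i acc' rest' assume i: "i < k" and "Inv' (Suc i) acc'"
      then obtain S'' where acc': "acc' = data NIL S''" and S'': "\<forall>v. S'' v \<subseteq> S' v" "colorable S'' \<longleftrightarrow> colorable S'"
        "(\<exists>i. S'' v \<subseteq> {i}) \<or> (\<forall>\<chi>. proper S'' \<chi> \<longrightarrow> \<chi> v < Suc i)" unfolding Inv'_def by blast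
      let ?F = "fix_color S'' v i"
      let ?R = "if colorable ?F then ?F else S''"
      have "Inv' i (data NIL ?R)"
      proof (cases "colorable ?F")
        case True
        have le: "\<And>u. ?F u \<subseteq> S'' u" by (rule fix_color_le)
        have "colorable S''" using colorable_mono[OF True] le by blast
        moreover have "?F v \<subseteq> {i}" by (simp add: fix_color_def)
        ultimately show ?thesis unfolding Inv'_def using True S'' le
          by (intro exI[of _ ?F]) (simp, meson order_trans)
      next
        case False
        have "\<chi> v < i" if "\<chi> v < Suc i" "proper S'' \<chi>" for \<chi>
        proof (rule ccontr)
          assume "\<not> \<chi> v < i"
          then have "\<chi> v = i" using that by simp
          then have "proper ?F \<chi>" using that unfolding proper_def fix_color_def by auto
          then show False using False unfolding colorable_def by blast
        qed
        then show ?thesis unfolding Inv'_def using False S'' by (intro exI[of _ S'']) auto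
      qed
      moreover have "evals p (Pair (Pair (enc_nat i) rest') acc' # ?s # ?\<rho>1) tryE (data NIL ?R) (U + T + 20) (Suc D)"
        unfolding acc' U_def by (rule evals_tryE[OF N dec v i])
      ultimately show "\<exists>acc''. evals p (Pair (Pair (enc_nat i) rest') acc' # ?s # ?\<rho>1) tryE acc'' (U + T + 20) (Suc D) \<and> Inv' i acc''"
        by blast
    qed
    then obtain w where w: "evals p (?s # ?\<rho>1) (Fold (rngE RK 1) (Tl (Var 0)) tryE) w
      (7 + 2 + k * ((U + T + 20) + 7) + 6) (Suc D)" "Inv' 0 w" by blast
    from w(2) obtain S'' where wS: "w = data NIL S''" and S'': "\<forall>v. S'' v \<subseteq> S' v" "colorable S'' \<longleftrightarrow> colorable S'"
        "(\<exists>i. S'' v \<subseteq> {i}) \<or> (\<forall>\<chi>. proper S'' \<chi> \<longrightarrow> \<chi> v < 0)" unfolding Inv'_def by blast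
    have "\<exists>i. S'' u \<subseteq> {i}" if u: "colorable S" "v \<le> u" "u < n" for u
    proof (cases "u = v")
      case True
      then show ?thesis using S''(2,3) S'(2) u(1) unfolding colorable_def by blast
    next
      case False
      then have "Suc v \<le> u \<and> u < n" using u by simp
      then obtain i where "S' u \<subseteq> {i}" using S'(3)[OF u(1)] by blast
      then show ?thesis using S''(1) by blast
    qed
    moreover have "\<forall>u. S'' u \<subseteq> S u" using S''(1) S'(1) by (meson order_trans)
    moreover have "colorable S'' \<longleftrightarrow> colorable S" using S''(2) S'(2) by simp
    ultimately have "Inv v w" unfolding Inv_def wS by (intro exI[of _ S'']) simp
    with w(1) show "\<exists>acc'. evals p (?s # ?\<rho>1) (Fold (rngE RK 1) (Tl (Var 0)) tryE) acc'
      (7 + 2 + k * ((U + T + 20) + 7) + 6) (Suc D) \<and> Inv v acc'" by blast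
  qed
  then obtain w where w: "evals p ?\<rho>1 (Fold (rngE RN 0) (Var 0) (Fold (rngE RK 1) (Tl (Var 0)) tryE)) w
    (7 + 1 + n * ((7 + 2 + k * ((U + T + 20) + 7) + 6) + 7) + 6) (Suc D)" "Inv 0 w" by blast
  from w(2) obtain S' where wS: "w = data NIL S'" and S': "\<forall>v. S' v \<subseteq> S v"
    "colorable S' \<longleftrightarrow> colorable S" "colorable S \<Longrightarrow> (\<forall>v. v < n \<longrightarrow> (\<exists>i. S' v \<subseteq> {i}))" unfolding Inv_def by auto
  let ?\<rho>2 = "w # ?\<rho>1"
  let ?O = "Pair NIL (enc_list (map (\<lambda>v. enc_nat (Suc (decoded S' v))) [0..<n]))"
  define OT where "OT = N * (tb (Find 1 RK (Al (NV 0) (NV 1))) N + 20) + 20"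
  from dec obtain r where r: "evals p [w] p r T D" "answer_ok S' r" unfolding wS by blast
  have 3: "evals p ?\<rho>2 (Rec (Var 0)) r (1 + T + 1) (Suc D)"
    by (rule evals_Rec[OF evals_Var r(1)]) auto
  have 4: "evals p ?\<rho>2 outE ?O OT (Suc D)"
    unfolding wS OT_def by (rule evals_outE[OF N])
  let ?out = "if colorable S then ?O else NIL"
  have 5: "evals p ?\<rho>2 (Cond (Rec (Var 0)) outE Nl) ?out ((1 + T + 1) + OT + 1 + 1) (Suc D)"
    by (rule evals_Cond[OF 3]) (use r(2) S'(2) 4 evals_Nl in \<open>auto simp: answer_ok_def intro: evals_Nl1\<close>)
  have d: "evals p ?\<rho> (dataE k) (data NIL S) (lit_time (rng k) + N * 90 + 2 * k + 70) (Suc D)"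
    by (rule evals_dataE) (use N s in auto)
  have "evals p ?\<rho> (searchE k) ?out ((N * N + 1) * T + search_time k N) (Suc D)"
    unfolding searchE_def
  proof (rule evals_mono[OF evals_Let[OF d evals_Let[OF w(1) 5]]])
    have "k * ((U + T + 20) + 7) \<le> N * (U + T + 27)" using N by (intro mult_mono) auto
    then have "n * ((7 + 2 + k * ((U + T + 20) + 7) + 6) + 7) \<le> N * (N * (U + T + 27) + 22)"
      using N by (intro mult_mono) auto
    moreover have "N * (N * (U + T + 27) + 22) + N * N * 23 = N * N * T + N * N * (U + 50) + N * 22"
      by (simp add: algebra_simps)
    ultimately show "lit_time (rng k) + N * 90 + 2 * k + 70 +
      (7 + 1 + n * ((7 + 2 + k * ((U + T + 20) + 7) + 6) + 7) + 6 + (1 + T + 1 + OT + 1 + 1) + 1) + 1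
      \<le> (N * N + 1) * T + search_time k N"
      unfolding search_time_def U_def[symmetric] OT_def distrib_right by linarith
  qed simp
  moreover have "\<exists>\<chi>. proper S \<chi> \<and> ?out = Pair NIL (enc_list (map (\<lambda>v. enc_nat (Suc (\<chi> v))) [0..<n]))" if "colorable S"
  proof -
    have "proper S' (decoded S')" using proper_decoded[of S'] S'(2,3) that by blast
    then have "proper S (decoded S')" using proper_mono[of S' "decoded S'" S] S'(1) by simp
    then show ?thesis using that by auto
  qed
  ultimately show ?thesis by (intro exI[of _ ?out]) auto
qed

lemma evals_program:
  fixes S :: "nat \<Rightarrow> nat set"
  assumes N: "n \<le> N" "k \<le> N" "m \<le> N" "s \<le> N" "1 \<le> N" and s: "s = lg m + Suc k"
    and D: "rate * (real k * ln (real (m + c))) < real D + 1"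
  shows "\<exists>out. evals (program k) [Pair (mat n k (\<lambda>v i. i \<in> S v)) (mat m n (\<lambda>h v. v \<in> I h))] (program k) out
      ((N * N + 1) * node_time N ^ Suc D + search_time k N + 20) (Suc D) \<and>
    (colorable S \<longrightarrow> (\<exists>\<chi>. proper S \<chi> \<and> out = Pair NIL (enc_list (map (\<lambda>v. enc_nat (Suc (\<chi> v))) [0..<n])))) \<and>
    (\<not> colorable S \<longrightarrow> out = NIL)"
proof -
  let ?\<rho> = "[Pair (mat n k (\<lambda>v i. i \<in> S v)) (mat m n (\<lambda>h v. v \<in> I h))]"
  \<comment> \<open>\<open>k < 2 ^ k\<close> replaces a logarithm of \<open>k\<close>, and the
    \<open>Suc\<close> in both \<open>s\<close> and \<open>Suc s\<close> pays for the factor 4 lost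
    by \<open>lg\<close>.\<close>
  have "m \<le> 2 ^ (lg m + 2)" using lg_bounds by blast
  then have "k * m \<le> k * 2 ^ (lg m + 2)" by simp
  also have "\<dots> < 2 ^ k * 2 ^ (lg m + 2)" by simp
  also have "\<dots> = 2 ^ Suc s" unfolding s by (simp add: power_add)
  finally have km: "k * m < 2 ^ Suc s" .
  have dec: "\<exists>r. evals (program k) [data NIL S] (program k) r (node_time N ^ Suc D) D \<and> answer_ok S r" for S
  proof (rule evals_decide[OF N km program_def])
    have "rate * potential S \<le> rate * (real k * ln (real (m + c)))"
      using potential_le rate_pos by (intro mult_left_mono) auto
    with D show "rate * potential S < real D + 1" by linarith
  qed
  from evals_searchE[OF N s dec, of S] obtain out where
    out: "evals (program k) ?\<rho> (searchE k) out ((N * N + 1) * node_time N ^ Suc D + search_time k N) (Suc D)"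
    "colorable S \<longrightarrow> (\<exists>\<chi>. proper S \<chi> \<and> out = Pair NIL (enc_list (map (\<lambda>v. enc_nat (Suc (\<chi> v))) [0..<n])))"
    "\<not> colorable S \<longrightarrow> out = NIL" by blast
  have a: "evals (program k) ?\<rho> (Hd (Var 0)) (mat n k (\<lambda>v i. i \<in> S v)) 2 (Suc D)"
    using evals_Hd[OF evals_Var[of 0 ?\<rho> "?\<rho> ! 0"] refl] by (simp add: numeral_2_eq_2)
  have b: "evals (program k) ?\<rho> (Hd (Tl (Var 0))) (hd_s (mat m n (\<lambda>h v. v \<in> I h))) 3 (Suc D)"
    using evals_Hd[OF evals_Tl[OF evals_Var[of 0 ?\<rho> "?\<rho> ! 0"] refl] refl] by (simp add: eval_nat_numeral)
  have "evals (program k) ?\<rho> (Cond (Hd (Var 0)) Nl (Hd (Tl (Var 0)))) NIL (2 + 1 + 3 + 1) (Suc D)"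
  proof (rule evals_Cond[OF a evals_Nl])
    assume "mat n k (\<lambda>v i. i \<in> S v) = NIL"
    then have "n = 0" by (cases n) (auto simp: mat_def upt_rec simp del: upt_Suc)
    then have "hd_s (mat m n (\<lambda>h v. v \<in> I h)) = NIL"
      by (cases m) (auto simp: mat_def upt_rec simp del: upt_Suc)
    with b show "evals (program k) ?\<rho> (Hd (Tl (Var 0))) NIL 3 (Suc D)" by simp
  qed
  from evals_CondF[OF this out(1), of decideE] have
    "evals (program k) ?\<rho> (program k) out ((N * N + 1) * node_time N ^ Suc D + search_time k N + 20) (Suc D)"
    unfolding program_def[symmetric] by (rule evals_mono) auto
  with out(2,3) show ?thesis by blast
qed

end

subsection \<open>Growth of the bounds\<close>

definition poly_bounded :: "(nat \<Rightarrow> nat) \<Rightarrow> bool" where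
  "poly_bounded f \<longleftrightarrow> (\<exists>a b. \<forall>N. f N \<le> a * (N + 1) ^ b)"

lemma poly_bounded_const: "poly_bounded (\<lambda>_. C)"
  unfolding poly_bounded_def by (rule exI[of _ C], rule exI[of _ 0]) simp

lemma poly_bounded_id: "poly_bounded (\<lambda>N. N)"
  unfolding poly_bounded_def by (rule exI[of _ 1], rule exI[of _ 1]) simp

lemma poly_bounded_add:
  assumes "poly_bounded f" "poly_bounded g" shows "poly_bounded (\<lambda>N. f N + g N)"
proof -
  obtain a b a' b' where f: "\<And>N. f N \<le> a * (N + 1) ^ b" and g: "\<And>N. g N \<le> a' * (N + 1) ^ b'"
    using assms unfolding poly_bounded_def by blast
  have "f N + g N \<le> (a + a') * (N + 1) ^ (b + b')" for N
  proof -
    have "a * (N + 1) ^ b \<le> a * (N + 1) ^ (b + b')" "a' * (N + 1) ^ b' \<le> a' * (N + 1) ^ (b + b')"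
      by (intro mult_left_mono power_increasing; simp)+
    then show ?thesis using f[of N] g[of N] unfolding add_mult_distrib by linarith
  qed
  then show ?thesis unfolding poly_bounded_def by blast
qed

lemma poly_bounded_mult:
  assumes "poly_bounded f" "poly_bounded g" shows "poly_bounded (\<lambda>N. f N * g N)"
proof -
  obtain a b a' b' where f: "\<And>N. f N \<le> a * (N + 1) ^ b" and g: "\<And>N. g N \<le> a' * (N + 1) ^ b'"
    using assms unfolding poly_bounded_def by blast
  have "f N * g N \<le> (a * a') * (N + 1) ^ (b + b')" for N
    using mult_mono[OF f[of N] g[of N]] by (simp add: power_add algebra_simps)
  then show ?thesis unfolding poly_bounded_def by blast
qed

lemmas poly_bounded_intros =
  poly_bounded_add poly_bounded_mult poly_bounded_const poly_bounded_id

lemma poly_bounded_tb: "poly_bounded (tb e)"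
  by (induction e) (auto intro!: poly_bounded_intros)

lemma poly_bounded_upd_time: "poly_bounded (upd_time e)"
  unfolding upd_time_def by (intro poly_bounded_intros poly_bounded_tb)

lemma poly_bounded_step_time: "poly_bounded step_time"
  unfolding step_time_def by (intro poly_bounded_intros poly_bounded_tb poly_bounded_upd_time)

lemma poly_bounded_node_time: "poly_bounded node_time"
  unfolding node_time_def by (intro poly_bounded_intros poly_bounded_step_time)

lemma poly_bounded_search_time: "poly_bounded (search_time k)"
  unfolding search_time_def
  by (intro poly_bounded_intros poly_bounded_tb poly_bounded_upd_time)

section \<open>Closure properties of polylogarithmic bounds\<close>

lemma log_ge_1: "1 \<le> log 2 (real (m + n + 2))"
  by (subst le_log_iff) auto

lemma polylog_mono: "polylog g \<Longrightarrow> (\<And>m n. f m n \<le> g m n) \<Longrightarrow> polylog f"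
  unfolding polylog_def by (meson order_trans)

lemma polylog_log: "polylog (\<lambda>m n. log 2 (real (m + n + 2)))"
  unfolding polylog_def by (rule exI[of _ 1], rule exI[of _ 1]) simp

lemma polylog_const: "polylog (\<lambda>m n. C)"
  unfolding polylog_def by (rule exI[of _ C], rule exI[of _ 0]) simp

lemma polylog_nonneg_coeff:
  assumes "polylog f" obtains A a where "A \<ge> 0" "\<And>m n. f m n \<le> A * log 2 (real (m + n + 2)) ^ a"
proof -
  obtain A a where A: "\<And>m n. f m n \<le> A * log 2 (real (m + n + 2)) ^ a"
    using assms unfolding polylog_def by blast
  have "f m n \<le> \<bar>A\<bar> * log 2 (real (m + n + 2)) ^ a" for m n
  proof -
    have "A * log 2 (real (m + n + 2)) ^ a \<le> \<bar>A\<bar> * log 2 (real (m + n + 2)) ^ a"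
      using log_ge_1[of m n] by (intro mult_right_mono zero_le_power) auto
    with A[of m n] show ?thesis by linarith
  qed
  then show ?thesis using that[of "\<bar>A\<bar>" a] by simp
qed

lemma polylog_add:
  assumes "polylog f" "polylog g" shows "polylog (\<lambda>m n. f m n + g m n)"
proof -
  obtain A a where f: "A \<ge> 0" "\<And>m n. f m n \<le> A * log 2 (real (m + n + 2)) ^ a"
    using polylog_nonneg_coeff[OF assms(1)] by blast
  obtain B b where g: "B \<ge> 0" "\<And>m n. g m n \<le> B * log 2 (real (m + n + 2)) ^ b"
    using polylog_nonneg_coeff[OF assms(2)] by blast
  have "f m n + g m n \<le> (A + B) * log 2 (real (m + n + 2)) ^ (a + b)" for m n
  proof -
    let ?l = "log 2 (real (m + n + 2))"
    have "A * ?l ^ a \<le> A * ?l ^ (a + b)" "B * ?l ^ b \<le> B * ?l ^ (a + b)"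
      using f(1) g(1) log_ge_1[of m n] by (intro mult_left_mono power_increasing; simp)+
    then show ?thesis using f(2)[of m n] g(2)[of m n] unfolding distrib_right by linarith
  qed
  then show ?thesis unfolding polylog_def by blast
qed

lemma polylog_mult:
  assumes "polylog f" "polylog g" "\<And>m n. 0 \<le> f m n" "\<And>m n. 0 \<le> g m n"
  shows "polylog (\<lambda>m n. f m n * g m n)"
proof -
  obtain A a where f: "A \<ge> 0" "\<And>m n. f m n \<le> A * log 2 (real (m + n + 2)) ^ a"
    using polylog_nonneg_coeff[OF assms(1)] by blast
  obtain B b where g: "B \<ge> 0" "\<And>m n. g m n \<le> B * log 2 (real (m + n + 2)) ^ b"
    using polylog_nonneg_coeff[OF assms(2)] by blast
  have "f m n * g m n \<le> (A * B) * log 2 (real (m + n + 2)) ^ (a + b)" for m n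
  proof -
    have "f m n * g m n \<le> (A * log 2 (real (m + n + 2)) ^ a) * (B * log 2 (real (m + n + 2)) ^ b)"
      using f g assms(3,4) log_ge_1[of m n] by (intro mult_mono) auto
    then show ?thesis by (simp add: power_add algebra_simps)
  qed
  then show ?thesis unfolding polylog_def by blast
qed

text \<open>\<open>rate\<close> times the largest possible potential, for
  \<open>s = lg m + Suc k\<close> and intersection constant \<open>Suc (c m n)\<close>. Every
  recursive call of the decision procedure consumes one unit of it.\<close>

definition depth_bound :: "nat \<Rightarrow> (nat \<Rightarrow> nat \<Rightarrow> nat) \<Rightarrow> nat \<Rightarrow> nat \<Rightarrow> nat" where
  "depth_bound k c m n = nat \<lfloor>3 * real (lg m + Suc k) * real (Suc (c m n)) * (real k * ln (real (m + Suc (c m n))))\<rfloor>"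

definition size_bound :: "nat \<Rightarrow> nat \<Rightarrow> nat \<Rightarrow> nat" where
  "size_bound k m n = n + k + m + (lg m + Suc k) + 1"

definition time_bound :: "nat \<Rightarrow> (nat \<Rightarrow> nat \<Rightarrow> nat) \<Rightarrow> nat \<Rightarrow> nat \<Rightarrow> nat" where
  "time_bound k c m n = (let N = size_bound k m n in
     (N * N + 1) * node_time N ^ Suc (depth_bound k c m n) + search_time k N + 20)"

lemma lg_le_log: "real (lg m) \<le> log 2 (real (m + n + 2))"
proof -
  have "2 ^ lg m \<le> m + n + 2" using lg_bounds[of m] by linarith
  then have "2 ^ lg m \<le> real (m + n + 2)" by (metis of_nat_le_iff of_nat_numeral of_nat_power)
  then show ?thesis by (subst le_log_iff) (auto simp: powr_realpow)
qed

lemma polylog_depth_bound: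
  assumes "polylog (\<lambda>m n. real (c m n))"
  shows "polylog (\<lambda>m n. real (depth_bound k c m n))"
proof (rule polylog_mono)
  let ?l = "\<lambda>m n. log 2 (real (m + n + 2))"
  have l: "0 \<le> ?l m n" for m n using log_ge_1[of m n] by linarith
  show "polylog (\<lambda>m n. 3 * (?l m n + real (Suc k)) * (real (c m n) + 1) * (real k * (?l m n + real (c m n))))"
    using l by (intro polylog_mult polylog_add polylog_const polylog_log assms mult_nonneg_nonneg) auto
  fix m n
  let ?C = "real (Suc (c m n))"
  \<comment> \<open>Replacing the sum by a product splits off the logarithm of the intersection
    constant. It is itself bounded crudely by \<open>c m n\<close>, which is polylogarithmic
    already.\<close>
  have "ln (real (m + Suc (c m n))) \<le> ln (real (m + n + 2) * ?C)"
  proof (rule ln_mono)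
    have "m + Suc (c m n) \<le> (m + n + 2) * Suc (c m n)" by (simp add: algebra_simps)
    then show "real (m + Suc (c m n)) \<le> real (m + n + 2) * ?C"
      by (metis of_nat_le_iff of_nat_mult)
  qed auto
  also have "\<dots> = ln (real (m + n + 2)) + ln (?C)" by (subst ln_mult) auto
  also have "ln (real (m + n + 2)) \<le> ?l m n"
  proof -
    have "ln (2::real) \<le> 1" using ln_le_minus_one[of "2::real"] by simp
    moreover have "0 \<le> ln (real (m + n + 2))" by simp
    ultimately have "ln (real (m + n + 2)) * ln 2 \<le> ln (real (m + n + 2))" by (rule mult_left_le)
    then show ?thesis unfolding log_def by (simp add: field_simps)
  qed
  also have "ln ?C \<le> real (c m n)" using ln_le_minus_one[of ?C] by simp
  finally have ln: "ln (real (m + Suc (c m n))) \<le> ?l m n + real (c m n)" by simp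
  have "real (depth_bound k c m n) \<le> 3 * real (lg m + Suc k) * ?C * (real k * ln (real (m + Suc (c m n))))"
    unfolding depth_bound_def by (subst of_nat_nat) auto
  also have "\<dots> \<le> 3 * (?l m n + real (Suc k)) * (real (c m n) + 1) * (real k * (?l m n + real (c m n)))"
    using l[of m n] ln lg_le_log[of m n] by (intro mult_mono) auto
  finally show "real (depth_bound k c m n)
    \<le> 3 * (?l m n + real (Suc k)) * (real (c m n) + 1) * (real k * (?l m n + real (c m n)))" .
qed

text \<open>A polynomial \<open>X\<close> dominates all ingredients, so the time is at most
  \<open>X ^ (d + 3)\<close>: exponent \<open>d + 1\<close> for the decision calls, one factor for
  the number of calls made by the search, and one to absorb the remaining sum. Then
  \<open>log 2 X\<close> is logarithmic and the exponent of 2 polylogarithmic.\<close>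

lemma quasi_poly_time_bound:
  assumes "polylog (\<lambda>m n. real (c m n))"
  shows "quasi_poly (\<lambda>m n. real (time_bound k c m n))"
proof -
  define X where "X N = node_time N + (N * N + 1) + search_time k N + 22" for N
  have "poly_bounded X" unfolding X_def
    by (intro poly_bounded_intros poly_bounded_node_time poly_bounded_search_time)
  then obtain a b where ab: "\<And>N. X N \<le> a * (N + 1) ^ b" unfolding poly_bounded_def by blast
  have a: "a > 0" using ab[of 0] unfolding X_def by (cases a) auto
  let ?l = "\<lambda>m n. log 2 (real (m + n + 2))"
  define G where "G m n = log 2 (real a) + real b * (log 2 (real (2 * k + 4)) + ?l m n)" for m n
  define g where "g m n = (real (depth_bound k c m n) + 3) * G m n" for m n
  have l: "0 \<le> ?l m n" for m n using log_ge_1[of m n] by linarith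
  have G0: "0 \<le> G m n" for m n using a l[of m n] unfolding G_def by (auto simp: zero_le_log_cancel_iff)
  have "polylog G" unfolding G_def
    by (intro polylog_mult polylog_add polylog_const polylog_log) (use l in auto)
  then have "polylog g" unfolding g_def
    by (intro polylog_mult polylog_add polylog_const polylog_depth_bound[OF assms]) (use G0 in auto)
  moreover have "real (time_bound k c m n) \<le> 2 powr g m n" for m n
  proof -
    define N where "N = size_bound k m n"
    define d where "d = depth_bound k c m n"
    have X2: "2 \<le> X N" unfolding X_def by simp
    then have X1: "1 \<le> X N ^ e" for e by (intro one_le_power) simp
    have "(N * N + 1) * node_time N ^ Suc d \<le> X N * X N ^ Suc d"
      by (intro mult_mono power_mono) (auto simp: X_def)
    moreover have "search_time k N + 20 \<le> X N * X N ^ Suc d"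
    proof -
      have "search_time k N + 20 \<le> X N * 1" by (simp add: X_def)
      also have "\<dots> \<le> X N * X N ^ Suc d" by (intro mult_left_mono X1) simp
      finally show ?thesis .
    qed
    ultimately have "time_bound k c m n \<le> 2 * (X N * X N ^ Suc d)"
      unfolding time_bound_def Let_def N_def[symmetric] d_def[symmetric] by linarith
    also have "\<dots> \<le> X N * (X N * X N ^ Suc d)" using X2 by (intro mult_right_mono) auto
    also have "\<dots> = X N ^ (d + 3)" by (simp add: eval_nat_numeral)
    finally have "real (time_bound k c m n) \<le> real (X N) ^ (d + 3)"
      by (metis of_nat_le_iff of_nat_power)
    also have "\<dots> = 2 powr (log 2 (real (X N)) * (real d + 3))"
      using X2 by (simp add: powr_powr[symmetric] powr_realpow[symmetric] add.commute)
    also have "\<dots> \<le> 2 powr g m n"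
    proof -
      \<comment> \<open>Here \<open>N + 1 = n + m + lg m + 2 * k + 3\<close>. The factor
        \<open>2 * k + 4\<close> separates the constant \<open>k\<close> from the size of the
        input.\<close>
      have "lg m \<le> m" using lg_bounds[of m] less_exp[of "lg m"] by linarith
      then have "N + 1 \<le> (2 * k + 4) * (m + n + 2)" unfolding N_def size_bound_def
        by (simp add: algebra_simps)
      then have "a * (N + 1) ^ b \<le> a * ((2 * k + 4) * (m + n + 2)) ^ b"
        by (intro mult_left_mono power_mono) auto
      then have "X N \<le> a * ((2 * k + 4) * (m + n + 2)) ^ b" using ab[of N] by linarith
      then have "real (X N) \<le> real a * (real (2 * k + 4) * real (m + n + 2)) ^ b"
        by (metis of_nat_le_iff of_nat_mult of_nat_power)
      then have "log 2 (real (X N)) \<le> log 2 (real a * (real (2 * k + 4) * real (m + n + 2)) ^ b)"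
        using X2 by (intro log_mono) auto
      also have "\<dots> = G m n" unfolding G_def using a
        by (subst log_mult) (auto simp: log_nat_power log_mult zero_less_mult_iff simp del: of_nat_add of_nat_mult)
      finally show ?thesis unfolding g_def d_def[symmetric]
        using G0[of m n] by (intro powr_mono) (auto simp: mult.commute mult_left_mono)
    qed
    finally show ?thesis .
  qed
  ultimately show ?thesis unfolding quasi_poly_def by blast
qed

subsection \<open>From instances to indices\<close>

text \<open>At most one color occurs on \<open>H\<close> exactly if some \<open>i\<close> covers all
  of \<open>H\<close>. For empty \<open>H\<close> both sides fail, the right one because
  \<open>k \<ge> 1\<close> supplies a color.\<close>

lemma two_colors_iff:
  assumes "finite H" "\<chi> ` H \<subseteq> {1..k}" "k \<ge> 1"
  shows "card (\<chi> ` H) \<ge> 2 \<longleftrightarrow> (\<forall>i<k. \<exists>v\<in>H. \<chi> v \<noteq> Suc i)"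
proof
  assume c: "card (\<chi> ` H) \<ge> 2"
  show "\<forall>i<k. \<exists>v\<in>H. \<chi> v \<noteq> Suc i"
  proof (rule ccontr)
    assume "\<not> ?thesis"
    then obtain i where "\<chi> ` H \<subseteq> {Suc i}" by auto
    then have "card (\<chi> ` H) \<le> card {Suc i}" by (intro card_mono) auto
    with c show False by simp
  qed
next
  assume all: "\<forall>i<k. \<exists>v\<in>H. \<chi> v \<noteq> Suc i"
  then obtain v where v: "v \<in> H" using assms(3) by force
  then have "\<chi> v \<in> {1..k}" using assms(2) by blast
  then obtain i where i: "i < k" "\<chi> v = Suc i" by (cases "\<chi> v") auto
  then obtain u where u: "u \<in> H" "\<chi> u \<noteq> \<chi> v" using all by auto
  have "card {\<chi> u, \<chi> v} \<le> card (\<chi> ` H)" using assms(1) u v by (intro card_mono) auto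
  then show "card (\<chi> ` H) \<ge> 2" using u by simp
qed

text \<open>Vertices and edges are replaced by their positions in \<open>vs\<close> and
  \<open>es\<close>, and colors are lowered by one. The depth exceeds that of the decision procedure
  by one because the search sits on top of it.\<close>

lemma program_solves:
  assumes "k \<ge> 2"
  shows "solves_proper_list_coloring (program k) k c (\<lambda>m n. real (time_bound k c m n))
    (\<lambda>m n. real (depth_bound k c m n) + 1)"
  unfolding solves_proper_list_coloring_def
proof (intro allI impI)
  fix V :: "nat set" and E L vs es
  assume A: "coloring_instance k V E L \<and> c_intersecting (c (card E) (card V)) E \<and>
    distinct vs \<and> set vs = V \<and> distinct es \<and> set es = E"
  define n where "n = length vs"
  define m where "m = length es"
  have card: "card V = n" "card E = m" using A distinct_card n_def m_def by metis+
  \<comment> \<open>The successor makes the constant positive, so the logarithms in the potential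
    are nonnegative even if no edge is live.\<close>
  define C where "C = Suc (c m n)"
  define I where "I h = {v. v < n \<and> vs ! v \<in> es ! h}" for h
  define S where "S v = {i. Suc i \<in> L (vs ! v)}" for v
  define s where "s = lg m + Suc k"
  have EV: "es ! h \<subseteq> set vs" if "h < m" for h
    using A that nth_mem[of h es] unfolding coloring_instance_def m_def by blast
  have I_img: "es ! h = (!) vs ` I h" if "h < m" for h
    using EV[OF that] unfolding I_def n_def by (auto simp: in_set_conv_nth subset_iff)
  have disj: "I h \<inter> I h' = {} \<longleftrightarrow> es ! h \<inter> es ! h' = {}" if "h < m" "h' < m" for h h'
    using EV[OF that(1)] unfolding I_def n_def by (auto simp: in_set_conv_nth subset_iff)
  interpret intersecting_hypergraph n k m s I C
  proof
    show "I h \<subseteq> {..<n}" for h unfolding I_def by auto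
    show "C > 0" "s > 0" by (auto simp: C_def s_def)
    fix h assume h: "h < m"
    have "(!) es ` {h'. h' < m \<and> I h \<inter> I h' = {}} \<subseteq> {H'\<in>E. es ! h \<inter> H' = {}}"
      using disj[OF h] A m_def by auto
    moreover have "finite {H'\<in>E. es ! h \<inter> H' = {}}" using A by auto
    ultimately have "card ((!) es ` {h'. h' < m \<and> I h \<inter> I h' = {}}) \<le> card {H'\<in>E. es ! h \<inter> H' = {}}"
      by (intro card_mono)
    moreover have "inj_on ((!) es) {h'. h' < m \<and> I h \<inter> I h' = {}}"
      using A by (intro inj_on_nth) (auto simp: m_def)
    moreover have "card {H'\<in>E. es ! h \<inter> H' = {}} \<le> c m n"
      using A h card unfolding c_intersecting_def m_def by auto
    ultimately show "card {h'. h' < m \<and> I h \<inter> I h' = {}} \<le> C"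
      unfolding C_def by (simp add: card_image)
  qed
  have inp: "enc_instance k vs es L = Pair (mat n k (\<lambda>v i. i \<in> S v)) (mat m n (\<lambda>h v. v \<in> I h))"
  proof -
    have "map (\<lambda>v. enc_list (map (\<lambda>i. enc_bool (i \<in> L v)) [1..<k + 1])) vs
      = map (\<lambda>v. enc_list (map (\<lambda>i. enc_bool (i \<in> S v)) [0..<k])) [0..<n]"
    proof (rule nth_equalityI)
      have "map (\<lambda>i. enc_bool (i \<in> L v)) [1..<k + 1] = map (\<lambda>i. enc_bool (Suc i \<in> L v)) [0..<k]" for v
        by (rule nth_equalityI) (auto simp del: upt_Suc)
      then show "map (\<lambda>v. enc_list (map (\<lambda>i. enc_bool (i \<in> L v)) [1..<k + 1])) vs ! j
        = map (\<lambda>v. enc_list (map (\<lambda>i. enc_bool (i \<in> S v)) [0..<k])) [0..<n] ! j"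
        if "j < length (map (\<lambda>v. enc_list (map (\<lambda>i. enc_bool (i \<in> L v)) [1..<k + 1])) vs)" for j
        using that unfolding S_def n_def by (simp del: upt_Suc)
    qed (simp add: n_def)
    moreover have "map (\<lambda>H. enc_list (map (\<lambda>v. enc_bool (v \<in> H)) vs)) es
      = map (\<lambda>h. enc_list (map (\<lambda>v. enc_bool (v \<in> I h)) [0..<n])) [0..<m]"
      unfolding I_def n_def m_def by (rule nth_equalityI) (auto intro!: arg_cong[of _ _ enc_list] nth_equalityI)
    ultimately show ?thesis unfolding enc_instance_def mat_def by simp
  qed
  have col: "proper_list_coloring k (set vs) E L \<chi>' \<longleftrightarrow> proper S (\<lambda>v. \<chi>' (vs ! v) - 1)"
    if range: "\<chi>' ` set vs \<subseteq> {1..k}" for \<chi>'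
  proof -
    have r: "\<chi>' (vs ! v) \<in> {1..k}" if "v < n" for v
      using range that by (metis image_subset_iff n_def nth_mem)
    have "list_coloring k (set vs) L \<chi>' \<longleftrightarrow> (\<forall>v<n. \<chi>' (vs ! v) \<in> L (vs ! v))"
    proof -
      have "\<chi>' \<in> set vs \<rightarrow> {1..k}" using range by auto
      then show ?thesis unfolding list_coloring_def n_def by (metis in_set_conv_nth)
    qed
    also have "\<dots> \<longleftrightarrow> (\<forall>v<n. \<chi>' (vs ! v) - 1 < k \<and> \<chi>' (vs ! v) - 1 \<in> S v)"
    proof -
      have "\<chi>' (vs ! v) \<in> L (vs ! v) \<longleftrightarrow> \<chi>' (vs ! v) - 1 < k \<and> \<chi>' (vs ! v) - 1 \<in> S v" if "v < n" for v
        using r[OF that] by (cases "\<chi>' (vs ! v)") (auto simp: S_def)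
      then show ?thesis by blast
    qed
    finally have 1: "list_coloring k (set vs) L \<chi>' \<longleftrightarrow> (\<forall>v<n. \<chi>' (vs ! v) - 1 < k \<and> \<chi>' (vs ! v) - 1 \<in> S v)" .
    have "card (\<chi>' ` (es ! h)) \<ge> 2 \<longleftrightarrow> (\<forall>i<k. \<exists>v\<in>I h. \<chi>' (vs ! v) - 1 \<noteq> i)" if h: "h < m" for h
    proof -
      have "card (\<chi>' ` (es ! h)) \<ge> 2 \<longleftrightarrow> (\<forall>i<k. \<exists>v\<in>es ! h. \<chi>' v \<noteq> Suc i)"
        by (rule two_colors_iff) (use EV[OF h] range assms in \<open>auto intro: finite_subset\<close>)
      also have "\<dots> \<longleftrightarrow> (\<forall>i<k. \<exists>v\<in>I h. \<chi>' (vs ! v) \<noteq> Suc i)"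
        unfolding I_img[OF h] by simp
      also have "\<dots> \<longleftrightarrow> (\<forall>i<k. \<exists>v\<in>I h. \<chi>' (vs ! v) - 1 \<noteq> i)"
      proof -
        have "\<chi>' (vs ! v) \<noteq> Suc i \<longleftrightarrow> \<chi>' (vs ! v) - 1 \<noteq> i" if "v \<in> I h" for v i
          using r[of v] that unfolding I_def by (cases "\<chi>' (vs ! v)") auto
        then show ?thesis by blast
      qed
      finally show ?thesis .
    qed
    moreover have "(\<forall>H\<in>E. card (\<chi>' ` H) \<ge> 2) \<longleftrightarrow> (\<forall>h<m. card (\<chi>' ` (es ! h)) \<ge> 2)"
      using A m_def by (metis in_set_conv_nth)
    ultimately show ?thesis unfolding proper_list_coloring_def proper_def 1 by simp
  qed
  have ex: "(\<exists>\<chi>'. proper_list_coloring k (set vs) E L \<chi>') \<Longrightarrow> colorable S"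
  proof -
    assume "\<exists>\<chi>'. proper_list_coloring k (set vs) E L \<chi>'"
    then obtain \<chi>' where \<chi>': "proper_list_coloring k (set vs) E L \<chi>'" by blast
    then have "\<chi>' ` set vs \<subseteq> {1..k}" unfolding proper_list_coloring_def list_coloring_def by auto
    from col[OF this] \<chi>' show "colorable S" unfolding colorable_def by blast
  qed
  have dec: "\<exists>\<chi>'. proper_list_coloring k (set vs) E L \<chi>' \<and>
      Pair NIL (enc_list (map (\<lambda>v. enc_nat (Suc (\<chi> v))) [0..<n])) = enc_coloring vs \<chi>'"
    if \<chi>: "proper S \<chi>" for \<chi>
  proof -
    define \<chi>' where "\<chi>' x = Suc (\<chi> (SOME j. j < n \<and> vs ! j = x))" for x
    have \<chi>'v: "\<chi>' (vs ! v) = Suc (\<chi> v)" if "v < n" for v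
    proof -
      have "(SOME j. j < n \<and> vs ! j = vs ! v) = v"
        by (rule some_equality) (use that A n_def in \<open>auto simp: nth_eq_iff_index_eq\<close>)
      then show ?thesis unfolding \<chi>'_def by simp
    qed
    have "\<chi>' ` set vs \<subseteq> {1..k}"
    proof
      fix i assume "i \<in> \<chi>' ` set vs"
      then obtain v where "v < n" "i = \<chi>' (vs ! v)" unfolding n_def by (auto simp: in_set_conv_nth)
      then show "i \<in> {1..k}" using \<chi>'v \<chi> unfolding proper_def by (simp add: Suc_le_eq)
    qed
    from col[OF this] have "proper_list_coloring k (set vs) E L \<chi>' \<longleftrightarrow> proper S \<chi>"
      using \<chi>'v I_sub unfolding proper_def by (auto simp: I_def)
    moreover have "map (\<lambda>v. enc_nat (Suc (\<chi> v))) [0..<n] = map (\<lambda>v. enc_nat (\<chi>' v)) vs"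
      using \<chi>'v by (intro nth_equalityI) (auto simp: n_def)
    ultimately show ?thesis using \<chi> unfolding enc_coloring_def by auto
  qed
  define N where "N = size_bound k m n"
  define d where "d = depth_bound k c m n"
  \<comment> \<open>Rounding down leaves the real bound strictly below \<open>d + 1\<close>, which
    is all the induction on the depth asks for.\<close>
  have D: "rate * (real k * ln (real (m + C))) < real d + 1"
  proof -
    have "3 * real (lg m + Suc k) * real (Suc (c m n)) * (real k * ln (real (m + Suc (c m n)))) = rate * (real k * ln (real (m + C)))"
      unfolding rate_def unfolding s_def C_def ..
    then have "d = nat \<lfloor>rate * (real k * ln (real (m + C)))\<rfloor>" unfolding d_def depth_bound_def by (simp only:)
    then show ?thesis by linarith
  qed
  have "\<exists>out. evals (program k) [enc_instance k vs es L] (program k) out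
      ((N * N + 1) * node_time N ^ Suc d + search_time k N + 20) (Suc d) \<and>
    (colorable S \<longrightarrow> (\<exists>\<chi>. proper S \<chi> \<and> out = Pair NIL (enc_list (map (\<lambda>v. enc_nat (Suc (\<chi> v))) [0..<n])))) \<and>
    (\<not> colorable S \<longrightarrow> out = NIL)"
    unfolding inp by (rule evals_program[OF _ _ _ _ _ s_def D]) (auto simp: N_def size_bound_def s_def)
  then obtain out t d' where r: "runs (program k) [enc_instance k vs es L] (program k) out t d'"
    "t \<le> (N * N + 1) * node_time N ^ Suc d + search_time k N + 20" "d' \<le> Suc d"
    "colorable S \<longrightarrow> (\<exists>\<chi>. proper S \<chi> \<and> out = Pair NIL (enc_list (map (\<lambda>v. enc_nat (Suc (\<chi> v))) [0..<n])))"
    "\<not> colorable S \<longrightarrow> out = NIL" unfolding evals_def by blast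
  have "correct_answer k vs E L out"
  proof (cases "colorable S")
    case True
    then obtain \<chi> where "proper S \<chi>" "out = Pair NIL (enc_list (map (\<lambda>v. enc_nat (Suc (\<chi> v))) [0..<n]))"
      using r(4) by blast
    then show ?thesis using dec[of \<chi>] unfolding correct_answer_def by metis
  next
    case False
    then show ?thesis using r(5) ex unfolding correct_answer_def by blast
  qed
  moreover have "real t \<le> real (time_bound k c m n)"
    using r(2) unfolding time_bound_def Let_def N_def[symmetric] d_def[symmetric] by (simp only: of_nat_le_iff)
  moreover have "real d' \<le> real (depth_bound k c m n) + 1" using r(3) unfolding d_def by linarith
  ultimately show "\<exists>out t d. runs (program k) [enc_instance k vs es L] (program k) out t d \<and>
    correct_answer k vs E L out \<and> real t \<le> real (time_bound k c (card E) (card V)) \<and>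
    real d \<le> real (depth_bound k c (card E) (card V)) + 1"
    using r(1) unfolding card by blast
qed

theorem theorem1:
  fixes k :: nat and c :: "nat \<Rightarrow> nat \<Rightarrow> nat"
  assumes "k \<ge> 2"
    and "polylog (\<lambda>m n. real (c m n))"
  shows "\<exists>p T D. quasi_poly T \<and> polylog D \<and> solves_proper_list_coloring p k c T D"
proof (intro exI conjI)
  show "quasi_poly (\<lambda>m n. real (time_bound k c m n))"
    by (rule quasi_poly_time_bound[OF assms(2)])
  show "polylog (\<lambda>m n. real (depth_bound k c m n) + 1)"
    by (intro polylog_add polylog_const polylog_depth_bound[OF assms(2)])
  show "solves_proper_list_coloring (program k) k c (\<lambda>m n. real (time_bound k c m n))
    (\<lambda>m n. real (depth_bound k c m n) + 1)"
    by (rule program_solves[OF assms(1)])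
qed

end
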